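(* The decision problem RP(Max-M) (the response problem for maximum-weight matching on general graphs) is fixed-parameter tractable with respect to the parameter $|I_0|+|I_*|$ (the total number of forbidden and neutral edges).
   Context: RP(Max-M) is the following decision problem. Given: a finite undirected graph $G=(V,E)$, a partition $E=I_\ell\,\dot\cup\,I_f$ of its edge set into leader's edges $I_\ell$ and follower's edges $I_f$, a follower's weight function $d\colon I_f\to\mathbb{Q}$, and a partition $I_f=I_0\,\dot\cup\,I_1\,\dot\cup\,I_*$ into forbidden edges $I_0$, mandatory edges $I_1$ and neutral edges $I_*$ (parts may be empty). For $X\subseteq I_\ell$, a feasible follower's reaction to $X$ is a set $Y\subseteq I_f$ such that $X\cup Y$ is a matching of $G$; it is an optimal reaction if it maximizes $d(Y)=\sum_{e\in Y}d(e)$ among all feasible reactions to $X$. Question: does there exist $X\subseteq I_\ell$ for which there is an optimal follower's reaction $Y$ to $X$ with $I_0\cap Y=\emptyset$ and $I_1\subseteq Y$? (This is the optimistic setting.) Fixed-parameter tractable with respect to a parameter $k$ means solvable in time $f(k)\cdot n^{O(1)}$ for some computable function $f$, where $n$ is the input size. *)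

theory Defs
  imports Complex_Main "HOL-Library.Disjoint_Sets"
begin

section \<open>Computation model\<close>

text \<open>
  The model is a first-order, call-by-value functional language over binary trees (LISP with
  the empty list as its only atom), in the style of N. D. Jones, Computability and Complexity
  (MIT Press, 1997). A program is a finite list of function bodies; its input and its result are
  trees. Every evaluation step copies a pointer, allocates one cell, follows one pointer, tests
  for the empty tree, or enters one of the finitely many functions. So unit cost per step is
  realistic, and running times agree with those of Turing machines up to a polynomial. In
  particular, the language has no arithmetic on numbers: it must be programmed on bit lists.
\<close>

datatype tree = Leaf | Node tree tree

fun tree_size :: "tree \<Rightarrow> nat" where
  "tree_size Leaf = 1"
| "tree_size (Node a b) = tree_size a + tree_size b + 1"

fun left_tree :: "tree \<Rightarrow> tree" where
  "left_tree Leaf = Leaf"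
| "left_tree (Node a b) = a"

fun right_tree :: "tree \<Rightarrow> tree" where
  "right_tree Leaf = Leaf"
| "right_tree (Node a b) = b"

datatype expr =
    Param nat
  | Empty
  | Join expr expr
  | LeftOf expr
  | RightOf expr
  | Cond expr expr expr
  | Call nat "expr list"

type_synonym program = "expr list"

text \<open>
  \<^term>\<open>eval P env e v t\<close>: with the arguments \<^term>\<open>env\<close> of the function being executed, the expression
  \<^term>\<open>e\<close> evaluates to \<^term>\<open>v\<close> in exactly \<^term>\<open>t\<close> steps. Diverging and ill-formed expressions (undefined
  argument or function) have no derivation. In \<^term>\<open>Cond\<close> the empty tree is the truth value false.
\<close>

inductive eval :: "program \<Rightarrow> tree list \<Rightarrow> expr \<Rightarrow> tree \<Rightarrow> nat \<Rightarrow> bool"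
  and evals :: "program \<Rightarrow> tree list \<Rightarrow> expr list \<Rightarrow> tree list \<Rightarrow> nat \<Rightarrow> bool"
  for P :: program
where
  eval_Param: "i < length env \<Longrightarrow> eval P env (Param i) (env ! i) 1"
| eval_Empty: "eval P env Empty Leaf 1"
| eval_Join: "eval P env a v s \<Longrightarrow> eval P env b w t \<Longrightarrow> eval P env (Join a b) (Node v w) (s + t + 1)"
| eval_LeftOf: "eval P env a v t \<Longrightarrow> eval P env (LeftOf a) (left_tree v) (t + 1)"
| eval_RightOf: "eval P env a v t \<Longrightarrow> eval P env (RightOf a) (right_tree v) (t + 1)"
| eval_Cond_true: "eval P env c u s \<Longrightarrow> u \<noteq> Leaf \<Longrightarrow> eval P env a v t \<Longrightarrow>
    eval P env (Cond c a b) v (s + t + 1)"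
| eval_Cond_false: "eval P env c Leaf s \<Longrightarrow> eval P env b v t \<Longrightarrow>
    eval P env (Cond c a b) v (s + t + 1)"
| eval_Call: "evals P env as vs s \<Longrightarrow> i < length P \<Longrightarrow> eval P vs (P ! i) v t \<Longrightarrow>
    eval P env (Call i as) v (s + t + 1)"
| evals_Nil: "evals P env [] [] 0"
| evals_Cons: "eval P env a v s \<Longrightarrow> evals P env as vs t \<Longrightarrow> evals P env (a # as) (v # vs) (s + t)"

inductive_cases eval_elims:
  "eval P env (Param i) v t" "eval P env Empty v t" "eval P env (Join a b) v t"
  "eval P env (LeftOf a) v t" "eval P env (RightOf a) v t" "eval P env (Cond c a b) v t"
  "eval P env (Call i as) v t" "evals P env [] vs t" "evals P env (a # as) vs t"

lemma eval_deterministic: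
  "eval P env e v t \<Longrightarrow> eval P env e v' t' \<Longrightarrow> v' = v \<and> t' = t"
  "evals P env es vs t \<Longrightarrow> evals P env es vs' t' \<Longrightarrow> vs' = vs \<and> t' = t"
proof (induction arbitrary: v' t' and vs' t' rule: eval_evals.inducts)
  case (eval_Join env a v s b w t)
  from eval_Join.prems show ?case
    by (rule eval_elims) (auto dest: eval_Join.IH(2,4))
next
  case (eval_LeftOf env a v t)
  from eval_LeftOf.prems show ?case
    by (rule eval_elims) (auto dest: eval_LeftOf.IH(2))
next
  case (eval_RightOf env a v t)
  from eval_RightOf.prems show ?case
    by (rule eval_elims) (auto dest: eval_RightOf.IH(2))
next
  case (eval_Cond_true env c u s a v t b)
  from eval_Cond_true.prems show ?case
    by (rule eval_elims) (use eval_Cond_true.hyps in \<open>auto dest: eval_Cond_true.IH(2,4)\<close>)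
next
  case (eval_Cond_false env c s b v t a)
  from eval_Cond_false.prems show ?case
    by (rule eval_elims) (auto dest: eval_Cond_false.IH(2,4))
next
  case (eval_Call env as vs s i v t)
  from eval_Call.prems show ?case
    by (rule eval_elims) (auto dest: eval_Call.IH(2) eval_Call(5))
next
  case (evals_Cons env a v s as vs t)
  from evals_Cons.prems show ?case
    by (rule eval_elims) (auto dest: evals_Cons.IH(2,4))
qed (auto elim: eval_elims(1) eval_elims(2) eval_elims(8))

text \<open>Execution starts with the first function of the program.\<close>

definition runs :: "program \<Rightarrow> tree \<Rightarrow> tree \<Rightarrow> nat \<Rightarrow> bool" where
  "runs P x v t \<longleftrightarrow> P \<noteq> [] \<and> eval P [x] (P ! 0) v t"

section \<open>Encodings\<close>

fun tree_of_list :: "tree list \<Rightarrow> tree" where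
  "tree_of_list [] = Leaf"
| "tree_of_list (x # xs) = Node x (tree_of_list xs)"

fun tree_of_bool :: "bool \<Rightarrow> tree" where
  "tree_of_bool False = Leaf"
| "tree_of_bool True = Node Leaf Leaf"

text \<open>Binary notation, least significant bit first, without leading zeros.\<close>

fun bits :: "nat \<Rightarrow> bool list" where
  "bits n = (if n = 0 then [] else odd n # bits (n div 2))"

declare bits.simps [simp del]

definition tree_of_nat :: "nat \<Rightarrow> tree" where
  "tree_of_nat n = tree_of_list (map tree_of_bool (bits n))"

definition tree_of_int :: "int \<Rightarrow> tree" where
  "tree_of_int i = Node (tree_of_bool (i < 0)) (tree_of_nat (nat \<bar>i\<bar>))"

text \<open>Numerator and denominator of the reduced fraction.\<close>

definition tree_of_rat :: "rat \<Rightarrow> tree" where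
  "tree_of_rat r = (case quotient_of r of (p, q) \<Rightarrow> Node (tree_of_int p) (tree_of_nat (nat q)))"

section \<open>Fixed-parameter tractability\<close>

text \<open>
  Computability imposes no time bound, so that unary notation may be used for the numbers here.
\<close>

definition unary :: "nat \<Rightarrow> tree" where
  "unary n = tree_of_list (replicate n Leaf)"

definition computable :: "(nat \<Rightarrow> nat) \<Rightarrow> bool" where
  "computable f \<longleftrightarrow> (\<exists>P. \<forall>n. \<exists>t. runs P (unary n) (unary (f n)) t)"

text \<open>
  A parameterized decision problem consists of the set \<^term>\<open>A\<close> of its instances, the encodings
  \<^term>\<open>enc a\<close> of each instance \<^term>\<open>a\<close> (an instance may have several, for example when sets are listed
  in arbitrary order), the yes-instances, and the parameter \<^term>\<open>\<kappa> a\<close>. One program must decide all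
  instances, whichever encoding is given.
\<close>

definition fixed_parameter_tractable ::
  "'a set \<Rightarrow> ('a \<Rightarrow> tree set) \<Rightarrow> ('a \<Rightarrow> bool) \<Rightarrow> ('a \<Rightarrow> nat) \<Rightarrow> bool"
where
  "fixed_parameter_tractable A enc yes \<kappa> \<longleftrightarrow>
    (\<exists>P f c. computable f \<and>
      (\<forall>a\<in>A. \<forall>x\<in>enc a. \<exists>v t. runs P x v t \<and> (v \<noteq> Leaf \<longleftrightarrow> yes a) \<and> t \<le> f (\<kappa> a) * tree_size x ^ c))"

section \<open>The response problem RP(Max-M)\<close>

text \<open>
  The vertices are natural numbers, so that they can be written down. An edge is the set of its
  two end vertices. Only the values of \<^term>\<open>weight\<close> on the follower's edges are relevant.
\<close>

record rp_instance =
  verts :: "nat set"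
  edges :: "nat set set"
  leader :: "nat set set"
  follower :: "nat set set"
  weight :: "nat set \<Rightarrow> rat"
  forbidden :: "nat set set"
  mandatory :: "nat set set"
  neutral :: "nat set set"

definition rp_instances :: "rp_instance set" where
  "rp_instances = {G.
     finite (verts G) \<and>
     (\<forall>e\<in>edges G. e \<subseteq> verts G \<and> card e = 2) \<and>
     edges G = leader G \<union> follower G \<and>
     leader G \<inter> follower G = {} \<and>
     follower G = forbidden G \<union> mandatory G \<union> neutral G \<and>
     forbidden G \<inter> mandatory G = {} \<and>
     forbidden G \<inter> neutral G = {} \<and>
     mandatory G \<inter> neutral G = {}}"

definition matching :: "rp_instance \<Rightarrow> nat set set \<Rightarrow> bool" where
  "matching G M \<longleftrightarrow> M \<subseteq> edges G \<and> disjoint M"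

definition feasible_reaction :: "rp_instance \<Rightarrow> nat set set \<Rightarrow> nat set set \<Rightarrow> bool" where
  "feasible_reaction G X Y \<longleftrightarrow> Y \<subseteq> follower G \<and> matching G (X \<union> Y)"

definition optimal_reaction :: "rp_instance \<Rightarrow> nat set set \<Rightarrow> nat set set \<Rightarrow> bool" where
  "optimal_reaction G X Y \<longleftrightarrow> feasible_reaction G X Y \<and>
     (\<forall>Y'. feasible_reaction G X Y' \<longrightarrow> sum (weight G) Y' \<le> sum (weight G) Y)"

definition rp_max_matching :: "rp_instance \<Rightarrow> bool" where
  "rp_max_matching G \<longleftrightarrow>
     (\<exists>X\<subseteq>leader G. \<exists>Y. optimal_reaction G X Y \<and> forbidden G \<inter> Y = {} \<and> mandatory G \<subseteq> Y)"

text \<open>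
  A set of edges is listed without repetition, each edge as a pair of its end vertices in either
  order. The sets \<^term>\<open>edges G\<close> and \<^term>\<open>follower G\<close> are determined by the listed parts.
\<close>

definition edge_of :: "nat \<times> nat \<Rightarrow> nat set" where
  "edge_of p = {fst p, snd p}"

definition lists_edges :: "(nat \<times> nat) list \<Rightarrow> nat set set \<Rightarrow> bool" where
  "lists_edges ps F \<longleftrightarrow> distinct (map edge_of ps) \<and> set (map edge_of ps) = F"

definition tree_of_edge :: "nat \<times> nat \<Rightarrow> tree" where
  "tree_of_edge p = Node (tree_of_nat (fst p)) (tree_of_nat (snd p))"

definition tree_of_edges :: "(nat \<times> nat) list \<Rightarrow> tree" where
  "tree_of_edges ps = tree_of_list (map tree_of_edge ps)"

definition tree_of_weighted_edges :: "(nat set \<Rightarrow> rat) \<Rightarrow> (nat \<times> nat) list \<Rightarrow> tree" where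
  "tree_of_weighted_edges d ps =
     tree_of_list (map (\<lambda>p. Node (tree_of_edge p) (tree_of_rat (d (edge_of p)))) ps)"

definition rp_encodings :: "rp_instance \<Rightarrow> tree set" where
  "rp_encodings G =
    {tree_of_list
       [tree_of_list (map tree_of_nat vs),
        tree_of_edges ls,
        tree_of_weighted_edges (weight G) fs,
        tree_of_weighted_edges (weight G) ms,
        tree_of_weighted_edges (weight G) ns] | vs ls fs ms ns.
      distinct vs \<and> set vs = verts G \<and>
      lists_edges ls (leader G) \<and>
      lists_edges fs (forbidden G) \<and>
      lists_edges ms (mandatory G) \<and>
      lists_edges ns (neutral G)}"

lemma ex_lists_edges:
  assumes "finite F" "\<forall>e\<in>F. card e = 2"
  shows "\<exists>ps. lists_edges ps F"
proof -
  obtain es where es: "set es = F" "distinct es"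
    using assms(1) finite_distinct_list by blast
  have "\<forall>e\<in>F. \<exists>p. edge_of p = e"
    using assms(2) unfolding edge_of_def by (metis card_2_iff fst_conv snd_conv)
  then obtain g where g: "\<forall>e\<in>F. edge_of (g e) = e" by metis
  have "map (edge_of \<circ> g) es = es" using g es by (intro map_idI) auto
  then have "lists_edges (map g es) F" using es by (simp add: lists_edges_def)
  then show ?thesis by blast
qed

lemma rp_encodings_nonempty:
  assumes "G \<in> rp_instances"
  shows "rp_encodings G \<noteq> {}"
proof -
  have fin: "finite (edges G)"
  proof (rule finite_subset)
    show "edges G \<subseteq> Pow (verts G)" using assms unfolding rp_instances_def by blast
    show "finite (Pow (verts G))" using assms by (simp add: rp_instances_def)
  qed
  have two: "\<forall>e\<in>edges G. card e = 2"
    using assms by (simp add: rp_instances_def)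
  have *: "\<exists>ps. lists_edges ps F" if "F \<subseteq> edges G" for F
  proof (rule ex_lists_edges)
    show "finite F" using that fin by (rule finite_subset)
    show "\<forall>e\<in>F. card e = 2" using that two by blast
  qed
  have "leader G \<subseteq> edges G" "forbidden G \<subseteq> edges G" "mandatory G \<subseteq> edges G" "neutral G \<subseteq> edges G"
    using assms by (auto simp: rp_instances_def)
  then obtain ls fs ms ns where ps: "lists_edges ls (leader G)" "lists_edges fs (forbidden G)"
    "lists_edges ms (mandatory G)" "lists_edges ns (neutral G)" by (meson * )
  have "finite (verts G)" using assms by (simp add: rp_instances_def)
  then obtain vs where "distinct vs" "set vs = verts G" using finite_distinct_list by blast
  with ps show ?thesis unfolding rp_encodings_def by blast
qed

end

theory Submission
  imports Defs "HOL-Library.Sublist"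
begin

text \<open>
  Why the problem is tractable. If the mandatory edges are to be part of the reaction, they form a
  matching, and the reaction is determined by its set \<open>Z\<close> of neutral edges. The leader's
  matching \<open>X\<close> has to avoid this reaction \<open>Y\<close> and must spoil every better one. A competing
  reaction consists of a matching \<open>W\<close> of forbidden and neutral edges and some mandatory edges
  that avoid \<open>W\<close>; for given \<open>W\<close> the best choice takes all such edges of nonnegative weight.
  Since \<open>X\<close> avoids the mandatory edges, it can exclude a competitor only by covering
  an endpoint of \<open>W\<close>. So all that matters about \<open>X\<close> is a set \<open>S\<close> of endpoints of forbidden and
  neutral edges that it covers. With \<open>k\<close> forbidden and neutral edges there are at most
  \<open>2 ^ k\<close> choices of \<open>Z\<close>, at most \<open>4 ^ k\<close> choices of \<open>S\<close>, and at most \<open>2 ^ k\<close> competitors \<open>W\<close>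
  (\<open>decides_if_rp_max_matching\<close>, \<open>rp_max_matching_if_decides\<close>).

  It remains to decide whether some matching of leader edges avoids \<open>Y\<close> and covers \<open>S\<close>. A search
  tree does this in time bounded by \<open>k\<close> up to a polynomial factor: a vertex with many free edges
  is postponed, because the few edges needed for the other vertices cannot block all of them
  (\<open>extendable_insert_if_many_free\<close>), and at a vertex with few free edges the search branches.

  The program is not written down explicitly. Instead, \<open>ptime\<close> states that a function on
  mathematical objects can be computed from a tree that encodes them, in time polynomial in the
  size of that tree plus a budget. This relation is closed under pairing, case distinction,
  composition and, most importantly, recursion along lists with bounded intermediate results
  (\<open>ptime_list_recursion\<close>); each closure rule contains the program text that it needs.
  The running time of the decision procedure (\<open>ptime_solve\<close>) then follows its definition. The
  weights are compared exactly, with binary arithmetic on fractions. With the budget \<open>2 ^ (k * k)\<close>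
  a polynomial bound is a fixed-parameter bound, and the function of \<open>k\<close> in it is computable by the
  same closure rules applied to unary numbers.
\<close>

section \<open>Relocating programs\<close>

text \<open>
  A program that is copied to position \<^term>\<open>k\<close> of a larger one has to call its own functions under
  their new numbers; \<^term>\<open>shift k\<close> renumbers the calls.
\<close>

fun shift :: "nat \<Rightarrow> expr \<Rightarrow> expr" where
  "shift k (Param i) = Param i"
| "shift k Empty = Empty"
| "shift k (Join a b) = Join (shift k a) (shift k b)"
| "shift k (LeftOf a) = LeftOf (shift k a)"
| "shift k (RightOf a) = RightOf (shift k a)"
| "shift k (Cond c a b) = Cond (shift k c) (shift k a) (shift k b)"
| "shift k (Call i es) = Call (k + i) (map (shift k) es)"

definition linked :: "program \<Rightarrow> nat \<Rightarrow> program \<Rightarrow> bool" where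
  "linked P k Q \<longleftrightarrow> (\<forall>i<length P. k + i < length Q \<and> Q ! (k + i) = shift k (P ! i))"

lemma linked_append: "length A = k \<Longrightarrow> linked P k (A @ map (shift k) P @ B)"
  by (auto simp: linked_def nth_append)

lemma eval_shift:
  "eval P env e v t \<Longrightarrow> linked P k Q \<Longrightarrow> eval Q env (shift k e) v t"
  "evals P env es vs t \<Longrightarrow> linked P k Q \<Longrightarrow> evals Q env (map (shift k) es) vs t"
proof (induction rule: eval_evals.inducts)
  case (eval_Call env as vs s i v t)
  then have "k + i < length Q" "Q ! (k + i) = shift k (P ! i)"
    by (auto simp: linked_def)
  then show ?case
    using eval_evals.eval_Call[of Q env "map (shift k) as" vs s "k + i" v t] eval_Call by simp
qed (auto intro: eval_evals.intros[simplified])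

lemma eval_Call_linked:
  assumes "runs P x v t" "linked P k Q" "eval Q env e x s"
  shows "eval Q env (Call k [e]) v (s + t + 1)"
proof -
  have P: "P \<noteq> []" "eval P [x] (P ! 0) v t" using assms(1) by (auto simp: runs_def)
  then have "k < length Q" "Q ! k = shift k (P ! 0)"
    using assms(2) unfolding linked_def by (metis add_0_right length_greater_0_conv)+
  moreover have "eval Q [x] (shift k (P ! 0)) v t" using eval_shift(1) P(2) assms(2) by blast
  moreover have "evals Q env [e] [x] s" using evals_Cons[OF assms(3) evals_Nil] by simp
  ultimately show ?thesis by (metis eval_Call)
qed

section \<open>Polynomial bounds\<close>

text \<open>
  The offset 2 makes the base at least 2. Hence a power of it also bounds every constant, and sums
  and products of such bounds need no separate constant factors.
\<close>

definition poly_bounded :: "'a set \<Rightarrow> ('a \<Rightarrow> nat) \<Rightarrow> ('a \<Rightarrow> nat) \<Rightarrow> bool" where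
  "poly_bounded D M g \<longleftrightarrow> (\<exists>c. \<forall>a\<in>D. g a \<le> (M a + 2) ^ c)"

lemma poly_bounded_mono:
  "poly_bounded D M g \<Longrightarrow> (\<And>a. a \<in> D \<Longrightarrow> h a \<le> g a) \<Longrightarrow> poly_bounded D M h"
  unfolding poly_bounded_def by (meson order_trans)

lemma poly_bounded_self: "poly_bounded D M M"
  unfolding poly_bounded_def by (rule exI[of _ 1]) simp

lemma poly_bounded_mult:
  assumes "poly_bounded D M g" "poly_bounded D M h"
  shows "poly_bounded D M (\<lambda>a. g a * h a)"
proof -
  obtain c d where "\<forall>a\<in>D. g a \<le> (M a + 2) ^ c" "\<forall>a\<in>D. h a \<le> (M a + 2) ^ d"
    using assms unfolding poly_bounded_def by auto
  then have "\<forall>a\<in>D. g a * h a \<le> (M a + 2) ^ (c + d)"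
    unfolding power_add by (meson mult_le_mono)
  then show ?thesis unfolding poly_bounded_def by blast
qed

lemma poly_bounded_const: "poly_bounded D M (\<lambda>_. n)"
  unfolding poly_bounded_def
proof (rule exI[of _ n], rule ballI)
  fix a
  have "n \<le> 2 ^ n" by (simp add: less_imp_le)
  also have "\<dots> \<le> (M a + 2) ^ n" by (rule power_mono) auto
  finally show "n \<le> (M a + 2) ^ n" .
qed

lemma poly_bounded_add:
  assumes "poly_bounded D M g" "poly_bounded D M h"
  shows "poly_bounded D M (\<lambda>a. g a + h a)"
proof -
  obtain c d where cd: "\<forall>a\<in>D. g a \<le> (M a + 2) ^ c" "\<forall>a\<in>D. h a \<le> (M a + 2) ^ d"
    using assms unfolding poly_bounded_def by auto
  have "g a + h a \<le> (M a + 2) ^ Suc (max c d)" if "a \<in> D" for a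
  proof -
    have "g a + h a \<le> (M a + 2) ^ max c d + (M a + 2) ^ max c d"
      using cd that by (intro add_mono) (auto intro: order_trans power_increasing)
    also have "\<dots> \<le> (M a + 2) * (M a + 2) ^ max c d" by simp
    finally show ?thesis by simp
  qed
  then show ?thesis unfolding poly_bounded_def by blast
qed

lemma poly_bounded_power:
  assumes "poly_bounded D M g"
  shows "poly_bounded D M (\<lambda>a. g a ^ n)"
  by (induction n) (simp_all add: poly_bounded_const poly_bounded_mult assms)

lemma poly_bounded_trans:
  assumes "poly_bounded D M g" "poly_bounded D g h"
  shows "poly_bounded D M h"
proof -
  obtain c where c: "\<forall>a\<in>D. h a \<le> (g a + 2) ^ c"
    using assms(2) unfolding poly_bounded_def by auto
  have "poly_bounded D M (\<lambda>a. (g a + 2) ^ c)"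
    by (intro poly_bounded_power poly_bounded_add poly_bounded_const assms)
  then show ?thesis by (rule poly_bounded_mono) (use c in auto)
qed

lemma poly_bounded_reindex:
  assumes "poly_bounded D M g" "\<And>a. a \<in> D' \<Longrightarrow> h a \<in> D"
  shows "poly_bounded D' (\<lambda>a. M (h a)) (\<lambda>a. g (h a))"
  using assms unfolding poly_bounded_def by blast

lemma poly_bounded_mono_measure:
  assumes "poly_bounded D M g" "\<And>a. a \<in> D \<Longrightarrow> M a \<le> N a"
  shows "poly_bounded D N g"
proof -
  have "poly_bounded D N M" by (rule poly_bounded_mono[OF poly_bounded_self assms(2)])
  then show ?thesis using assms(1) by (rule poly_bounded_trans)
qed

lemmas poly_bounded_intros = poly_bounded_add poly_bounded_mult poly_bounded_const
  poly_bounded_power poly_bounded_self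

section \<open>Polynomial-time computability from a context\<close>

text \<open>
  The judgement is relative to a context: from the tree \<^term>\<open>C a\<close>, which holds the values of all
  variables in scope, one program computes \<^term>\<open>f a\<close> for every index \<^term>\<open>a\<close> in \<^term>\<open>D\<close>. The index is
  the mathematical object behind the encodings, so no decoding is ever needed. The budget
  \<^term>\<open>\<mu> a\<close> may be exponential in the parameter; this is how fixed-parameter running times fit
  into a calculus of polynomial bounds. The size of the result is bounded together with the time,
  although time alone allows results of exponential size (by sharing): only so do the bounds
  survive composition. Measuring time against the size of the context of the same index, rather than
  assuming that contexts are small, keeps the judgement stable under reindexing.
\<close>

definition ptime :: "'a set \<Rightarrow> ('a \<Rightarrow> nat) \<Rightarrow> ('a \<Rightarrow> tree) \<Rightarrow> ('a \<Rightarrow> tree) \<Rightarrow> bool" where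
  "ptime D \<mu> C f \<longleftrightarrow> (\<exists>P T. poly_bounded D (\<lambda>a. \<mu> a + tree_size (C a)) T \<and>
     (\<forall>a\<in>D. tree_size (f a) \<le> T a \<and> (\<exists>t\<le>T a. runs P (C a) (f a) t)))"

lemma ptimeI:
  assumes "poly_bounded D (\<lambda>a. \<mu> a + tree_size (C a)) T"
    and "\<And>a. a \<in> D \<Longrightarrow> tree_size (f a) \<le> T a"
    and "\<And>a. a \<in> D \<Longrightarrow> \<exists>t\<le>T a. runs P (C a) (f a) t"
  shows "ptime D \<mu> C f"
  using assms unfolding ptime_def by blast

lemma ptimeE:
  assumes "ptime D \<mu> C f"
  obtains P T where "poly_bounded D (\<lambda>a. \<mu> a + tree_size (C a)) T"
    and "\<And>a. a \<in> D \<Longrightarrow> tree_size (f a) \<le> T a"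
    and "\<And>a. a \<in> D \<Longrightarrow> \<exists>t\<le>T a. runs P (C a) (f a) t"
  using assms unfolding ptime_def by blast

lemma ptime_size:
  assumes "ptime D \<mu> C f"
  shows "poly_bounded D (\<lambda>a. \<mu> a + tree_size (C a)) (\<lambda>a. tree_size (f a))"
  by (rule ptimeE[OF assms]) (rule poly_bounded_mono)

lemma poly_bounded_context: "poly_bounded D (\<lambda>a. \<mu> a + tree_size (C a)) (\<lambda>a. tree_size (C a))"
  by (rule poly_bounded_mono[OF poly_bounded_self]) simp

lemma ptime_cong:
  assumes "ptime D \<mu> C f" "\<And>a. a \<in> D \<Longrightarrow> f a = g a"
  shows "ptime D \<mu> C g"
  using assms unfolding ptime_def by simp

lemma ptime_id: "ptime D \<mu> C C"
proof (rule ptimeI)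
  show "poly_bounded D (\<lambda>a. \<mu> a + tree_size (C a)) (\<lambda>a. \<mu> a + tree_size (C a))"
    by (rule poly_bounded_self)
  fix a
  have "1 \<le> tree_size (C a)" by (cases "C a") auto
  moreover have "runs [Param 0] (C a) (C a) 1"
    using eval_Param[of 0 "[C a]"] by (simp add: runs_def)
  ultimately show "\<exists>t\<le>\<mu> a + tree_size (C a). runs [Param 0] (C a) (C a) t"
    by (meson trans_le_add2)
qed simp

lemma ptime_Leaf: "ptime D \<mu> C (\<lambda>_. Leaf)"
proof (rule ptimeI)
  show "poly_bounded D (\<lambda>a. \<mu> a + tree_size (C a)) (\<lambda>a. 1)" by (rule poly_bounded_const)
  show "\<exists>t\<le>1. runs [Empty] (C a) Leaf t" for a
    by (auto intro!: exI[of _ 1] eval_Empty simp: runs_def)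
qed simp

lemma eval_Param0: "eval Q [x] (Param 0) x 1"
  using eval_Param[of 0 "[x]"] by simp

text \<open>
  For a fixed budget, computability from a context is a preorder. Looking up a variable, passing
  arguments and weakening a context are all instances of composition.
\<close>

lemma ptime_trans:
  assumes "ptime D \<mu> C f" "ptime D \<mu> f g"
  shows "ptime D \<mu> C g"
proof -
  obtain P S where P: "poly_bounded D (\<lambda>a. \<mu> a + tree_size (C a)) S"
    "\<And>a. a \<in> D \<Longrightarrow> tree_size (f a) \<le> S a"
    "\<And>a. a \<in> D \<Longrightarrow> \<exists>t\<le>S a. runs P (C a) (f a) t" using ptimeE[OF assms(1)] by metis
  obtain R T where R: "poly_bounded D (\<lambda>a. \<mu> a + tree_size (f a)) T"
    "\<And>a. a \<in> D \<Longrightarrow> tree_size (g a) \<le> T a"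
    "\<And>a. a \<in> D \<Longrightarrow> \<exists>t\<le>T a. runs R (f a) (g a) t" using ptimeE[OF assms(2)] by metis
  let ?j = "1 + length P"
  let ?Q = "[Call ?j [Call 1 [Param 0]]] @ map (shift 1) P @ map (shift ?j) R @ []"
  have lP: "linked P 1 ?Q" by (rule linked_append) simp
  have lR: "linked R ?j ?Q"
    using linked_append[of "[Call ?j [Call 1 [Param 0]]] @ map (shift 1) P" ?j R "[]"] by simp
  show ?thesis
  proof (rule ptimeI)
    have "poly_bounded D (\<lambda>a. \<mu> a + tree_size (C a)) (\<lambda>a. \<mu> a + tree_size (f a))"
      by (intro poly_bounded_add ptime_size[OF assms(1)] poly_bounded_mono[OF poly_bounded_self])
         simp
    then have "poly_bounded D (\<lambda>a. \<mu> a + tree_size (C a)) T"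
      using R(1) by (rule poly_bounded_trans)
    then show "poly_bounded D (\<lambda>a. \<mu> a + tree_size (C a)) (\<lambda>a. S a + T a + 3)"
      by (intro poly_bounded_add P(1) poly_bounded_const)
    fix a assume a: "a \<in> D"
    show "tree_size (g a) \<le> S a + T a + 3" using R(2)[OF a] by simp
    obtain s t where st: "s \<le> S a" "runs P (C a) (f a) s" "t \<le> T a" "runs R (f a) (g a) t"
      using P(3)[OF a] R(3)[OF a] by blast
    have "eval ?Q [C a] (Call ?j [Call 1 [Param 0]]) (g a) (1 + s + 1 + t + 1)"
      by (rule eval_Call_linked[OF st(4) lR eval_Call_linked[OF st(2) lP eval_Param0]])
    then have "runs ?Q (C a) (g a) (1 + s + 1 + t + 1)" by (simp add: runs_def)
    then show "\<exists>t\<le>S a + T a + 3. runs ?Q (C a) (g a) t"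
      using st by (intro exI[of _ "1 + s + 1 + t + 1"]) simp
  qed
qed

lemma ptime_Node:
  assumes "ptime D \<mu> C f" "ptime D \<mu> C g"
  shows "ptime D \<mu> C (\<lambda>a. Node (f a) (g a))"
proof -
  obtain P S where P: "poly_bounded D (\<lambda>a. \<mu> a + tree_size (C a)) S"
    "\<And>a. a \<in> D \<Longrightarrow> tree_size (f a) \<le> S a"
    "\<And>a. a \<in> D \<Longrightarrow> \<exists>t\<le>S a. runs P (C a) (f a) t" using ptimeE[OF assms(1)] by metis
  obtain R T where R: "poly_bounded D (\<lambda>a. \<mu> a + tree_size (C a)) T"
    "\<And>a. a \<in> D \<Longrightarrow> tree_size (g a) \<le> T a"
    "\<And>a. a \<in> D \<Longrightarrow> \<exists>t\<le>T a. runs R (C a) (g a) t" using ptimeE[OF assms(2)] by metis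
  let ?j = "1 + length P"
  let ?m = "Join (Call 1 [Param 0]) (Call ?j [Param 0])"
  let ?Q = "[?m] @ map (shift 1) P @ map (shift ?j) R @ []"
  have lP: "linked P 1 ?Q" by (rule linked_append) simp
  have lR: "linked R ?j ?Q" using linked_append[of "[?m] @ map (shift 1) P" ?j R "[]"] by simp
  show ?thesis
  proof (rule ptimeI)
    show "poly_bounded D (\<lambda>a. \<mu> a + tree_size (C a)) (\<lambda>a. S a + T a + 5)"
      by (intro poly_bounded_add P(1) R(1) poly_bounded_const)
    fix a assume a: "a \<in> D"
    show "tree_size (Node (f a) (g a)) \<le> S a + T a + 5" using P(2)[OF a] R(2)[OF a] by simp
    obtain s t where st: "s \<le> S a" "runs P (C a) (f a) s" "t \<le> T a" "runs R (C a) (g a) t"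
      using P(3)[OF a] R(3)[OF a] by blast
    have "eval ?Q [C a] ?m (Node (f a) (g a)) ((1 + s + 1) + (1 + t + 1) + 1)"
      by (intro eval_Join eval_Call_linked[OF st(2) lP eval_Param0]
          eval_Call_linked[OF st(4) lR eval_Param0])
    then have "runs ?Q (C a) (Node (f a) (g a)) ((1 + s + 1) + (1 + t + 1) + 1)"
      by (simp add: runs_def)
    then show "\<exists>t\<le>S a + T a + 5. runs ?Q (C a) (Node (f a) (g a)) t"
      using st by (intro exI[of _ "(1 + s + 1) + (1 + t + 1) + 1"]) simp
  qed
qed

lemma tree_size_pos: "1 \<le> tree_size t"
  by (cases t) auto

lemma ptime_left_id: "ptime D \<mu> C (\<lambda>a. left_tree (C a))"
proof (rule ptimeI)
  show "poly_bounded D (\<lambda>a. \<mu> a + tree_size (C a)) (\<lambda>a. 1 + tree_size (C a))"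
    by (intro poly_bounded_add poly_bounded_const poly_bounded_context)
  fix a
  show "tree_size (left_tree (C a)) \<le> 1 + tree_size (C a)" by (cases "C a") auto
  have "runs [LeftOf (Param 0)] (C a) (left_tree (C a)) (1 + 1)"
    using eval_LeftOf[OF eval_Param0] by (simp add: runs_def)
  then show "\<exists>t\<le>1 + tree_size (C a). runs [LeftOf (Param 0)] (C a) (left_tree (C a)) t"
    using tree_size_pos[of "C a"] by (meson add_le_mono le_refl)
qed

lemma ptime_right_id: "ptime D \<mu> C (\<lambda>a. right_tree (C a))"
proof (rule ptimeI)
  show "poly_bounded D (\<lambda>a. \<mu> a + tree_size (C a)) (\<lambda>a. 1 + tree_size (C a))"
    by (intro poly_bounded_add poly_bounded_const poly_bounded_context)
  fix a
  show "tree_size (right_tree (C a)) \<le> 1 + tree_size (C a)" by (cases "C a") auto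
  have "runs [RightOf (Param 0)] (C a) (right_tree (C a)) (1 + 1)"
    using eval_RightOf[OF eval_Param0] by (simp add: runs_def)
  then show "\<exists>t\<le>1 + tree_size (C a). runs [RightOf (Param 0)] (C a) (right_tree (C a)) t"
    using tree_size_pos[of "C a"] by (meson add_le_mono le_refl)
qed

lemma ptime_left: "ptime D \<mu> C f \<Longrightarrow> ptime D \<mu> C (\<lambda>a. left_tree (f a))"
  by (rule ptime_trans[OF _ ptime_left_id])

lemma ptime_right: "ptime D \<mu> C f \<Longrightarrow> ptime D \<mu> C (\<lambda>a. right_tree (f a))"
  by (rule ptime_trans[OF _ ptime_right_id])

lemma ptime_cond:
  assumes "ptime D \<mu> C h" "ptime D \<mu> C f" "ptime D \<mu> C g"
  shows "ptime D \<mu> C (\<lambda>a. if h a \<noteq> Leaf then f a else g a)"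
proof -
  obtain H U where H: "poly_bounded D (\<lambda>a. \<mu> a + tree_size (C a)) U"
    "\<And>a. a \<in> D \<Longrightarrow> \<exists>t\<le>U a. runs H (C a) (h a) t" using ptimeE[OF assms(1)] by metis
  obtain P S where P: "poly_bounded D (\<lambda>a. \<mu> a + tree_size (C a)) S"
    "\<And>a. a \<in> D \<Longrightarrow> tree_size (f a) \<le> S a"
    "\<And>a. a \<in> D \<Longrightarrow> \<exists>t\<le>S a. runs P (C a) (f a) t" using ptimeE[OF assms(2)] by metis
  obtain R T where R: "poly_bounded D (\<lambda>a. \<mu> a + tree_size (C a)) T"
    "\<And>a. a \<in> D \<Longrightarrow> tree_size (g a) \<le> T a"
    "\<And>a. a \<in> D \<Longrightarrow> \<exists>t\<le>T a. runs R (C a) (g a) t" using ptimeE[OF assms(3)] by metis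
  let ?i = "1 + length H"
  let ?j = "?i + length P"
  let ?m = "Cond (Call 1 [Param 0]) (Call ?i [Param 0]) (Call ?j [Param 0])"
  let ?Q = "[?m] @ map (shift 1) H @ map (shift ?i) P @ map (shift ?j) R @ []"
  have lO: "linked H 1 ?Q" by (rule linked_append) simp
  have lP: "linked P ?i ?Q"
    using linked_append[of "[?m] @ map (shift 1) H" ?i P "map (shift ?j) R @ []"] by simp
  have lR: "linked R ?j ?Q"
    using linked_append[of "[?m] @ map (shift 1) H @ map (shift ?i) P" ?j R "[]"] by simp
  let ?f = "\<lambda>a. if h a \<noteq> Leaf then f a else g a"
  show ?thesis
  proof (rule ptimeI)
    show "poly_bounded D (\<lambda>a. \<mu> a + tree_size (C a)) (\<lambda>a. U a + S a + T a + 5)"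
      by (intro poly_bounded_add H(1) P(1) R(1) poly_bounded_const)
    fix a assume a: "a \<in> D"
    show "tree_size (?f a) \<le> U a + S a + T a + 5" using P(2)[OF a] R(2)[OF a] by simp
    obtain u s t where st: "u \<le> U a" "runs H (C a) (h a) u" "s \<le> S a" "runs P (C a) (f a) s"
      "t \<le> T a" "runs R (C a) (g a) t"
      using H(2)[OF a] P(3)[OF a] R(3)[OF a] by blast
    have c: "eval ?Q [C a] (Call 1 [Param 0]) (h a) (1 + u + 1)"
      by (rule eval_Call_linked[OF st(2) lO eval_Param0])
    show "\<exists>t\<le>U a + S a + T a + 5. runs ?Q (C a) (?f a) t"
    proof (cases "h a = Leaf")
      case True
      then have "eval ?Q [C a] ?m (g a) ((1 + u + 1) + (1 + t + 1) + 1)"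
        using c by (intro eval_Cond_false eval_Call_linked[OF st(6) lR eval_Param0]) simp
      then have "runs ?Q (C a) (?f a) ((1 + u + 1) + (1 + t + 1) + 1)"
        using True by (simp add: runs_def)
      then show ?thesis
        using st by (intro exI[of _ "(1 + u + 1) + (1 + t + 1) + 1"]) simp
    next
      case False
      then have "eval ?Q [C a] ?m (f a) ((1 + u + 1) + (1 + s + 1) + 1)"
        using c by (intro eval_Cond_true[OF c] eval_Call_linked[OF st(4) lP eval_Param0])
      then have "runs ?Q (C a) (?f a) ((1 + u + 1) + (1 + s + 1) + 1)"
        using False by (simp add: runs_def)
      then show ?thesis
        using st by (intro exI[of _ "(1 + u + 1) + (1 + s + 1) + 1"]) simp
    qed
  qed
qed

text \<open>
  This is how facts about an outer context are used below a binder: the new index is a tuple whose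
  first component is the old one.
\<close>

lemma ptime_reindex:
  assumes "ptime D \<mu> C f" "\<And>z. z \<in> D' \<Longrightarrow> h z \<in> D"
  shows "ptime D' (\<lambda>z. \<mu> (h z)) (\<lambda>z. C (h z)) (\<lambda>z. f (h z))"
proof -
  obtain P T where P: "poly_bounded D (\<lambda>a. \<mu> a + tree_size (C a)) T"
    "\<And>a. a \<in> D \<Longrightarrow> tree_size (f a) \<le> T a"
    "\<And>a. a \<in> D \<Longrightarrow> \<exists>t\<le>T a. runs P (C a) (f a) t" using ptimeE[OF assms(1)] by metis
  show ?thesis
    by (rule ptimeI[where T = "\<lambda>z. T (h z)" and P = P])
       (use poly_bounded_reindex[OF P(1), of D' h] P(2,3) assms(2) in auto)
qed

section \<open>Recursion along lists\<close>

definition enc_list :: "('b \<Rightarrow> tree) \<Rightarrow> 'b list \<Rightarrow> tree" where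
  "enc_list eb xs = tree_of_list (map eb xs)"

lemma enc_list_simps [simp]:
  "enc_list eb [] = Leaf" "enc_list eb (x # xs) = Node (eb x) (enc_list eb xs)"
  by (simp_all add: enc_list_def)

lemma length_le_tree_size: "length xs < tree_size (enc_list eb xs)"
  by (induction xs) auto

lemma tree_size_suffix: "suffix ys xs \<Longrightarrow> tree_size (enc_list eb ys) \<le> tree_size (enc_list eb xs)"
  by (induction xs) (auto simp: suffix_Cons)

lemma tree_size_elem: "x \<in> set xs \<Longrightarrow> tree_size (eb x) \<le> tree_size (enc_list eb xs)"
  by (induction xs) auto

lemma ptime_time:
  assumes "ptime D \<mu> C f"
  shows "\<exists>P c. \<forall>a\<in>D. \<exists>t\<le>(\<mu> a + tree_size (C a) + 2) ^ c. runs P (C a) (f a) t"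
proof -
  obtain P T c where "\<And>a. a \<in> D \<Longrightarrow> \<exists>t\<le>T a. runs P (C a) (f a) t"
    and "\<And>a. a \<in> D \<Longrightarrow> T a \<le> (\<mu> a + tree_size (C a) + 2) ^ c"
    using assms unfolding ptime_def poly_bounded_def by blast
  then show ?thesis by (meson order_trans)
qed

text \<open>
  Recursion along a list with a parameter \<^term>\<open>p\<close> that is updated on the way down (by \<^term>\<open>g\<close>) and a
  result that is built on the way up. The recursion equations of \<^term>\<open>F\<close> are not premises. They are
  used to establish the last premise, which asks for \<^term>\<open>F a (x # xs) p\<close> in a context that
  already holds the recursive result. The polynomial bound \<^term>\<open>bd\<close> on all parameters and
  intermediate results is indispensable, since iterating a polynomial-time step can otherwise produce
  exponentially large values. Given it, every step takes time polynomial in the data available at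
  the start, and there are only linearly many steps.
\<close>

theorem ptime_list_recursion:
  fixes F :: "'a \<Rightarrow> 'b list \<Rightarrow> 'p \<Rightarrow> 'c"
  assumes l: "ptime D \<mu> C (\<lambda>a. enc_list eb (l a))"
    and start: "ptime D \<mu> C (\<lambda>a. ep (start a))" "\<And>a. a \<in> D \<Longrightarrow> start a \<in> Q a"
    and bd: "poly_bounded D (\<lambda>a. \<mu> a + tree_size (C a)) bd"
    and p_le: "\<And>a p. a \<in> D \<Longrightarrow> p \<in> Q a \<Longrightarrow> tree_size (ep p) \<le> bd a"
    and F_le: "\<And>a xs p. a \<in> D \<Longrightarrow> suffix xs (l a) \<Longrightarrow> p \<in> Q a \<Longrightarrow> tree_size (ec (F a xs p)) \<le> bd a"
    and gQ: "\<And>a x xs p. a \<in> D \<Longrightarrow> suffix (x # xs) (l a) \<Longrightarrow> p \<in> Q a \<Longrightarrow> g a x p \<in> Q a"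
    and base: "ptime {(a, p). a \<in> D \<and> p \<in> Q a} (\<lambda>z. \<mu> (fst z))
      (\<lambda>z. Node (C (fst z)) (Node (ep (snd z)) Leaf)) (\<lambda>z. ec (F (fst z) [] (snd z)))"
    and g: "ptime {(a, p, x, xs). a \<in> D \<and> p \<in> Q a \<and> suffix (x # xs) (l a)} (\<lambda>z. \<mu> (fst z))
      (\<lambda>z. Node (C (fst z)) (Node (ep (fst (snd z)))
         (Node (eb (fst (snd (snd z)))) (enc_list eb (snd (snd (snd z)))))))
      (\<lambda>z. ep (g (fst z) (fst (snd (snd z))) (fst (snd z))))"
    and h: "ptime {(a, p, x, xs). a \<in> D \<and> p \<in> Q a \<and> suffix (x # xs) (l a)} (\<lambda>z. \<mu> (fst z))
      (\<lambda>z. Node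
         (ec (F (fst z) (snd (snd (snd z))) (g (fst z) (fst (snd (snd z))) (fst (snd z)))))
         (Node (C (fst z)) (Node (ep (fst (snd z)))
           (Node (eb (fst (snd (snd z)))) (enc_list eb (snd (snd (snd z))))))))
      (\<lambda>z. ec (F (fst z) (fst (snd (snd z)) # snd (snd (snd z))) (fst (snd z))))"
  shows "ptime D \<mu> C (\<lambda>a. ec (F a (l a) (start a)))"
proof -
  define K where "K = (\<lambda>a p xs. Node (C a) (Node (ep p) (enc_list eb xs)))"
  have K_app: "K a p xs = Node (C a) (Node (ep p) (enc_list eb xs))" for a p xs
    by (simp add: K_def)
  let ?M = "\<lambda>a. \<mu> a + tree_size (C a)"
  \<comment> \<open>The size of every context that occurs during the recursion is at most this bound.\<close>
  define N where "N = (\<lambda>a. tree_size (C a) + bd a + tree_size (enc_list eb (l a)) + bd a + 10 + \<mu> a)"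
  have "poly_bounded D ?M \<mu>"
    by (rule poly_bounded_mono[OF poly_bounded_self]) simp
  then have pbN: "poly_bounded D ?M N"
    unfolding N_def
    by (intro poly_bounded_add bd poly_bounded_const poly_bounded_context ptime_size[OF l])
  have sz: "tree_size (Node (eb x) (enc_list eb xs)) \<le> tree_size (enc_list eb (l a))"
    if "suffix (x # xs) (l a)" for a x xs
    using tree_size_suffix[OF that, of eb] by simp
  obtain PB cb where B0: "\<forall>z\<in>{(a, p). a \<in> D \<and> p \<in> Q a}.
      \<exists>t\<le>(\<mu> (fst z) + tree_size (Node (C (fst z)) (Node (ep (snd z)) Leaf)) + 2) ^ cb.
        runs PB (Node (C (fst z)) (Node (ep (snd z)) Leaf)) (ec (F (fst z) [] (snd z))) t"
    using ptime_time[OF base] by blast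
  have B: "\<exists>t\<le>(N a + 2) ^ cb. runs PB (K a p []) (ec (F a [] p)) t"
    if ap: "a \<in> D" "p \<in> Q a" for a p
  proof -
    have "(\<mu> a + tree_size (Node (C a) (Node (ep p) Leaf)) + 2) ^ cb \<le> (N a + 2) ^ cb"
      using p_le[OF ap] unfolding N_def by (intro power_mono) auto
    then show ?thesis
      using B0[rule_format, of "(a, p)", unfolded mem_Collect_eq prod.case fst_conv snd_conv,
          OF conjI[OF ap]]
      unfolding K_def enc_list_simps by (meson order_trans)
  qed
  let ?E = "{(a, p, x, xs). a \<in> D \<and> p \<in> Q a \<and> suffix (x # xs) (l a)}"
  obtain PG cg where G0: "\<forall>z\<in>?E.
      \<exists>t\<le>(\<mu> (fst z) + tree_size (Node (C (fst z)) (Node (ep (fst (snd z)))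
         (Node (eb (fst (snd (snd z)))) (enc_list eb (snd (snd (snd z))))))) + 2) ^ cg.
       runs PG (Node (C (fst z)) (Node (ep (fst (snd z)))
         (Node (eb (fst (snd (snd z)))) (enc_list eb (snd (snd (snd z)))))))
       (ep (g (fst z) (fst (snd (snd z))) (fst (snd z)))) t"
    using ptime_time[OF g] by blast
  have G: "\<exists>t\<le>(N a + 2) ^ cg. runs PG (K a p (x # xs)) (ep (g a x p)) t"
    if ap: "a \<in> D" "p \<in> Q a" "suffix (x # xs) (l a)" for a p x xs
  proof -
    have "(\<mu> a + tree_size (Node (C a) (Node (ep p) (Node (eb x) (enc_list eb xs)))) + 2) ^ cg
        \<le> (N a + 2) ^ cg"
      using p_le[OF ap(1,2)] sz[OF ap(3)] unfolding N_def by (intro power_mono) auto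
    then show ?thesis
      using G0[rule_format, of "(a, p, x, xs)", unfolded mem_Collect_eq prod.case fst_conv snd_conv,
          OF conjI[OF ap(1) conjI[OF ap(2,3)]]]
      unfolding K_def enc_list_simps by (meson order_trans)
  qed
  obtain PH ch where H0: "\<forall>z\<in>?E.
      \<exists>t\<le>(\<mu> (fst z) + tree_size (Node
           (ec (F (fst z) (snd (snd (snd z))) (g (fst z) (fst (snd (snd z))) (fst (snd z)))))
           (Node (C (fst z)) (Node (ep (fst (snd z)))
         (Node (eb (fst (snd (snd z)))) (enc_list eb (snd (snd (snd z)))))))) + 2) ^ ch.
       runs PH (Node
           (ec (F (fst z) (snd (snd (snd z))) (g (fst z) (fst (snd (snd z))) (fst (snd z)))))
           (Node (C (fst z)) (Node (ep (fst (snd z)))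
         (Node (eb (fst (snd (snd z)))) (enc_list eb (snd (snd (snd z))))))))
       (ec (F (fst z) (fst (snd (snd z)) # snd (snd (snd z))) (fst (snd z)))) t"
    using ptime_time[OF h] by blast
  have H: "\<exists>t\<le>(N a + 2) ^ ch.
      runs PH (Node (ec (F a xs (g a x p))) (K a p (x # xs))) (ec (F a (x # xs) p)) t"
    if ap: "a \<in> D" "p \<in> Q a" "suffix (x # xs) (l a)" for a p x xs
  proof -
    have "suffix xs (l a)" using ap(3) by (meson suffix_ConsD)
    from F_le[OF ap(1) this gQ[OF ap(1,3,2)]]
    have "(\<mu> a + tree_size (Node (ec (F a xs (g a x p)))
          (Node (C a) (Node (ep p) (Node (eb x) (enc_list eb xs))))) + 2) ^ ch \<le> (N a + 2) ^ ch"
      using p_le[OF ap(1,2)] sz[OF ap(3)]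
      unfolding N_def by (intro power_mono) auto
    then show ?thesis
      using H0[rule_format, of "(a, p, x, xs)", unfolded mem_Collect_eq prod.case fst_conv snd_conv,
          OF conjI[OF ap(1) conjI[OF ap(2,3)]]]
      unfolding K_def enc_list_simps by (meson order_trans)
  qed
  let ?b = 1
  let ?g = "1 + length PB"
  let ?h = "?g + length PG"
  \<comment> \<open>The argument of the loop is a tree with the context, the parameter and the remaining list.\<close>
  let ?list = "RightOf (RightOf (Param 0))"
  let ?rec = "Call 0 [Join (LeftOf (Param 0)) (Join (Call ?g [Param 0]) (RightOf ?list))]"
  let ?m = "Cond ?list (Call ?h [Join ?rec (Param 0)]) (Call ?b [Param 0])"
  let ?P = "[?m] @ map (shift ?b) PB @ map (shift ?g) PG @ map (shift ?h) PH @ []"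
  have lB: "linked PB ?b ?P" by (rule linked_append) simp
  have lG: "linked PG ?g ?P"
    using linked_append[of "[?m] @ map (shift ?b) PB" ?g PG "map (shift ?h) PH @ []"] by simp
  have lH: "linked PH ?h ?P"
    using linked_append[of "[?m] @ map (shift ?b) PB @ map (shift ?g) PG" ?h PH "[]"] by simp
  define prog where "prog = ?P"
  have prog: "0 < length prog" "prog ! 0 = ?m" by (simp_all add: prog_def)
  note lB = lB[folded prog_def] and lG = lG[folded prog_def] and lH = lH[folded prog_def]
  \<comment> \<open>The evaluation of the loop body itself costs less than 30 steps besides the calls.\<close>
  define U where "U = (\<lambda>a. (N a + 2) ^ cb + (N a + 2) ^ cg + (N a + 2) ^ ch + 30)"
  have loop: "\<exists>t\<le>(length xs + 1) * U a. eval prog [K a p xs] ?m (ec (F a xs p)) t"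
    if aD: "a \<in> D" and "suffix xs (l a)" "p \<in> Q a" for a xs p
    using that(2,3)
  proof (induction xs arbitrary: p)
    case Nil
    obtain t where t: "t \<le> (N a + 2) ^ cb" "runs PB (K a p []) (ec (F a [] p)) t"
      using B[OF aD Nil(2)] by blast
    have "right_tree (right_tree (K a p [])) = Leaf" by (simp add: K_def)
    then have "eval prog [K a p []] ?list Leaf (1 + 1 + 1)"
      using eval_RightOf[OF eval_RightOf[OF eval_Param0[of prog "K a p []"]]] by simp
    then have "eval prog [K a p []] ?m (ec (F a [] p)) ((1 + 1 + 1) + (1 + t + 1) + 1)"
      by (rule eval_Cond_false[OF _ eval_Call_linked[OF t(2) lB eval_Param0]])
    moreover have "(1 + 1 + 1) + (1 + t + 1) + 1 \<le> (length [] + 1) * U a"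
      using t(1) by (simp add: U_def)
    ultimately show ?case by blast
  next
    case (Cons x xs)
    have sx: "suffix xs (l a)" using Cons.prems(1) by (meson suffix_ConsD)
    let ?p = "g a x p"
    have pQ: "?p \<in> Q a" using gQ[OF aD Cons.prems] .
    obtain r where r: "r \<le> (length xs + 1) * U a" "eval prog [K a ?p xs] ?m (ec (F a xs ?p)) r"
      using Cons.IH[OF sx pQ] by blast
    obtain s where s: "s \<le> (N a + 2) ^ cg" "runs PG (K a p (x # xs)) (ep ?p) s"
      using G[OF aD Cons.prems(2,1)] by blast
    obtain t where t: "t \<le> (N a + 2) ^ ch"
      "runs PH (Node (ec (F a xs ?p)) (K a p (x # xs))) (ec (F a (x # xs) p)) t"
      using H[OF aD Cons.prems(2,1)] by blast
    let ?k = "K a p (x # xs)"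
    have "right_tree (right_tree ?k) = Node (eb x) (enc_list eb xs)" by (simp add: K_def)
    then have list: "eval prog [?k] ?list (Node (eb x) (enc_list eb xs)) (1 + 1 + 1)"
      using eval_RightOf[OF eval_RightOf[OF eval_Param0[of prog ?k]]] by simp
    have tl: "eval prog [?k] (RightOf ?list) (enc_list eb xs) (1 + 1 + 1 + 1)"
      using eval_RightOf[OF list] by simp
    have c: "eval prog [?k] (LeftOf (Param 0)) (C a) (1 + 1)"
      using eval_LeftOf[OF eval_Param0[of prog ?k]] by (simp add: K_def)
    have arg: "eval prog [?k] (Join (LeftOf (Param 0)) (Join (Call ?g [Param 0]) (RightOf ?list)))
        (K a ?p xs) ((1 + 1) + ((1 + s + 1) + (1 + 1 + 1 + 1) + 1) + 1)"
      unfolding K_app[of a ?p xs]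
      by (intro eval_Join c tl eval_Call_linked[OF s(2) lG eval_Param0])
    have "evals prog [?k] [Join (LeftOf (Param 0)) (Join (Call ?g [Param 0]) (RightOf ?list))]
        [K a ?p xs] ((1 + 1) + ((1 + s + 1) + (1 + 1 + 1 + 1) + 1) + 1 + 0)"
      by (rule evals_Cons[OF arg evals_Nil])
    then have rec: "eval prog [?k] ?rec (ec (F a xs ?p))
        ((1 + 1) + ((1 + s + 1) + (1 + 1 + 1 + 1) + 1) + 1 + 0 + r + 1)"
      by (rule eval_Call) (use prog r(2) in simp_all)
    have "eval prog [?k] ?m (ec (F a (x # xs) p))
       ((1 + 1 + 1) + (((1 + 1) + ((1 + s + 1) + (1 + 1 + 1 + 1) + 1) + 1 + 0 + r + 1) + 1 + 1 + t + 1) + 1)"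
      by (rule eval_Cond_true[OF list _ eval_Call_linked[OF t(2) lH eval_Join[OF rec eval_Param0]]]) simp
    moreover have "(1 + 1 + 1) + (((1 + 1) + ((1 + s + 1) + (1 + 1 + 1 + 1) + 1) + 1 + 0 + r + 1) + 1 + 1 + t + 1) + 1
       \<le> (length (x # xs) + 1) * U a"
      using r(1) s(1) t(1)
      by (simp add: U_def)
    ultimately show ?case by blast
  qed
  have "ptime D \<mu> (\<lambda>a. K a (start a) (l a)) (\<lambda>a. ec (F a (l a) (start a)))"
  proof -
    let ?T = "\<lambda>a. tree_size (K a (start a) (l a)) * U a + bd a"
    have pb: "poly_bounded D ?M ?T"
      unfolding U_def K_def tree_size.simps
      by (intro poly_bounded_intros poly_bounded_context ptime_size[OF l] ptime_size[OF start(1)] pbN bd)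
    obtain c where c: "\<forall>a\<in>D. ?T a \<le> (?M a + 2) ^ c" using pb unfolding poly_bounded_def by blast
    show ?thesis
    proof (rule ptimeI)
      have "?T a \<le> (\<mu> a + tree_size (K a (start a) (l a)) + 2) ^ c" if "a \<in> D" for a
      proof -
        have "(?M a + 2) ^ c \<le> (\<mu> a + tree_size (K a (start a) (l a)) + 2) ^ c"
          by (rule power_mono) (auto simp: K_def)
        then show ?thesis using c that by (meson order_trans)
      qed
      then show "poly_bounded D (\<lambda>a. \<mu> a + tree_size (K a (start a) (l a))) ?T"
        unfolding poly_bounded_def by blast
      fix a assume a: "a \<in> D"
      show "tree_size (ec (F a (l a) (start a))) \<le> ?T a"
        using F_le[OF a _ start(2)[OF a]] by (simp add: trans_le_add2)
      obtain t where t: "t \<le> (length (l a) + 1) * U a"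
        "eval prog [K a (start a) (l a)] ?m (ec (F a (l a) (start a))) t"
        using loop[OF a _ start(2)[OF a], of "l a"] by auto
      have "length (l a) + 1 \<le> tree_size (K a (start a) (l a))"
        using length_le_tree_size[of "l a" eb] by (simp add: K_def)
      then have "t \<le> ?T a" using t(1) by (meson mult_le_mono1 order_trans trans_le_add1)
      moreover have "runs prog (K a (start a) (l a)) (ec (F a (l a) (start a))) t"
        using t(2) prog by (auto simp: runs_def)
      ultimately show "\<exists>t\<le>?T a. runs prog (K a (start a) (l a)) (ec (F a (l a) (start a))) t" by blast
    qed
  qed
  moreover have "ptime D \<mu> C (\<lambda>a. K a (start a) (l a))"
    unfolding K_def by (intro ptime_Node ptime_id start(1) l)
  ultimately show ?thesis by (rule ptime_trans[rotated])
qed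

lemma ptime_Node_left: "ptime D \<mu> C f \<Longrightarrow> ptime D \<mu> (\<lambda>a. Node (C a) (N a)) f"
  by (rule ptime_trans[of _ _ _ C]) (use ptime_left_id[of D \<mu> "\<lambda>a. Node (C a) (N a)"] in simp)

lemma ptime_Node_right: "ptime D \<mu> C f \<Longrightarrow> ptime D \<mu> (\<lambda>a. Node (N a) (C a)) f"
  by (rule ptime_trans[of _ _ _ C]) (use ptime_right_id[of D \<mu> "\<lambda>a. Node (N a) (C a)"] in simp)

lemma ptime_fst_of: "ptime D \<mu> C (\<lambda>a. Node (f a) (g a)) \<Longrightarrow> ptime D \<mu> C f"
  using ptime_left[of D \<mu> C "\<lambda>a. Node (f a) (g a)"] by simp

lemma ptime_snd_of: "ptime D \<mu> C (\<lambda>a. Node (f a) (g a)) \<Longrightarrow> ptime D \<mu> C g"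
  using ptime_right[of D \<mu> C "\<lambda>a. Node (f a) (g a)"] by simp

lemma ptime_outer:
  assumes "ptime D \<mu> C f" "\<And>z. z \<in> D' \<Longrightarrow> fst z \<in> D"
  shows "ptime D' (\<lambda>z. \<mu> (fst z)) (\<lambda>z. Node (C (fst z)) (N z)) (\<lambda>z. f (fst z))"
  using ptime_Node_left ptime_reindex[of D \<mu> C f D' fst] assms by fastforce

lemma ptime_inner: "ptime D \<mu> (\<lambda>z. Node (N z) (f z)) f"
  by (rule ptime_Node_right[OF ptime_id])

text \<open>
  The special case without a parameter. The tail of the list is available besides the recursive result.
\<close>

theorem ptime_structural_recursion:
  fixes F :: "'a \<Rightarrow> 'b list \<Rightarrow> 'c"
  assumes l: "ptime D \<mu> C (\<lambda>a. enc_list eb (l a))"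
    and bd: "poly_bounded D (\<lambda>a. \<mu> a + tree_size (C a)) bd"
    and F_le: "\<And>a xs. a \<in> D \<Longrightarrow> suffix xs (l a) \<Longrightarrow> tree_size (ec (F a xs)) \<le> bd a"
    and base: "ptime D \<mu> C (\<lambda>a. ec (F a []))"
    and step: "ptime {(a, x, xs). a \<in> D \<and> suffix (x # xs) (l a)} (\<lambda>z. \<mu> (fst z))
      (\<lambda>z. Node (C (fst z)) (Node (eb (fst (snd z)))
         (Node (enc_list eb (snd (snd z))) (ec (F (fst z) (snd (snd z)))))))
      (\<lambda>z. ec (F (fst z) (fst (snd z) # snd (snd z))))"
  shows "ptime D \<mu> C (\<lambda>a. ec (F a (l a)))"
proof -
  have "ptime D \<mu> C (\<lambda>a. ec ((\<lambda>a xs p. F a xs) a (l a) ((\<lambda>_. ()) a)))"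
  proof (rule ptime_list_recursion[where ep = "\<lambda>_. Leaf" and Q = "\<lambda>_. UNIV" and g = "\<lambda>_ _ _. ()"
        and bd = "\<lambda>a. bd a + 1", OF l])
    show "poly_bounded D (\<lambda>a. \<mu> a + tree_size (C a)) (\<lambda>a. bd a + 1)"
      by (intro poly_bounded_add bd poly_bounded_const)
    show "ptime {(a, p). a \<in> D \<and> p \<in> UNIV} (\<lambda>z. \<mu> (fst z))
      (\<lambda>z. Node (C (fst z)) (Node Leaf Leaf)) (\<lambda>z. ec (F (fst z) []))"
      by (rule ptime_outer[OF base]) auto
    let ?E = "{(a, p :: unit, x, xs). a \<in> D \<and> p \<in> UNIV \<and> suffix (x # xs) (l a)}"
    let ?L = "\<lambda>z. enc_list eb (snd (snd (snd z)))"
    let ?x = "\<lambda>z. eb (fst (snd (snd z)))"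
    let ?r = "\<lambda>z. ec (F (fst z) (snd (snd (snd z))))"
    let ?K = "\<lambda>z. Node (?r z) (Node (C (fst z)) (Node Leaf (Node (?x z) (?L z))))"
    have "ptime ?E (\<lambda>z. \<mu> (fst z)) ?K (\<lambda>z. Node (C (fst z)) (Node (?x z) (Node (?L z) (?r z))))"
      by (intro ptime_Node) (intro ptime_Node_right ptime_Node_left ptime_id | rule ptime_id)+
    moreover have "ptime ?E (\<lambda>z. \<mu> (fst z))
        (\<lambda>z. Node (C (fst z)) (Node (?x z) (Node (?L z) (?r z))))
        (\<lambda>z. ec (F (fst z) (fst (snd (snd z)) # snd (snd (snd z)))))"
      using ptime_reindex[OF step, of ?E "\<lambda>z. (fst z, snd (snd z))"] by auto
    ultimately show "ptime ?E (\<lambda>z. \<mu> (fst z)) ?K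
        (\<lambda>z. ec (F (fst z) (fst (snd (snd z)) # snd (snd (snd z)))))"
      by (rule ptime_trans)
  qed (auto intro: ptime_Leaf F_le le_SucI)
  then show ?thesis .
qed

section \<open>Boolean operations and list functions\<close>

lemma ptime_if:
  assumes "ptime D \<mu> C (\<lambda>a. tree_of_bool (b a))" "ptime D \<mu> C f" "ptime D \<mu> C g"
  shows "ptime D \<mu> C (\<lambda>a. if b a then f a else g a)"
  by (rule ptime_cong[OF ptime_cond[OF assms]]) (auto split: if_splits)

lemma ptime_if_enc:
  assumes "ptime D \<mu> C (\<lambda>a. tree_of_bool (b a))" "ptime D \<mu> C (\<lambda>a. e (f a))"
    "ptime D \<mu> C (\<lambda>a. e (g a))"
  shows "ptime D \<mu> C (\<lambda>a. e (if b a then f a else g a))"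
  by (rule ptime_cong[OF ptime_if[OF assms]]) auto

lemma ptime_True: "ptime D \<mu> C (\<lambda>_. tree_of_bool True)"
  by (simp add: ptime_Node ptime_Leaf)

lemma ptime_False: "ptime D \<mu> C (\<lambda>_. tree_of_bool False)"
  by (simp add: ptime_Leaf)

lemma ptime_not:
  assumes "ptime D \<mu> C (\<lambda>a. tree_of_bool (b a))"
  shows "ptime D \<mu> C (\<lambda>a. tree_of_bool (\<not> b a))"
  by (rule ptime_cong[OF ptime_if[OF assms ptime_False ptime_True]]) auto

lemma ptime_conj:
  assumes "ptime D \<mu> C (\<lambda>a. tree_of_bool (b a))" "ptime D \<mu> C (\<lambda>a. tree_of_bool (c a))"
  shows "ptime D \<mu> C (\<lambda>a. tree_of_bool (b a \<and> c a))"
  by (rule ptime_cong[OF ptime_if[OF assms ptime_False]]) auto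

lemma ptime_disj:
  assumes "ptime D \<mu> C (\<lambda>a. tree_of_bool (b a))" "ptime D \<mu> C (\<lambda>a. tree_of_bool (c a))"
  shows "ptime D \<mu> C (\<lambda>a. tree_of_bool (b a \<or> c a))"
  by (rule ptime_cong[OF ptime_if[OF assms(1) ptime_True assms(2)]]) auto

lemma ptime_imp:
  assumes "ptime D \<mu> C (\<lambda>a. tree_of_bool (b a))" "ptime D \<mu> C (\<lambda>a. tree_of_bool (c a))"
  shows "ptime D \<mu> C (\<lambda>a. tree_of_bool (b a \<longrightarrow> c a))"
  by (rule ptime_cong[OF ptime_if[OF assms ptime_True]]) auto

lemma ptime_iff:
  assumes "ptime D \<mu> C (\<lambda>a. tree_of_bool (b a))" "ptime D \<mu> C (\<lambda>a. tree_of_bool (c a))"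
  shows "ptime D \<mu> C (\<lambda>a. tree_of_bool (b a \<longleftrightarrow> c a))"
  by (rule ptime_cong[OF ptime_if[OF assms ptime_not[OF assms(2)]]]) auto

lemmas ptime_bool = ptime_True ptime_False ptime_not ptime_conj ptime_disj ptime_imp ptime_iff

lemma ptime_Nil: "ptime D \<mu> C (\<lambda>_. enc_list eb [])"
  by (simp add: ptime_Leaf)

lemma ptime_Cons:
  assumes "ptime D \<mu> C (\<lambda>a. eb (x a))" "ptime D \<mu> C (\<lambda>a. enc_list eb (xs a))"
  shows "ptime D \<mu> C (\<lambda>a. enc_list eb (x a # xs a))"
  using ptime_Node[OF assms] by simp

lemma ptime_tl:
  assumes "ptime D \<mu> C (\<lambda>a. enc_list eb (xs a))"
  shows "ptime D \<mu> C (\<lambda>a. enc_list eb (tl (xs a)))"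
  by (rule ptime_cong[OF ptime_right[OF assms]]) (metis enc_list_simps list.exhaust list.sel(2,3) right_tree.simps)

lemma ptime_nonempty:
  assumes "ptime D \<mu> C (\<lambda>a. enc_list eb (xs a))"
  shows "ptime D \<mu> C (\<lambda>a. tree_of_bool (xs a \<noteq> []))"
proof -
  have "enc_list eb ys \<noteq> Leaf \<longleftrightarrow> ys \<noteq> []" for ys by (cases ys) auto
  then show ?thesis
    by (intro ptime_cong[OF ptime_cond[OF assms ptime_True ptime_False]]) auto
qed

lemma ptime_null:
  assumes "ptime D \<mu> C (\<lambda>a. enc_list eb (xs a))"
  shows "ptime D \<mu> C (\<lambda>a. tree_of_bool (xs a = []))"
  using ptime_not[OF ptime_nonempty[OF assms]] by simp

lemma ptime_append:
  assumes "ptime D \<mu> C (\<lambda>a. enc_list eb (xs a))" "ptime D \<mu> C (\<lambda>a. enc_list eb (ys a))"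
  shows "ptime D \<mu> C (\<lambda>a. enc_list eb (xs a @ ys a))"
proof (rule ptime_structural_recursion[where F = "\<lambda>a xs. xs @ ys a", OF assms(1),
      where bd = "\<lambda>a. tree_size (enc_list eb (xs a)) + tree_size (enc_list eb (ys a))"])
  show "poly_bounded D (\<lambda>a. \<mu> a + tree_size (C a))
     (\<lambda>a. tree_size (enc_list eb (xs a)) + tree_size (enc_list eb (ys a)))"
    by (intro poly_bounded_add ptime_size assms)
  show "tree_size (enc_list eb (zs @ ys a)) \<le> tree_size (enc_list eb (xs a)) + tree_size (enc_list eb (ys a))"
    if "suffix zs (xs a)" for a zs
  proof -
    have "tree_size (enc_list eb (zs @ ys a)) \<le> tree_size (enc_list eb zs) + tree_size (enc_list eb (ys a))"
      by (induction zs) auto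
    then show ?thesis using tree_size_suffix[OF that, of eb] by linarith
  qed
  show "ptime D \<mu> C (\<lambda>a. enc_list eb ([] @ ys a))" using assms(2) by simp
  show "ptime {(a, x, zs). a \<in> D \<and> suffix (x # zs) (xs a)} (\<lambda>z. \<mu> (fst z))
      (\<lambda>z. Node (C (fst z)) (Node (eb (fst (snd z)))
        (Node (enc_list eb (snd (snd z))) (enc_list eb (snd (snd z) @ ys (fst z))))))
      (\<lambda>z. enc_list eb ((fst (snd z) # snd (snd z)) @ ys (fst z)))"
    unfolding append_Cons
    by (rule ptime_Cons[OF ptime_Node_right[OF ptime_Node_left[OF ptime_id]]
          ptime_Node_right[OF ptime_Node_right[OF ptime_Node_right[OF ptime_id]]]])
qed

text \<open>
  Computability of the elements, each in its own context, already contains a common bound on their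
  sizes, from which the sizes of maps and concatenations are derived.
\<close>

lemma elementwise_bound:
  assumes l: "ptime D \<mu> C (\<lambda>a. enc_list eb (l a))"
    and h: "ptime {z. fst z \<in> D \<and> snd z \<in> set (l (fst z))} (\<lambda>z. \<mu> (fst z))
      (\<lambda>z. Node (C (fst z)) (eb (snd z))) (\<lambda>z. eh (h (fst z) (snd z)))"
  obtains b where "poly_bounded D (\<lambda>a. \<mu> a + tree_size (C a)) b"
    and "\<And>a x. a \<in> D \<Longrightarrow> x \<in> set (l a) \<Longrightarrow> tree_size (eh (h a x)) \<le> b a"
proof -
  obtain c where c: "\<And>z. z \<in> {z. fst z \<in> D \<and> snd z \<in> set (l (fst z))} \<Longrightarrow> tree_size (eh (h (fst z) (snd z)))
     \<le> (\<mu> (fst z) + tree_size (Node (C (fst z)) (eb (snd z))) + 2) ^ c"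
    using ptime_size[OF h] unfolding poly_bounded_def by blast
  define b where "b = (\<lambda>a. (\<mu> a + tree_size (C a) + tree_size (enc_list eb (l a)) + 3) ^ c)"
  show thesis
  proof (rule that[of b])
    show "poly_bounded D (\<lambda>a. \<mu> a + tree_size (C a)) b"
      unfolding b_def
      by (intro poly_bounded_power poly_bounded_add[OF poly_bounded_add[OF poly_bounded_self]]
          ptime_size[OF l] poly_bounded_const)
    fix a x assume ax: "a \<in> D" "x \<in> set (l a)"
    have "tree_size (eh (h a x)) \<le> (\<mu> a + tree_size (Node (C a) (eb x)) + 2) ^ c"
      using c[of "(a, x)"] ax by simp
    also have "\<dots> \<le> b a"
      unfolding b_def using tree_size_elem[OF ax(2), of eb] by (intro power_mono) auto
    finally show "tree_size (eh (h a x)) \<le> b a" .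
  qed
qed

lemma tree_size_concat:
  assumes "\<And>x. x \<in> set xs \<Longrightarrow> tree_size (enc_list eh (h x)) \<le> b"
  shows "tree_size (enc_list eh (concat (map h xs))) \<le> length xs * b + 1"
  using assms
proof (induction xs)
  case (Cons x xs)
  have "tree_size (enc_list eh (ys @ zs)) \<le> tree_size (enc_list eh ys) + tree_size (enc_list eh zs)" for ys zs
    by (induction ys) auto
  then have "tree_size (enc_list eh (concat (map h (x # xs))))
    \<le> tree_size (enc_list eh (h x)) + tree_size (enc_list eh (concat (map h xs)))" by simp
  also have "\<dots> \<le> b + (length xs * b + 1)" by (intro add_mono Cons.IH) (auto intro: Cons.prems)
  finally show ?case by simp
qed simp

text \<open>
  Maps, filters and bounded quantifiers over lists are all special cases of this rule.
\<close>

theorem ptime_concat_map: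
  assumes l: "ptime D \<mu> C (\<lambda>a. enc_list eb (l a))"
    and h: "ptime {z. fst z \<in> D \<and> snd z \<in> set (l (fst z))} (\<lambda>z. \<mu> (fst z))
      (\<lambda>z. Node (C (fst z)) (eb (snd z))) (\<lambda>z. enc_list eh (h (fst z) (snd z)))"
  shows "ptime D \<mu> C (\<lambda>a. enc_list eh (concat (map (h a) (l a))))"
proof -
  obtain b where b: "poly_bounded D (\<lambda>a. \<mu> a + tree_size (C a)) b"
    and hb: "\<And>a x. a \<in> D \<Longrightarrow> x \<in> set (l a) \<Longrightarrow> tree_size (enc_list eh (h a x)) \<le> b a"
    by (rule elementwise_bound[where h = h and eh = "enc_list eh", OF l h]) blast
  show ?thesis
  proof (rule ptime_structural_recursion[where F = "\<lambda>a xs. concat (map (h a) xs)", OF l,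
        where bd = "\<lambda>a. tree_size (enc_list eb (l a)) * b a + 1"])
    show "poly_bounded D (\<lambda>a. \<mu> a + tree_size (C a)) (\<lambda>a. tree_size (enc_list eb (l a)) * b a + 1)"
      by (intro poly_bounded_add poly_bounded_mult ptime_size[OF l] b poly_bounded_const)
    fix a xs assume a: "a \<in> D" "suffix xs (l a)"
    have "tree_size (enc_list eh (concat (map (h a) xs))) \<le> length xs * b a + 1"
      by (rule tree_size_concat) (use a hb set_mono_suffix in blast)
    moreover have "length xs \<le> tree_size (enc_list eb (l a))"
      using length_le_tree_size[of xs eb] tree_size_suffix[OF a(2), of eb] by simp
    ultimately show "tree_size (enc_list eh (concat (map (h a) xs)))
       \<le> tree_size (enc_list eb (l a)) * b a + 1"
      by (meson add_le_mono1 mult_le_mono1 order_trans)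
  next
    show "ptime D \<mu> C (\<lambda>a. enc_list eh (concat (map (h a) [])))" by (simp add: ptime_Leaf)
  next
    let ?E = "{(a, x, xs). a \<in> D \<and> suffix (x # xs) (l a)}"
    let ?K = "\<lambda>z. Node (C (fst z)) (Node (eb (fst (snd z))) (Node (enc_list eb (snd (snd z)))
        (enc_list eh (concat (map (h (fst z)) (snd (snd z)))))))"
    have "ptime ?E (\<lambda>z. \<mu> (fst z)) (\<lambda>z. Node (C (fst z)) (eb (fst (snd z))))
        (\<lambda>z. enc_list eh (h (fst z) (fst (snd z))))"
      using ptime_reindex[OF h, of ?E "\<lambda>z. (fst z, fst (snd z))"] set_mono_suffix by fastforce
    moreover have "ptime ?E (\<lambda>z. \<mu> (fst z)) ?K (\<lambda>z. Node (C (fst z)) (eb (fst (snd z))))"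
      by (intro ptime_Node) (intro ptime_Node_right ptime_Node_left ptime_id | rule ptime_Node_left ptime_id)+
    ultimately have "ptime ?E (\<lambda>z. \<mu> (fst z)) ?K (\<lambda>z. enc_list eh (h (fst z) (fst (snd z))))"
      by (rule ptime_trans[rotated])
    then show "ptime ?E (\<lambda>z. \<mu> (fst z)) ?K
      (\<lambda>z. enc_list eh (concat (map (h (fst z)) (fst (snd z) # snd (snd z)))))"
      by (simp only: list.map concat.simps)
        (intro ptime_append, assumption, intro ptime_Node_right ptime_id)
  qed
qed

lemma ptime_map:
  assumes "ptime D \<mu> C (\<lambda>a. enc_list eb (l a))"
    and "ptime {z. fst z \<in> D \<and> snd z \<in> set (l (fst z))} (\<lambda>z. \<mu> (fst z))
      (\<lambda>z. Node (C (fst z)) (eb (snd z))) (\<lambda>z. eh (h (fst z) (snd z)))"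
  shows "ptime D \<mu> C (\<lambda>a. enc_list eh (map (h a) (l a)))"
proof -
  have "concat (map (\<lambda>x. [h a x]) xs) = map (h a) xs" for a xs by (induction xs) auto
  then show ?thesis
    using ptime_concat_map[where h = "\<lambda>a x. [h a x]", OF assms(1)
        ptime_Cons[where x = "\<lambda>z. h (fst z) (snd z)", OF assms(2) ptime_Nil]] by simp
qed

lemma ptime_filter:
  assumes "ptime D \<mu> C (\<lambda>a. enc_list eb (l a))"
    and "ptime {z. fst z \<in> D \<and> snd z \<in> set (l (fst z))} (\<lambda>z. \<mu> (fst z))
      (\<lambda>z. Node (C (fst z)) (eb (snd z))) (\<lambda>z. tree_of_bool (p (fst z) (snd z)))"
  shows "ptime D \<mu> C (\<lambda>a. enc_list eb (filter (p a) (l a)))"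
proof -
  have "concat (map (\<lambda>x. if p a x then [x] else []) xs) = filter (p a) xs" for a xs
    by (induction xs) auto
  then show ?thesis
    using ptime_concat_map[OF assms(1), where h = "\<lambda>a x. if p a x then [x] else []",
        OF ptime_if_enc[where e = "enc_list eb", OF assms(2) ptime_Cons[OF ptime_inner ptime_Nil] ptime_Nil]]
    by simp
qed

lemma ptime_list_ex:
  assumes "ptime D \<mu> C (\<lambda>a. enc_list eb (l a))"
    and "ptime {z. fst z \<in> D \<and> snd z \<in> set (l (fst z))} (\<lambda>z. \<mu> (fst z))
      (\<lambda>z. Node (C (fst z)) (eb (snd z))) (\<lambda>z. tree_of_bool (p (fst z) (snd z)))"
  shows "ptime D \<mu> C (\<lambda>a. tree_of_bool (list_ex (p a) (l a)))"
proof -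
  have "list_ex (p a) xs \<longleftrightarrow> filter (p a) xs \<noteq> []" for a xs by (induction xs) auto
  then show ?thesis using ptime_nonempty[OF ptime_filter[OF assms]] by simp
qed

lemma ptime_list_all:
  assumes "ptime D \<mu> C (\<lambda>a. enc_list eb (l a))"
    and "ptime {z. fst z \<in> D \<and> snd z \<in> set (l (fst z))} (\<lambda>z. \<mu> (fst z))
      (\<lambda>z. Node (C (fst z)) (eb (snd z))) (\<lambda>z. tree_of_bool (p (fst z) (snd z)))"
  shows "ptime D \<mu> C (\<lambda>a. tree_of_bool (list_all (p a) (l a)))"
proof -
  have "list_all (p a) xs \<longleftrightarrow> \<not> list_ex (\<lambda>x. \<not> p a x) xs" for a xs
    by (induction xs) auto
  then show ?thesis using ptime_not[OF ptime_list_ex[OF assms(1) ptime_not[OF assms(2)]]] by simp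
qed

lemmas ptime_proj =
  ptime_id
  ptime_Node_left[OF ptime_id]
  ptime_Node_right[OF ptime_id]
  ptime_Node_right[OF ptime_Node_left[OF ptime_id]]
  ptime_Node_right[OF ptime_Node_right[OF ptime_id]]
  ptime_Node_right[OF ptime_Node_right[OF ptime_Node_left[OF ptime_id]]]
  ptime_Node_right[OF ptime_Node_right[OF ptime_Node_right[OF ptime_id]]]
  ptime_Node_right[OF ptime_Node_right[OF ptime_Node_right[OF ptime_Node_left[OF ptime_id]]]]
  ptime_Node_right[OF ptime_Node_right[OF ptime_Node_right[OF ptime_Node_right[OF ptime_id]]]]

definition enc_pair :: "('b \<Rightarrow> tree) \<Rightarrow> ('c \<Rightarrow> tree) \<Rightarrow> 'b \<times> 'c \<Rightarrow> tree" where
  "enc_pair eb ec p = Node (eb (fst p)) (ec (snd p))"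

lemma ptime_fst:
  assumes "ptime D \<mu> C (\<lambda>a. enc_pair eb ec (p a))"
  shows "ptime D \<mu> C (\<lambda>a. eb (fst (p a)))"
  using assms unfolding enc_pair_def by (rule ptime_fst_of)

lemma ptime_snd:
  assumes "ptime D \<mu> C (\<lambda>a. enc_pair eb ec (p a))"
  shows "ptime D \<mu> C (\<lambda>a. ec (snd (p a)))"
  using assms unfolding enc_pair_def by (rule ptime_snd_of)

lemma ptime_pair:
  assumes "ptime D \<mu> C (\<lambda>a. eb (x a))" "ptime D \<mu> C (\<lambda>a. ec (y a))"
  shows "ptime D \<mu> C (\<lambda>a. enc_pair eb ec (x a, y a))"
  using ptime_Node[OF assms] by (simp add: enc_pair_def)

section \<open>Binary arithmetic\<close>

abbreviation enc_bits :: "bool list \<Rightarrow> tree" where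
  "enc_bits \<equiv> enc_list tree_of_bool"

fun bits_val :: "bool list \<Rightarrow> nat" where
  "bits_val [] = 0"
| "bits_val (b # bs) = of_bool b + 2 * bits_val bs"

lemma bits_val_bits: "bits_val (bits n) = n"
proof (induction n rule: bits.induct)
  case (1 n)
  show ?case
  proof (cases "n = 0")
    case False
    have "bits_val (bits n) = of_bool (odd n) + 2 * (n div 2)"
      using 1[OF False] False by (subst bits.simps) simp
    then show ?thesis by (simp add: mod2_eq_if[symmetric] mult.commute)
  qed (subst bits.simps, simp)
qed

lemma bits_inject: "bits m = bits n \<longleftrightarrow> m = n"
  by (metis bits_val_bits)

lemma tree_of_nat_bits: "tree_of_nat n = enc_bits (bits n)"
  by (simp add: tree_of_nat_def enc_list_def)

lemma tree_size_bits: "tree_size (enc_bits bs) \<le> 4 * length bs + 1"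
proof (induction bs)
  case (Cons b bs)
  then show ?case by (cases b) auto
qed simp

text \<open>
  Bit lists that are too short are read as if they were continued by zeros. This lets addition and
  comparison recurse on one argument only.
\<close>

definition low_bit :: "bool list \<Rightarrow> bool" where
  "low_bit bs \<longleftrightarrow> bs \<noteq> [] \<and> hd bs"

lemma ptime_low_bit:
  assumes "ptime D \<mu> C (\<lambda>a. enc_bits (xs a))"
  shows "ptime D \<mu> C (\<lambda>a. tree_of_bool (low_bit (xs a)))"
proof -
  have "left_tree (enc_bits bs) = tree_of_bool (low_bit bs)" for bs
    by (cases bs) (auto simp: low_bit_def)
  then show ?thesis using ptime_left[OF assms] by simp
qed

lemma bits_val_low_bit: "bits_val bs = of_bool (low_bit bs) + 2 * bits_val (tl bs)"
  by (cases bs) (auto simp: low_bit_def)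

lemma tree_size_tl: "tree_size (enc_list eb (tl bs)) \<le> tree_size (enc_list eb bs)"
  by (cases bs) auto

lemma tree_size_bool: "tree_size (tree_of_bool b) \<le> 3"
  by (cases b) auto

lemma ptime_bits_eq:
  assumes xs: "ptime D \<mu> C (\<lambda>a. enc_bits (xs a))" and ys: "ptime D \<mu> C (\<lambda>a. enc_bits (ys a))"
  shows "ptime D \<mu> C (\<lambda>a. tree_of_bool (xs a = ys a))"
proof -
  have eq: "x # zs = p \<longleftrightarrow> p \<noteq> [] \<and> x = low_bit p \<and> zs = tl p" for x zs p
    by (cases p) (auto simp: low_bit_def)
  show ?thesis
  proof (rule ptime_list_recursion[where F = "\<lambda>_ xs p. xs = p" and ep = enc_bits and start = ys
          and Q = "\<lambda>a. {p. tree_size (enc_bits p) \<le> tree_size (enc_bits (ys a))}"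
          and g = "\<lambda>_ _. tl" and bd = "\<lambda>a. tree_size (enc_bits (ys a)) + 3", OF xs ys])
    show "poly_bounded D (\<lambda>a. \<mu> a + tree_size (C a)) (\<lambda>a. tree_size (enc_bits (ys a)) + 3)"
      by (intro poly_bounded_add ptime_size[OF ys] poly_bounded_const)
  next
    show "ptime {(a, p). a \<in> D \<and> p \<in> {p. tree_size (enc_bits p) \<le> tree_size (enc_bits (ys a))}}
      (\<lambda>z. \<mu> (fst z)) (\<lambda>z. Node (C (fst z)) (Node (enc_bits (snd z)) Leaf))
      (\<lambda>z. tree_of_bool ([] = snd z))"
      by (subst eq_commute, rule ptime_null) (rule ptime_proj)
  qed (simp_all add: eq le_trans[OF tree_size_tl] trans_le_add2[OF tree_size_bool],
       (intro ptime_bool ptime_nonempty ptime_low_bit ptime_iff ptime_tl; rule ptime_proj)+)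
qed

fun inc :: "bool list \<Rightarrow> bool list" where
  "inc [] = [True]"
| "inc (b # bs) = (if b then False # inc bs else True # bs)"

fun add_carry :: "bool list \<Rightarrow> bool list \<Rightarrow> bool \<Rightarrow> bool list" where
  "add_carry [] ys c = (if c then inc ys else ys)"
| "add_carry (x # xs) ys c = (x \<longleftrightarrow> (low_bit ys \<longleftrightarrow> c)) #
     add_carry xs (tl ys) (if x then low_bit ys \<or> c else low_bit ys \<and> c)"

fun mult_bits :: "bool list \<Rightarrow> bool list \<Rightarrow> bool list" where
  "mult_bits [] ys = []"
| "mult_bits (x # xs) ys = (if x then add_carry ys (False # mult_bits xs ys) False else False # mult_bits xs ys)"

text \<open>
  The lists start with the least significant bit. The third argument is the outcome of the comparison
  of the bits already seen, and a later position overrides it.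
\<close>

fun le_bits :: "bool list \<Rightarrow> bool list \<Rightarrow> bool \<Rightarrow> bool" where
  "le_bits [] ys c \<longleftrightarrow> c \<or> list_ex (\<lambda>b. b) ys"
| "le_bits (x # xs) ys c \<longleftrightarrow> le_bits xs (tl ys) (if x \<longleftrightarrow> low_bit ys then c else low_bit ys)"

lemma bits_val_inc: "bits_val (inc bs) = bits_val bs + 1"
  by (induction bs) auto

lemma bits_val_add_carry: "bits_val (add_carry xs ys c) = bits_val xs + bits_val ys + of_bool c"
proof (induction xs ys c rule: add_carry.induct)
  case (2 x xs ys c)
  then show ?case using bits_val_low_bit[of ys] by (auto simp: of_bool_def)
qed (auto simp: bits_val_inc)

lemma bits_val_mult_bits: "bits_val (mult_bits xs ys) = bits_val xs * bits_val ys"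
  by (induction xs) (auto simp: bits_val_add_carry algebra_simps)

lemma bits_val_zero_iff: "bits_val bs = 0 \<longleftrightarrow> \<not> list_ex (\<lambda>b. b) bs"
  by (induction bs) auto

lemma le_bits: "le_bits xs ys c \<longleftrightarrow> bits_val xs < bits_val ys \<or> bits_val xs = bits_val ys \<and> c"
proof (induction xs ys c rule: le_bits.induct)
  case (1 ys c)
  then show ?case using bits_val_zero_iff[of ys] by auto
next
  case (2 x xs ys c)
  show ?case
    unfolding le_bits.simps(2) 2 bits_val.simps(2) bits_val_low_bit[of ys]
    by (cases x; cases "low_bit ys"; cases c) auto
qed

lemma length_inc: "length (inc bs) \<le> length bs + 1"
  by (induction bs) auto

lemma length_add_carry: "length (add_carry xs ys c) \<le> max (length xs) (length ys) + 1"
proof (induction xs ys c rule: add_carry.induct)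
  case (1 ys c)
  then show ?case using length_inc[of ys] by auto
next
  case (2 x xs ys c)
  then show ?case by (cases ys) auto
qed

text \<open>
  The dependence on the second argument has factor 1. In an iterated product the accumulator is the
  second argument, so its length grows additively.
\<close>

lemma length_mult_bits: "length (mult_bits xs ys) \<le> 2 * length xs + length ys"
proof (induction xs)
  case (Cons x xs)
  then show ?case using length_add_carry[of ys "False # mult_bits xs ys" False] by auto
qed simp

lemma ptime_inc:
  assumes "ptime D \<mu> C (\<lambda>a. enc_bits (xs a))"
  shows "ptime D \<mu> C (\<lambda>a. enc_bits (inc (xs a)))"
proof (rule ptime_structural_recursion[where F = "\<lambda>_ xs. inc xs", OF assms,
      where bd = "\<lambda>a. 4 * (tree_size (enc_bits (xs a)) + 1) + 1"])
  show "poly_bounded D (\<lambda>a. \<mu> a + tree_size (C a)) (\<lambda>a. 4 * (tree_size (enc_bits (xs a)) + 1) + 1)"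
    by (intro poly_bounded_intros ptime_size[OF assms])
  fix a zs assume "suffix zs (xs a)"
  then show "tree_size (enc_bits (inc zs)) \<le> 4 * (tree_size (enc_bits (xs a)) + 1) + 1"
    using tree_size_bits[of "inc zs"] length_inc[of zs] length_le_tree_size[of zs tree_of_bool]
      tree_size_suffix[of zs "xs a" tree_of_bool] by simp
next
  show "ptime D \<mu> C (\<lambda>a. enc_bits (inc []))"
    unfolding inc.simps by (intro ptime_Cons ptime_True ptime_Nil)
qed (unfold inc.simps, intro ptime_if_enc[where e = enc_bits] ptime_Cons ptime_bool; rule ptime_proj)

lemma ptime_add_carry:
  assumes xs: "ptime D \<mu> C (\<lambda>a. enc_bits (xs a))" and ys: "ptime D \<mu> C (\<lambda>a. enc_bits (ys a))"
    and c: "ptime D \<mu> C (\<lambda>a. tree_of_bool (c a))"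
  shows "ptime D \<mu> C (\<lambda>a. enc_bits (add_carry (xs a) (ys a) (c a)))"
proof -
  have "ptime D \<mu> C (\<lambda>a. enc_bits ((\<lambda>a zs p. add_carry zs (fst p) (snd p)) a (xs a)
       ((\<lambda>a. (ys a, c a)) a)))"
  proof (rule ptime_list_recursion[where F = "\<lambda>_ zs p. add_carry zs (fst p) (snd p)"
        and ep = "enc_pair enc_bits tree_of_bool" and start = "\<lambda>a. (ys a, c a)"
        and Q = "\<lambda>a. {p. tree_size (enc_bits (fst p)) \<le> tree_size (enc_bits (ys a))}"
        and g = "\<lambda>_ x p. (tl (fst p), if x then low_bit (fst p) \<or> snd p else low_bit (fst p) \<and> snd p)"
        and bd = "\<lambda>a. 4 * (tree_size (enc_bits (xs a)) + tree_size (enc_bits (ys a))) + 5", OF xs])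
    show "ptime D \<mu> C (\<lambda>a. enc_pair enc_bits tree_of_bool (ys a, c a))"
      by (intro ptime_pair ys c)
    show "poly_bounded D (\<lambda>a. \<mu> a + tree_size (C a))
        (\<lambda>a. 4 * (tree_size (enc_bits (xs a)) + tree_size (enc_bits (ys a))) + 5)"
      by (intro poly_bounded_add poly_bounded_mult poly_bounded_const ptime_size xs ys)
    fix a and p :: "bool list \<times> bool"
    assume "p \<in> {p. tree_size (enc_bits (fst p)) \<le> tree_size (enc_bits (ys a))}"
    then have p: "tree_size (enc_bits (fst p)) \<le> tree_size (enc_bits (ys a))" by simp
    show "tree_size (enc_pair enc_bits tree_of_bool p)
       \<le> 4 * (tree_size (enc_bits (xs a)) + tree_size (enc_bits (ys a))) + 5"
      using p tree_size_bool[of "snd p"] by (simp add: enc_pair_def)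
    have len: "length (add_carry zs (fst p) (snd p)) \<le> length zs + length (fst p) + 1" for zs
      using length_add_carry[of zs "fst p" "snd p"] by (rule order_trans) simp
    show "tree_size (enc_bits (add_carry zs (fst p) (snd p)))
       \<le> 4 * (tree_size (enc_bits (xs a)) + tree_size (enc_bits (ys a))) + 5" if "suffix zs (xs a)" for zs
      using p tree_size_bits[of "add_carry zs (fst p) (snd p)"] len[of zs]
        length_le_tree_size[of zs tree_of_bool] length_le_tree_size[of "fst p" tree_of_bool]
        tree_size_suffix[OF that, of tree_of_bool] by simp
    show "(tl (fst p), if x then low_bit (fst p) \<or> snd p else low_bit (fst p) \<and> snd p)
        \<in> {p. tree_size (enc_bits (fst p)) \<le> tree_size (enc_bits (ys a))}" for x
      using p le_trans[OF tree_size_tl] by simp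
  next
    let ?D = "{(a, p). a \<in> D \<and> p \<in> {p. tree_size (enc_bits (fst p)) \<le> tree_size (enc_bits (ys a))}}"
    have "ptime ?D (\<lambda>z. \<mu> (fst z)) (\<lambda>z. Node (C (fst z)) (Node (enc_pair enc_bits tree_of_bool (snd z)) Leaf))
      (\<lambda>z. enc_pair enc_bits tree_of_bool (snd z))" by (rule ptime_proj)
    note p = ptime_fst[OF this] ptime_snd[OF this]
    show "ptime ?D (\<lambda>z. \<mu> (fst z)) (\<lambda>z. Node (C (fst z)) (Node (enc_pair enc_bits tree_of_bool (snd z)) Leaf))
      (\<lambda>z. enc_bits (add_carry [] (fst (snd z)) (snd (snd z))))"
      unfolding add_carry.simps by (intro ptime_if_enc[where e = enc_bits] ptime_inc p)
  next
    let ?E = "{(a, p, x, zs). a \<in> D \<and> p \<in> {p. tree_size (enc_bits (fst p)) \<le> tree_size (enc_bits (ys a))}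
       \<and> suffix (x # zs) (xs a)}"
    let ?p = "\<lambda>z. fst (snd z)"
    let ?x = "\<lambda>z. fst (snd (snd z))"
    let ?K = "\<lambda>z. Node (C (fst z)) (Node (enc_pair enc_bits tree_of_bool (?p z))
        (Node (tree_of_bool (?x z)) (enc_bits (snd (snd (snd z))))))"
    have "ptime ?E (\<lambda>z. \<mu> (fst z)) ?K (\<lambda>z. enc_pair enc_bits tree_of_bool (?p z))" by (rule ptime_proj)
    note p = ptime_fst[OF this] ptime_snd[OF this]
    have x: "ptime ?E (\<lambda>z. \<mu> (fst z)) ?K (\<lambda>z. tree_of_bool (?x z))" by (rule ptime_proj)
    show "ptime ?E (\<lambda>z. \<mu> (fst z)) ?K (\<lambda>z. enc_pair enc_bits tree_of_bool
        (tl (fst (?p z)), if ?x z then low_bit (fst (?p z)) \<or> snd (?p z) else low_bit (fst (?p z)) \<and> snd (?p z)))"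
      by (intro ptime_pair ptime_tl ptime_if_enc[where e = tree_of_bool] ptime_bool ptime_low_bit p x)
    let ?K' = "\<lambda>z. Node (enc_bits (add_carry (snd (snd (snd z)))
         (fst (tl (fst (?p z)), if ?x z then low_bit (fst (?p z)) \<or> snd (?p z) else low_bit (fst (?p z)) \<and> snd (?p z)))
         (snd (tl (fst (?p z)), if ?x z then low_bit (fst (?p z)) \<or> snd (?p z) else low_bit (fst (?p z)) \<and> snd (?p z)))))
        (?K z)"
    show "ptime ?E (\<lambda>z. \<mu> (fst z)) ?K' (\<lambda>z. enc_bits (add_carry (?x z # snd (snd (snd z))) (fst (?p z)) (snd (?p z))))"
      unfolding add_carry.simps fst_conv snd_conv
      by (intro ptime_Cons ptime_iff ptime_low_bit p[THEN ptime_Node_right] x[THEN ptime_Node_right])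
         (rule ptime_proj)
  qed simp
  then show ?thesis by simp
qed

lemma ptime_mult_bits:
  assumes xs: "ptime D \<mu> C (\<lambda>a. enc_bits (xs a))" and ys: "ptime D \<mu> C (\<lambda>a. enc_bits (ys a))"
  shows "ptime D \<mu> C (\<lambda>a. enc_bits (mult_bits (xs a) (ys a)))"
proof (rule ptime_structural_recursion[where F = "\<lambda>a zs. mult_bits zs (ys a)", OF xs,
      where bd = "\<lambda>a. 8 * (tree_size (enc_bits (xs a)) + tree_size (enc_bits (ys a))) + 1"])
  show "poly_bounded D (\<lambda>a. \<mu> a + tree_size (C a))
      (\<lambda>a. 8 * (tree_size (enc_bits (xs a)) + tree_size (enc_bits (ys a))) + 1)"
    by (intro poly_bounded_add poly_bounded_mult poly_bounded_const ptime_size xs ys)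
  fix a zs assume "suffix zs (xs a)"
  then show "tree_size (enc_bits (mult_bits zs (ys a)))
     \<le> 8 * (tree_size (enc_bits (xs a)) + tree_size (enc_bits (ys a))) + 1"
    using tree_size_bits[of "mult_bits zs (ys a)"] length_mult_bits[of zs "ys a"]
      length_le_tree_size[of zs tree_of_bool] length_le_tree_size[of "ys a" tree_of_bool]
      tree_size_suffix[of zs "xs a" tree_of_bool] by simp
next
  show "ptime D \<mu> C (\<lambda>a. enc_bits (mult_bits [] (ys a)))" by (simp add: ptime_Leaf)
next
  let ?E = "{(a, x, zs). a \<in> D \<and> suffix (x # zs) (xs a)}"
  let ?K = "\<lambda>z. Node (C (fst z)) (Node (tree_of_bool (fst (snd z))) (Node (enc_bits (snd (snd z)))
      (enc_bits (mult_bits (snd (snd z)) (ys (fst z))))))"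
  have y: "ptime ?E (\<lambda>z. \<mu> (fst z)) ?K (\<lambda>z. enc_bits (ys (fst z)))"
    by (rule ptime_outer[OF ys]) auto
  show "ptime ?E (\<lambda>z. \<mu> (fst z)) ?K (\<lambda>z. enc_bits (mult_bits (fst (snd z) # snd (snd z)) (ys (fst z))))"
    unfolding mult_bits.simps
    by (intro ptime_if_enc[where e = enc_bits] ptime_add_carry ptime_Cons ptime_False y; rule ptime_proj)
qed

lemma ptime_le_bits:
  assumes xs: "ptime D \<mu> C (\<lambda>a. enc_bits (xs a))" and ys: "ptime D \<mu> C (\<lambda>a. enc_bits (ys a))"
    and c: "ptime D \<mu> C (\<lambda>a. tree_of_bool (c a))"
  shows "ptime D \<mu> C (\<lambda>a. tree_of_bool (le_bits (xs a) (ys a) (c a)))"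
proof -
  have "ptime D \<mu> C (\<lambda>a. tree_of_bool ((\<lambda>a zs p. le_bits zs (fst p) (snd p)) a (xs a)
       ((\<lambda>a. (ys a, c a)) a)))"
  proof (rule ptime_list_recursion[where F = "\<lambda>_ zs p. le_bits zs (fst p) (snd p)"
        and ep = "enc_pair enc_bits tree_of_bool" and start = "\<lambda>a. (ys a, c a)"
        and Q = "\<lambda>a. {p. tree_size (enc_bits (fst p)) \<le> tree_size (enc_bits (ys a))}"
        and g = "\<lambda>_ x p. (tl (fst p), if x \<longleftrightarrow> low_bit (fst p) then snd p else low_bit (fst p))"
        and bd = "\<lambda>a. tree_size (enc_bits (ys a)) + 5", OF xs])
    show "ptime D \<mu> C (\<lambda>a. enc_pair enc_bits tree_of_bool (ys a, c a))"
      by (intro ptime_pair ys c)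
    show "poly_bounded D (\<lambda>a. \<mu> a + tree_size (C a)) (\<lambda>a. tree_size (enc_bits (ys a)) + 5)"
      by (intro poly_bounded_add poly_bounded_const ptime_size ys)
    fix a and p :: "bool list \<times> bool"
    assume "p \<in> {p. tree_size (enc_bits (fst p)) \<le> tree_size (enc_bits (ys a))}"
    then have p: "tree_size (enc_bits (fst p)) \<le> tree_size (enc_bits (ys a))" by simp
    show "tree_size (enc_pair enc_bits tree_of_bool p) \<le> tree_size (enc_bits (ys a)) + 5"
      using p tree_size_bool[of "snd p"] by (simp add: enc_pair_def)
    show "tree_size (tree_of_bool (le_bits zs (fst p) (snd p))) \<le> tree_size (enc_bits (ys a)) + 5" for zs
      using tree_size_bool[of "le_bits zs (fst p) (snd p)"] by linarith
    show "(tl (fst p), if x \<longleftrightarrow> low_bit (fst p) then snd p else low_bit (fst p))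
        \<in> {p. tree_size (enc_bits (fst p)) \<le> tree_size (enc_bits (ys a))}" for x
      using p le_trans[OF tree_size_tl] by simp
  next
    let ?D = "{(a, p). a \<in> D \<and> p \<in> {p. tree_size (enc_bits (fst p)) \<le> tree_size (enc_bits (ys a))}}"
    have "ptime ?D (\<lambda>z. \<mu> (fst z)) (\<lambda>z. Node (C (fst z)) (Node (enc_pair enc_bits tree_of_bool (snd z)) Leaf))
      (\<lambda>z. enc_pair enc_bits tree_of_bool (snd z))" by (rule ptime_proj)
    note p = ptime_fst[OF this] ptime_snd[OF this]
    show "ptime ?D (\<lambda>z. \<mu> (fst z)) (\<lambda>z. Node (C (fst z)) (Node (enc_pair enc_bits tree_of_bool (snd z)) Leaf))
      (\<lambda>z. tree_of_bool (le_bits [] (fst (snd z)) (snd (snd z))))"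
      unfolding le_bits.simps by (intro ptime_disj ptime_list_ex[where eb = tree_of_bool] p) (rule ptime_proj)
  next
    let ?E = "{(a, p, x, zs). a \<in> D \<and> p \<in> {p. tree_size (enc_bits (fst p)) \<le> tree_size (enc_bits (ys a))}
       \<and> suffix (x # zs) (xs a)}"
    let ?p = "\<lambda>z. fst (snd z)"
    let ?x = "\<lambda>z. fst (snd (snd z))"
    let ?K = "\<lambda>z. Node (C (fst z)) (Node (enc_pair enc_bits tree_of_bool (?p z))
        (Node (tree_of_bool (?x z)) (enc_bits (snd (snd (snd z))))))"
    have "ptime ?E (\<lambda>z. \<mu> (fst z)) ?K (\<lambda>z. enc_pair enc_bits tree_of_bool (?p z))" by (rule ptime_proj)
    note p = ptime_fst[OF this] ptime_snd[OF this]
    have x: "ptime ?E (\<lambda>z. \<mu> (fst z)) ?K (\<lambda>z. tree_of_bool (?x z))" by (rule ptime_proj)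
    show "ptime ?E (\<lambda>z. \<mu> (fst z)) ?K (\<lambda>z. enc_pair enc_bits tree_of_bool
        (tl (fst (?p z)), if ?x z \<longleftrightarrow> low_bit (fst (?p z)) then snd (?p z) else low_bit (fst (?p z))))"
      by (intro ptime_pair ptime_tl ptime_if_enc[where e = tree_of_bool] ptime_bool ptime_low_bit p x)
    let ?K' = "\<lambda>z. Node (tree_of_bool (le_bits (snd (snd (snd z)))
         (fst (tl (fst (?p z)), if ?x z \<longleftrightarrow> low_bit (fst (?p z)) then snd (?p z) else low_bit (fst (?p z))))
         (snd (tl (fst (?p z)), if ?x z \<longleftrightarrow> low_bit (fst (?p z)) then snd (?p z) else low_bit (fst (?p z))))))
        (?K z)"
    show "ptime ?E (\<lambda>z. \<mu> (fst z)) ?K' (\<lambda>z. tree_of_bool (le_bits (?x z # snd (snd (snd z))) (fst (?p z)) (snd (?p z))))"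
      unfolding le_bits.simps fst_conv snd_conv by (rule ptime_proj)
  qed simp
  then show ?thesis by simp
qed

section \<open>Sums of fractions\<close>

type_synonym signed_frac = "bool \<times> bool list \<times> bool list"

text \<open>
  Sign, absolute value of the numerator, and denominator. The sign is kept apart from the numerator so
  that negation is a change of one bit, also for zero.
\<close>

definition enc_frac :: "signed_frac \<Rightarrow> tree" where
  "enc_frac r = Node (Node (tree_of_bool (fst r)) (enc_bits (fst (snd r)))) (enc_bits (snd (snd r)))"

lemma ptime_frac:
  assumes "ptime D \<mu> C (\<lambda>a. enc_frac (r a))"
  shows "ptime D \<mu> C (\<lambda>a. tree_of_bool (fst (r a)))"
    and "ptime D \<mu> C (\<lambda>a. enc_bits (fst (snd (r a))))"
    and "ptime D \<mu> C (\<lambda>a. enc_bits (snd (snd (r a))))"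
proof -
  note parts = assms[unfolded enc_frac_def]
  show "ptime D \<mu> C (\<lambda>a. tree_of_bool (fst (r a)))" by (rule ptime_fst_of[OF ptime_fst_of[OF parts]])
  show "ptime D \<mu> C (\<lambda>a. enc_bits (fst (snd (r a))))" by (rule ptime_snd_of[OF ptime_fst_of[OF parts]])
  show "ptime D \<mu> C (\<lambda>a. enc_bits (snd (snd (r a))))" by (rule ptime_snd_of[OF parts])
qed

definition frac_val :: "signed_frac \<Rightarrow> rat" where
  "frac_val r = (if fst r then -1 else 1) * of_nat (bits_val (fst (snd r))) / of_nat (bits_val (snd (snd r)))"

definition frac_of_rat :: "rat \<Rightarrow> signed_frac" where
  "frac_of_rat r = (fst (quotient_of r) < 0, bits (nat \<bar>fst (quotient_of r)\<bar>), bits (nat (snd (quotient_of r))))"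

lemma tree_of_rat_frac: "tree_of_rat r = enc_frac (frac_of_rat r)"
  by (simp add: enc_frac_def tree_of_rat_def tree_of_int_def frac_of_rat_def tree_of_nat_bits split: prod.splits)

lemma frac_of_rat_denom: "bits_val (snd (snd (frac_of_rat r))) > 0"
  using quotient_of_denom_pos'[of r] by (simp add: frac_of_rat_def bits_val_bits)

lemma frac_val_of_rat: "frac_val (frac_of_rat r) = r"
proof -
  obtain p q where pq: "quotient_of r = (p, q)" by fastforce
  then have "q > 0" and r: "r = of_int p / of_int q"
    using quotient_of_denom_pos quotient_of_div by blast+
  then have "frac_val (frac_of_rat r) = of_int p / of_int q"
    unfolding frac_val_def frac_of_rat_def pq by (simp add: bits_val_bits of_nat_nat)
  then show ?thesis using r by simp
qed

definition negate :: "signed_frac \<Rightarrow> signed_frac" where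
  "negate r = (\<not> fst r, snd r)"

lemma frac_val_negate: "frac_val (negate r) = - frac_val r"
  by (simp add: frac_val_def negate_def)

text \<open>
  The state consists of the sum of the positive numerators, the sum of the absolute values of the
  negative numerators, and the denominator common to both. In this form no subtraction is needed, and
  the sign of the sum is found by a single comparison. Fractions are never reduced: the common
  denominator is the product of the denominators, whose length is at most linear in the input.
\<close>

fun sum_fracs :: "signed_frac list \<Rightarrow> bool list \<times> bool list \<times> bool list" where
  "sum_fracs [] = ([], [], [True])"
| "sum_fracs (r # rs) = (let s = sum_fracs rs; d = snd (snd r); m = mult_bits (fst (snd r)) (snd (snd s)) in
     (if fst r then mult_bits d (fst s) else add_carry (mult_bits d (fst s)) m False,
      if fst r then add_carry (mult_bits d (fst (snd s))) m False else mult_bits d (fst (snd s)),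
      mult_bits d (snd (snd s))))"

text \<open>
  Dividing the difference of the two numerators by the denominator is an invariant of the summation.
\<close>

lemma sum_fracs:
  assumes "\<forall>r\<in>set rs. bits_val (snd (snd r)) > 0"
  shows "bits_val (snd (snd (sum_fracs rs))) > 0 \<and>
    (of_nat (bits_val (fst (sum_fracs rs))) - of_nat (bits_val (fst (snd (sum_fracs rs)))))
      / of_nat (bits_val (snd (snd (sum_fracs rs)))) = sum_list (map frac_val rs)"
  using assms
proof (induction rs)
  case (Cons r rs)
  then have IH: "bits_val (snd (snd (sum_fracs rs))) > 0"
    "(of_nat (bits_val (fst (sum_fracs rs))) - of_nat (bits_val (fst (snd (sum_fracs rs)))))
      / of_nat (bits_val (snd (snd (sum_fracs rs)))) = sum_list (map frac_val rs)"
    and d: "bits_val (snd (snd r)) > 0" by auto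
  have *: "((if neg then d * p else d * p + n * q) - (if neg then d * m + n * q else d * m)) / (d * q)
      = (if neg then -1 else 1) * n / d + s"
    if "q > 0" "d > 0" "(p - m) / q = s" for p m q n d s :: rat and neg
  proof -
    have p: "p = s * q + m" using that by (simp add: field_simps)
    show ?thesis using that(1,2) unfolding p by (cases neg) (simp_all add: field_simps)
  qed
  have if_val: "bits_val (if b then xs else ys) = (if b then bits_val xs else bits_val ys)" for b xs ys
    by simp
  show ?case
    using IH(1) d *[OF _ _ IH(2), of "of_nat (bits_val (snd (snd r)))" "fst r" "of_nat (bits_val (fst (snd r)))"]
    by (simp add: Let_def bits_val_mult_bits bits_val_add_carry frac_val_def[of r] if_val
        if_distrib[of of_nat] del: if_split split: if_split_asm)
qed simp

definition nonpos_sum :: "signed_frac list \<Rightarrow> bool" where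
  "nonpos_sum rs = le_bits (fst (sum_fracs rs)) (fst (snd (sum_fracs rs))) True"

lemma nonpos_sum:
  assumes "\<forall>r\<in>set rs. bits_val (snd (snd r)) > 0"
  shows "nonpos_sum rs \<longleftrightarrow> sum_list (map frac_val rs) \<le> 0"
  using sum_fracs[OF assms]
  by (auto simp: nonpos_sum_def le_bits le_less field_simps simp flip: sum_fracs[OF assms, THEN conjunct2])

lemma length_sum_fracs:
  "length (fst (sum_fracs rs)) \<le> 2 * tree_size (enc_list enc_frac rs) + 1 \<and>
   length (fst (snd (sum_fracs rs))) \<le> 2 * tree_size (enc_list enc_frac rs) + 1 \<and>
   length (snd (snd (sum_fracs rs))) \<le> 2 * tree_size (enc_list enc_frac rs) + 1"
proof (induction rs)
  case (Cons r rs)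
  let ?n = "fst (snd r)" and ?d = "snd (snd r)" and ?s = "sum_fracs rs"
  let ?B = "2 * tree_size (enc_list enc_frac rs) + 1"
  have add: "length (add_carry xs ys c) \<le> k + 1" if "length xs \<le> k" "length ys \<le> k" for xs ys c k
    using length_add_carry[of xs ys c] that by (meson add_le_mono1 le_trans max.boundedI)
  have mul: "length (mult_bits xs ys) \<le> 2 * length ?n + 2 * length ?d + ?B"
    if "length ys \<le> ?B" "xs = ?n \<or> xs = ?d" for xs ys
    using length_mult_bits[of xs ys] that by auto
  have "2 * length ?n + 2 * length ?d + ?B + 1 \<le> 2 * tree_size (enc_list enc_frac (r # rs)) + 1"
    using length_le_tree_size[of ?n tree_of_bool] length_le_tree_size[of ?d tree_of_bool] by (simp add: enc_frac_def)
  then have le: "k \<le> 2 * tree_size (enc_list enc_frac (r # rs)) + 1"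
    if "k \<le> 2 * length ?n + 2 * length ?d + ?B + 1" for k using that by (rule order_trans[rotated])
  from Cons.IH have
    "length (mult_bits ?d (fst ?s)) \<le> 2 * length ?n + 2 * length ?d + ?B"
    "length (mult_bits ?d (fst (snd ?s))) \<le> 2 * length ?n + 2 * length ?d + ?B"
    "length (mult_bits ?d (snd (snd ?s))) \<le> 2 * length ?n + 2 * length ?d + ?B"
    "length (mult_bits ?n (snd (snd ?s))) \<le> 2 * length ?n + 2 * length ?d + ?B"
    by (intro mul; simp)+
  note m = this this[THEN trans_le_add1, of 1]
  show ?case
    unfolding sum_fracs.simps Let_def fst_conv snd_conv
    by (intro conjI le) (auto intro!: m add[simplified] simp del: enc_list_simps intro: m[simplified])
qed simp

lemma ptime_sum_fracs:
  assumes rs: "ptime D \<mu> C (\<lambda>a. enc_list enc_frac (rs a))"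
  shows "ptime D \<mu> C (\<lambda>a. enc_pair enc_bits (enc_pair enc_bits enc_bits) (sum_fracs (rs a)))"
proof (rule ptime_structural_recursion[where F = "\<lambda>_. sum_fracs", OF rs,
      where bd = "\<lambda>a. 24 * tree_size (enc_list enc_frac (rs a)) + 17"])
  show "poly_bounded D (\<lambda>a. \<mu> a + tree_size (C a)) (\<lambda>a. 24 * tree_size (enc_list enc_frac (rs a)) + 17)"
    by (intro poly_bounded_add poly_bounded_mult poly_bounded_const ptime_size rs)
  fix a xs assume "suffix xs (rs a)"
  from tree_size_suffix[OF this, of enc_frac]
  show "tree_size (enc_pair enc_bits (enc_pair enc_bits enc_bits) (sum_fracs xs))
     \<le> 24 * tree_size (enc_list enc_frac (rs a)) + 17"
    using length_sum_fracs[of xs] tree_size_bits[of "fst (sum_fracs xs)"]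
      tree_size_bits[of "fst (snd (sum_fracs xs))"] tree_size_bits[of "snd (snd (sum_fracs xs))"]
    unfolding enc_pair_def tree_size.simps by linarith
next
  show "ptime D \<mu> C (\<lambda>a. enc_pair enc_bits (enc_pair enc_bits enc_bits) (sum_fracs []))"
    unfolding sum_fracs.simps by (intro ptime_pair ptime_Cons ptime_True ptime_Nil)
next
  let ?E = "{(a, x, xs). a \<in> D \<and> suffix (x # xs) (rs a)}"
  let ?x = "\<lambda>z. fst (snd z)"
  let ?s = "\<lambda>z. sum_fracs (snd (snd z))"
  let ?K = "\<lambda>z. Node (C (fst z)) (Node (enc_frac (?x z)) (Node (enc_list enc_frac (snd (snd z)))
      (enc_pair enc_bits (enc_pair enc_bits enc_bits) (?s z))))"
  have x: "ptime ?E (\<lambda>z. \<mu> (fst z)) ?K (\<lambda>z. enc_frac (?x z))" by (rule ptime_proj)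
  note x = ptime_frac[OF x]
  have s: "ptime ?E (\<lambda>z. \<mu> (fst z)) ?K (\<lambda>z. enc_pair enc_bits (enc_pair enc_bits enc_bits) (?s z))"
    by (rule ptime_proj)
  note s = ptime_fst[OF s] ptime_fst[OF ptime_snd[OF s]] ptime_snd[OF ptime_snd[OF s]]
  show "ptime ?E (\<lambda>z. \<mu> (fst z)) ?K
     (\<lambda>z. enc_pair enc_bits (enc_pair enc_bits enc_bits) (sum_fracs (?x z # snd (snd z))))"
    unfolding sum_fracs.simps Let_def
    by (intro ptime_pair ptime_if_enc[where e = enc_bits] ptime_add_carry ptime_mult_bits ptime_False x s)
qed

lemma ptime_nonpos_sum:
  assumes "ptime D \<mu> C (\<lambda>a. enc_list enc_frac (rs a))"
  shows "ptime D \<mu> C (\<lambda>a. tree_of_bool (nonpos_sum (rs a)))"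
  unfolding nonpos_sum_def
  by (intro ptime_le_bits ptime_fst[OF ptime_sum_fracs[OF assms]]
      ptime_fst[OF ptime_snd[OF ptime_sum_fracs[OF assms]]] ptime_True)

section \<open>Edges, matchings and sublists\<close>

type_synonym edge = "nat \<times> nat"

abbreviation enc_edge :: "edge \<Rightarrow> tree" where
  "enc_edge \<equiv> enc_pair tree_of_nat tree_of_nat"

lemma ptime_nat_eq:
  assumes "ptime D \<mu> C (\<lambda>a. tree_of_nat (m a))" "ptime D \<mu> C (\<lambda>a. tree_of_nat (n a))"
  shows "ptime D \<mu> C (\<lambda>a. tree_of_bool (m a = n a))"
  using ptime_bits_eq[of D \<mu> C "\<lambda>a. bits (m a)" "\<lambda>a. bits (n a)"] assms
  by (simp add: tree_of_nat_bits bits_inject)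

definition incident :: "edge \<Rightarrow> nat \<Rightarrow> bool" where
  "incident e v \<longleftrightarrow> fst e = v \<or> snd e = v"

definition meets :: "edge \<Rightarrow> edge \<Rightarrow> bool" where
  "meets e f \<longleftrightarrow> incident e (fst f) \<or> incident e (snd f)"

definition avoids :: "edge \<Rightarrow> edge list \<Rightarrow> bool" where
  "avoids e es \<longleftrightarrow> list_all (\<lambda>f. \<not> meets e f) es"

fun is_matching :: "edge list \<Rightarrow> bool" where
  "is_matching [] \<longleftrightarrow> True"
| "is_matching (e # es) \<longleftrightarrow> avoids e es \<and> is_matching es"

definition covered :: "nat \<Rightarrow> edge list \<Rightarrow> bool" where
  "covered v es \<longleftrightarrow> list_ex (\<lambda>e. incident e v) es"

lemma ptime_incident:
  assumes "ptime D \<mu> C (\<lambda>a. enc_edge (e a))" "ptime D \<mu> C (\<lambda>a. tree_of_nat (v a))"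
  shows "ptime D \<mu> C (\<lambda>a. tree_of_bool (incident (e a) (v a)))"
  unfolding incident_def
  by (intro ptime_disj ptime_nat_eq ptime_fst[OF assms(1)] ptime_snd[OF assms(1)] assms(2))

lemma ptime_meets:
  assumes "ptime D \<mu> C (\<lambda>a. enc_edge (e a))" "ptime D \<mu> C (\<lambda>a. enc_edge (f a))"
  shows "ptime D \<mu> C (\<lambda>a. tree_of_bool (meets (e a) (f a)))"
  unfolding meets_def
  by (intro ptime_disj ptime_incident ptime_fst[OF assms(2)] ptime_snd[OF assms(2)] assms(1))

lemma ptime_avoids:
  assumes "ptime D \<mu> C (\<lambda>a. enc_edge (e a))" "ptime D \<mu> C (\<lambda>a. enc_list enc_edge (es a))"
  shows "ptime D \<mu> C (\<lambda>a. tree_of_bool (avoids (e a) (es a)))"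
  unfolding avoids_def
  by (rule ptime_list_all[OF assms(2)])
    (intro ptime_not ptime_meets ptime_outer[OF assms(1)] ptime_inner; auto)

lemma ptime_covered:
  assumes "ptime D \<mu> C (\<lambda>a. tree_of_nat (v a))" "ptime D \<mu> C (\<lambda>a. enc_list enc_edge (es a))"
  shows "ptime D \<mu> C (\<lambda>a. tree_of_bool (covered (v a) (es a)))"
  unfolding covered_def
  by (rule ptime_list_ex[OF assms(2)]) (intro ptime_incident ptime_outer[OF assms(1)] ptime_inner; auto)

lemma ptime_is_matching:
  assumes es: "ptime D \<mu> C (\<lambda>a. enc_list enc_edge (es a))"
  shows "ptime D \<mu> C (\<lambda>a. tree_of_bool (is_matching (es a)))"
proof (rule ptime_structural_recursion[where F = "\<lambda>_. is_matching", OF es,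
      where bd = "\<lambda>_. 3"])
  show "poly_bounded D (\<lambda>a. \<mu> a + tree_size (C a)) (\<lambda>a. 3)" by (rule poly_bounded_const)
  show "ptime D \<mu> C (\<lambda>a. tree_of_bool (is_matching []))"
    unfolding is_matching.simps by (rule ptime_True)
  show "ptime {(a, x, xs). a \<in> D \<and> suffix (x # xs) (es a)} (\<lambda>z. \<mu> (fst z))
      (\<lambda>z. Node (C (fst z)) (Node (enc_edge (fst (snd z))) (Node (enc_list enc_edge (snd (snd z)))
         (tree_of_bool (is_matching (snd (snd z)))))))
      (\<lambda>z. tree_of_bool (is_matching (fst (snd z) # snd (snd z))))"
    unfolding is_matching.simps by (intro ptime_conj ptime_avoids; rule ptime_proj)
qed (rule tree_size_bool)

lemma ptime_drop:
  assumes xs: "ptime D \<mu> C (\<lambda>a. enc_list eb (xs a))" and bs: "ptime D \<mu> C (\<lambda>a. enc_list ec (bs a))"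
  shows "ptime D \<mu> C (\<lambda>a. enc_list eb (drop (length (bs a)) (xs a)))"
proof (rule ptime_structural_recursion[where F = "\<lambda>a bs. drop (length bs) (xs a)", OF bs,
      where bd = "\<lambda>a. tree_size (enc_list eb (xs a))"])
  show "poly_bounded D (\<lambda>a. \<mu> a + tree_size (C a)) (\<lambda>a. tree_size (enc_list eb (xs a)))"
    by (rule ptime_size[OF xs])
  show "tree_size (enc_list eb (drop (length zs) (xs a))) \<le> tree_size (enc_list eb (xs a))" for a zs
    by (rule tree_size_suffix) (rule suffix_drop)
  show "ptime D \<mu> C (\<lambda>a. enc_list eb (drop (length []) (xs a)))" using xs by simp
  have drop: "drop (length (y # zs)) ws = tl (drop (length zs) ws)" for y zs ws
    by (simp add: drop_Suc tl_drop)
  show "ptime {(a, x, zs). a \<in> D \<and> suffix (x # zs) (bs a)} (\<lambda>z. \<mu> (fst z))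
      (\<lambda>z. Node (C (fst z)) (Node (ec (fst (snd z))) (Node (enc_list ec (snd (snd z)))
         (enc_list eb (drop (length (snd (snd z))) (xs (fst z)))))))
      (\<lambda>z. enc_list eb (drop (length (fst (snd z) # snd (snd z))) (xs (fst z))))"
    unfolding drop by (rule ptime_tl) (rule ptime_proj)
qed

lemma tree_size_list_le:
  assumes "\<And>x. x \<in> set xs \<Longrightarrow> tree_size (eb x) \<le> b"
  shows "tree_size (enc_list eb xs) \<le> length xs * (b + 1) + 1"
  using assms
proof (induction xs)
  case (Cons x xs)
  have "tree_size (enc_list eb xs) \<le> length xs * (b + 1) + 1" using Cons by simp
  then show ?case using Cons.prems[of x] by simp
qed simp

lemma tree_size_subseqs: "ys \<in> set (subseqs xs) \<Longrightarrow> tree_size (enc_list eb ys) \<le> tree_size (enc_list eb xs)"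
  by (induction xs arbitrary: ys) (auto simp: Let_def intro: le_SucI trans_le_add2)

lemma ptime_subseqs:
  assumes xs: "ptime D \<mu> C (\<lambda>a. enc_list eb (xs a))"
    and len: "poly_bounded D (\<lambda>a. \<mu> a + tree_size (C a)) (\<lambda>a. 2 ^ length (xs a))"
  shows "ptime D \<mu> C (\<lambda>a. enc_list (enc_list eb) (subseqs (xs a)))"
proof (rule ptime_structural_recursion[where F = "\<lambda>_. subseqs", OF xs,
      where bd = "\<lambda>a. 2 ^ length (xs a) * (tree_size (enc_list eb (xs a)) + 1) + 1"])
  show "poly_bounded D (\<lambda>a. \<mu> a + tree_size (C a))
      (\<lambda>a. 2 ^ length (xs a) * (tree_size (enc_list eb (xs a)) + 1) + 1)"
    by (intro poly_bounded_add poly_bounded_mult poly_bounded_const len ptime_size xs)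
  fix a zs assume "suffix zs (xs a)"
  note le = tree_size_suffix[OF this, of eb] suffix_length_le[OF this]
  have "tree_size (enc_list (enc_list eb) (subseqs zs))
     \<le> length (subseqs zs) * (tree_size (enc_list eb (xs a)) + 1) + 1"
    by (rule tree_size_list_le) (use le(1) tree_size_subseqs order_trans in blast)
  also have "\<dots> \<le> 2 ^ length (xs a) * (tree_size (enc_list eb (xs a)) + 1) + 1"
    using le(2) by (simp add: length_subseqs del: mult_Suc_right)
  finally show "tree_size (enc_list (enc_list eb) (subseqs zs))
     \<le> 2 ^ length (xs a) * (tree_size (enc_list eb (xs a)) + 1) + 1" .
next
  show "ptime D \<mu> C (\<lambda>a. enc_list (enc_list eb) (subseqs []))"
    by (simp add: ptime_Node ptime_Leaf)
next
  let ?E = "{(a, x, zs). a \<in> D \<and> suffix (x # zs) (xs a)}"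
  let ?K = "\<lambda>z. Node (C (fst z)) (Node (eb (fst (snd z))) (Node (enc_list eb (snd (snd z)))
      (enc_list (enc_list eb) (subseqs (snd (snd z))))))"
  have x: "ptime ?E (\<lambda>z. \<mu> (fst z)) ?K (\<lambda>z. eb (fst (snd z)))" by (rule ptime_proj)
  have r: "ptime ?E (\<lambda>z. \<mu> (fst z)) ?K (\<lambda>z. enc_list (enc_list eb) (subseqs (snd (snd z))))"
    by (rule ptime_proj)
  show "ptime ?E (\<lambda>z. \<mu> (fst z)) ?K (\<lambda>z. enc_list (enc_list eb) (subseqs (fst (snd z) # snd (snd z))))"
    unfolding subseqs.simps Let_def
    by (intro ptime_append r ptime_map[OF r, where h = "\<lambda>z. (#) (fst (snd z))"])
       (intro ptime_Cons ptime_outer[OF x] ptime_inner; auto)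
qed

section \<open>Search for matchings that cover given vertices\<close>

definition free_edges :: "edge list \<Rightarrow> edge list \<Rightarrow> nat \<Rightarrow> edge list \<Rightarrow> edge list" where
  "free_edges ls ys s X = filter (\<lambda>e. incident e s \<and> avoids e X \<and> avoids e ys) ls"

text \<open>
  One level of the search tree for a matching that covers given vertices. If there are more than
  \<^term>\<open>length B\<close> free edges at \<^term>\<open>s\<close>, the decision is postponed: however few vertices are still
  covered later, one of these edges survives. Otherwise the search branches over all free edges,
  of which there are at most \<^term>\<open>length B\<close>. The bound is the length of a list because lengths of
  lists can be compared without arithmetic.
\<close>

definition expand :: "edge list \<Rightarrow> edge list \<Rightarrow> nat list \<Rightarrow> nat \<Rightarrow> edge list \<Rightarrow> edge list list" where
  "expand ls ys B s X =
     (if covered s X \<or> drop (length B) (free_edges ls ys s X) \<noteq> [] then [X]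
      else map (\<lambda>e. e # X) (free_edges ls ys s X))"

fun partial_covers :: "edge list \<Rightarrow> edge list \<Rightarrow> nat list \<Rightarrow> nat list \<Rightarrow> edge list list" where
  "partial_covers ls ys B [] = [[]]"
| "partial_covers ls ys B (s # S) = concat (map (expand ls ys B s) (partial_covers ls ys B S))"

lemma ptime_free_edges:
  assumes "ptime D \<mu> C (\<lambda>a. enc_list enc_edge (ls a))" "ptime D \<mu> C (\<lambda>a. enc_list enc_edge (ys a))"
    and "ptime D \<mu> C (\<lambda>a. tree_of_nat (s a))" "ptime D \<mu> C (\<lambda>a. enc_list enc_edge (X a))"
  shows "ptime D \<mu> C (\<lambda>a. enc_list enc_edge (free_edges (ls a) (ys a) (s a) (X a)))"
  unfolding free_edges_def
  by (rule ptime_filter[OF assms(1)])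
    (intro ptime_conj ptime_incident ptime_avoids ptime_outer[OF assms(2)] ptime_outer[OF assms(3)]
      ptime_outer[OF assms(4)] ptime_inner; auto)

lemma ptime_expand:
  assumes ls: "ptime D \<mu> C (\<lambda>a. enc_list enc_edge (ls a))" and ys: "ptime D \<mu> C (\<lambda>a. enc_list enc_edge (ys a))"
    and B: "ptime D \<mu> C (\<lambda>a. enc_list tree_of_nat (B a))"
    and s: "ptime D \<mu> C (\<lambda>a. tree_of_nat (s a))" and X: "ptime D \<mu> C (\<lambda>a. enc_list enc_edge (X a))"
  shows "ptime D \<mu> C (\<lambda>a. enc_list (enc_list enc_edge) (expand (ls a) (ys a) (B a) (s a) (X a)))"
proof -
  note free = ptime_free_edges[OF ls ys s X]
  have branches: "ptime D \<mu> C (\<lambda>a. enc_list (enc_list enc_edge)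
      (map (\<lambda>e. e # X a) (free_edges (ls a) (ys a) (s a) (X a))))"
    by (rule ptime_map[OF free]) (rule ptime_Cons[OF ptime_inner ptime_outer[OF X]]; auto)
  show ?thesis
    unfolding expand_def
    by (intro ptime_if_enc[where e = "enc_list (enc_list enc_edge)"] ptime_disj ptime_covered
        ptime_nonempty[OF ptime_drop[OF free B]] ptime_Cons ptime_Nil s X branches)
qed

lemma length_expand: "length (expand ls ys B s X) \<le> length B + 1"
  by (auto simp: expand_def)

text \<open>
  The number of leaves of the search tree depends only on the number of vertices to be covered and the branching
  bound, both of which will be linear in the parameter.
\<close>

lemma length_partial_covers: "length (partial_covers ls ys B S) \<le> (length B + 1) ^ length S"
proof (induction S)
  case (Cons s S)
  have "length (concat (map (expand ls ys B s) Xs)) \<le> (length B + 1) * length Xs" for Xs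
    by (induction Xs) (auto intro: add_le_mono[OF length_expand, simplified])
  also have "(length B + 1) * length (partial_covers ls ys B S) \<le> (length B + 1) * (length B + 1) ^ length S"
    using Cons by (rule mult_le_mono2)
  finally show ?case by simp
qed simp

lemma tree_size_expand:
  assumes "Y \<in> set (expand ls ys B s X)"
  shows "tree_size (enc_list enc_edge Y) \<le> tree_size (enc_list enc_edge ls) + tree_size (enc_list enc_edge X) + 1"
  using assms tree_size_elem[of _ ls enc_edge]
  by (auto simp: expand_def free_edges_def split: if_splits intro!: add_le_mono)

lemma tree_size_partial_covers:
  "X \<in> set (partial_covers ls ys B S) \<Longrightarrow>
     tree_size (enc_list enc_edge X) \<le> length S * (tree_size (enc_list enc_edge ls) + 1) + 1"
proof (induction S arbitrary: X)
  case (Cons s S)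
  then obtain Y where Y: "Y \<in> set (partial_covers ls ys B S)" "X \<in> set (expand ls ys B s Y)" by auto
  then show ?case using Cons.IH[OF Y(1)] tree_size_expand[OF Y(2)] by simp
qed simp

lemma ptime_partial_covers:
  assumes ls: "ptime D \<mu> C (\<lambda>a. enc_list enc_edge (ls a))" and ys: "ptime D \<mu> C (\<lambda>a. enc_list enc_edge (ys a))"
    and B: "ptime D \<mu> C (\<lambda>a. enc_list tree_of_nat (B a))" and S: "ptime D \<mu> C (\<lambda>a. enc_list tree_of_nat (S a))"
    and len: "poly_bounded D (\<lambda>a. \<mu> a + tree_size (C a)) (\<lambda>a. (length (B a) + 1) ^ length (S a))"
  shows "ptime D \<mu> C (\<lambda>a. enc_list (enc_list enc_edge) (partial_covers (ls a) (ys a) (B a) (S a)))"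
proof -
  define b where "b = (\<lambda>a. tree_size (enc_list tree_of_nat (S a)) * (tree_size (enc_list enc_edge (ls a)) + 1) + 1)"
  show ?thesis
  proof (rule ptime_structural_recursion[where F = "\<lambda>a. partial_covers (ls a) (ys a) (B a)", OF S,
        where bd = "\<lambda>a. (length (B a) + 1) ^ length (S a) * (b a + 1) + 1"])
    show "poly_bounded D (\<lambda>a. \<mu> a + tree_size (C a)) (\<lambda>a. (length (B a) + 1) ^ length (S a) * (b a + 1) + 1)"
      unfolding b_def by (intro poly_bounded_add poly_bounded_mult poly_bounded_const len ptime_size S ls)
    fix a zs assume "suffix zs (S a)"
    note le = suffix_length_le[OF this]
    have "tree_size (enc_list (enc_list enc_edge) (partial_covers (ls a) (ys a) (B a) zs))
       \<le> length (partial_covers (ls a) (ys a) (B a) zs) * (b a + 1) + 1"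
    proof (rule tree_size_list_le)
      fix X assume "X \<in> set (partial_covers (ls a) (ys a) (B a) zs)"
      from tree_size_partial_covers[OF this]
      show "tree_size (enc_list enc_edge X) \<le> b a"
        unfolding b_def using le length_le_tree_size[of "S a" tree_of_nat]
        by (elim order_trans) (intro add_mono mult_le_mono; simp)
    qed
    also have "\<dots> \<le> (length (B a) + 1) ^ length (S a) * (b a + 1) + 1"
      using order_trans[OF length_partial_covers power_increasing[OF le, of "length (B a) + 1"]]
      by (intro add_mono mult_le_mono) auto
    finally show "tree_size (enc_list (enc_list enc_edge) (partial_covers (ls a) (ys a) (B a) zs))
       \<le> (length (B a) + 1) ^ length (S a) * (b a + 1) + 1" .
  next
    show "ptime D \<mu> C (\<lambda>a. enc_list (enc_list enc_edge) (partial_covers (ls a) (ys a) (B a) []))"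
      by (simp add: ptime_Node ptime_Leaf)
  next
    let ?E = "{(a, s, zs). a \<in> D \<and> suffix (s # zs) (S a)}"
    let ?r = "\<lambda>z. partial_covers (ls (fst z)) (ys (fst z)) (B (fst z)) (snd (snd z))"
    let ?K = "\<lambda>z. Node (C (fst z)) (Node (tree_of_nat (fst (snd z))) (Node (enc_list tree_of_nat (snd (snd z)))
      (enc_list (enc_list enc_edge) (?r z))))"
    have s: "ptime ?E (\<lambda>z. \<mu> (fst z)) ?K (\<lambda>z. tree_of_nat (fst (snd z)))" by (rule ptime_proj)
    have r: "ptime ?E (\<lambda>z. \<mu> (fst z)) ?K (\<lambda>z. enc_list (enc_list enc_edge) (?r z))" by (rule ptime_proj)
    have out: "ptime ?E (\<lambda>z. \<mu> (fst z)) ?K (\<lambda>z. f (fst z))" if "ptime D \<mu> C f" for f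
      by (rule ptime_outer[OF that]) auto
    show "ptime ?E (\<lambda>z. \<mu> (fst z)) ?K (\<lambda>z. enc_list (enc_list enc_edge)
        (partial_covers (ls (fst z)) (ys (fst z)) (B (fst z)) (fst (snd z) # snd (snd z))))"
      unfolding partial_covers.simps
      by (rule ptime_concat_map[OF r])
        (intro ptime_expand ptime_outer[OF s] ptime_outer[OF out[OF ls]] ptime_outer[OF out[OF ys]]
          ptime_outer[OF out[OF B]] ptime_inner; auto)
  qed
qed

section \<open>The decision procedure and its running time\<close>

type_synonym weighted_edge = "edge \<times> signed_frac"

abbreviation enc_wedge :: "weighted_edge \<Rightarrow> tree" where
  "enc_wedge \<equiv> enc_pair enc_edge enc_frac"

definition endpoints :: "edge list \<Rightarrow> nat list" where
  "endpoints es = concat (map (\<lambda>e. [fst e, snd e]) es)"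

text \<open>
  The heaviest reaction that uses exactly the edges \<^term>\<open>W\<close> outside the mandatory ones adds every
  mandatory edge that has nonnegative weight and avoids \<^term>\<open>W\<close>. It must not outweigh the reaction
  formed by \<^term>\<open>ms\<close> and \<^term>\<open>Z\<close>, which is expressed by a sum that is not positive.
\<close>

definition unbeaten :: "weighted_edge list \<Rightarrow> weighted_edge list \<Rightarrow> weighted_edge list \<Rightarrow> bool" where
  "unbeaten ms Z W \<longleftrightarrow> nonpos_sum (map snd W @
     map snd (filter (\<lambda>e. \<not> fst (snd e) \<and> avoids (fst e) (map fst W)) ms) @
     map (\<lambda>e. negate (snd e)) (ms @ Z))"

definition leaves_no_gain ::
  "weighted_edge list \<Rightarrow> weighted_edge list \<Rightarrow> weighted_edge list \<Rightarrow> nat list \<Rightarrow> bool" where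
  "leaves_no_gain os ms Z S \<longleftrightarrow>
     list_all (\<lambda>W. is_matching (map fst W) \<and> list_all (\<lambda>s. \<not> covered s (map fst W)) S \<longrightarrow> unbeaten ms Z W)
       (subseqs os)"

text \<open>
  The branching bound handed to \<^const>\<open>partial_covers\<close> is twice the number of all endpoints of
  forbidden and neutral edges: a matching that covers \<^term>\<open>r\<close> vertices needs at most \<^term>\<open>r\<close> edges,
  and these have at most \<^term>\<open>2 * r\<close> endpoints.
\<close>

definition solve ::
  "edge list \<Rightarrow> weighted_edge list \<Rightarrow> weighted_edge list \<Rightarrow> weighted_edge list \<Rightarrow> bool" where
  "solve ls fs ms ns \<longleftrightarrow>
     list_ex (\<lambda>Z. is_matching (map fst (ms @ Z)) \<and>
         list_ex (\<lambda>S. partial_covers ls (map fst (ms @ Z))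
               (endpoints (map fst (fs @ ns)) @ endpoints (map fst (fs @ ns))) S \<noteq> [] \<and>
             leaves_no_gain (fs @ ns) ms Z S)
           (subseqs (endpoints (map fst (fs @ ns)))))
       (subseqs ns)"

lemma ptime_endpoints:
  assumes "ptime D \<mu> C (\<lambda>a. enc_list enc_edge (es a))"
  shows "ptime D \<mu> C (\<lambda>a. enc_list tree_of_nat (endpoints (es a)))"
  unfolding endpoints_def
  by (rule ptime_concat_map[OF assms])
    (intro ptime_Cons ptime_Nil ptime_fst[OF ptime_inner] ptime_snd[OF ptime_inner])

lemma ptime_map_fst:
  assumes "ptime D \<mu> C (\<lambda>a. enc_list enc_wedge (es a))"
  shows "ptime D \<mu> C (\<lambda>a. enc_list enc_edge (map fst (es a)))"
  by (rule ptime_map[OF assms]) (rule ptime_fst[OF ptime_inner])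

lemma ptime_map_snd:
  assumes "ptime D \<mu> C (\<lambda>a. enc_list enc_wedge (es a))"
  shows "ptime D \<mu> C (\<lambda>a. enc_list enc_frac (map snd (es a)))"
  by (rule ptime_map[OF assms]) (rule ptime_snd[OF ptime_inner])

lemma ptime_negate:
  assumes "ptime D \<mu> C (\<lambda>a. enc_frac (r a))"
  shows "ptime D \<mu> C (\<lambda>a. enc_frac (negate (r a)))"
  unfolding negate_def enc_frac_def fst_conv snd_conv
  by (intro ptime_Node ptime_not ptime_frac[OF assms])

lemma ptime_unbeaten:
  assumes ms: "ptime D \<mu> C (\<lambda>a. enc_list enc_wedge (ms a))"
    and Z: "ptime D \<mu> C (\<lambda>a. enc_list enc_wedge (Z a))"
    and W: "ptime D \<mu> C (\<lambda>a. enc_list enc_wedge (W a))"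
  shows "ptime D \<mu> C (\<lambda>a. tree_of_bool (unbeaten (ms a) (Z a) (W a)))"
proof -
  have "ptime D \<mu> C (\<lambda>a. enc_list enc_wedge
     (filter (\<lambda>e. \<not> fst (snd e) \<and> avoids (fst e) (map fst (W a))) (ms a)))"
    by (rule ptime_filter[OF ms])
      (intro ptime_conj ptime_not ptime_frac(1) ptime_avoids ptime_fst[OF ptime_inner]
        ptime_snd[OF ptime_inner] ptime_outer[OF ptime_map_fst[OF W]]; auto)
  moreover have "ptime D \<mu> C (\<lambda>a. enc_list enc_frac (map (\<lambda>e. negate (snd e)) (ms a @ Z a)))"
    by (rule ptime_map[OF ptime_append[OF ms Z]]) (rule ptime_negate[OF ptime_snd[OF ptime_inner]])
  ultimately show ?thesis
    unfolding unbeaten_def by (intro ptime_nonpos_sum ptime_append ptime_map_snd W)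
qed

lemma ptime_leaves_no_gain:
  assumes os: "ptime D \<mu> C (\<lambda>a. enc_list enc_wedge (os a))"
    and ms: "ptime D \<mu> C (\<lambda>a. enc_list enc_wedge (ms a))"
    and Z: "ptime D \<mu> C (\<lambda>a. enc_list enc_wedge (Z a))"
    and S: "ptime D \<mu> C (\<lambda>a. enc_list tree_of_nat (S a))"
    and len: "poly_bounded D (\<lambda>a. \<mu> a + tree_size (C a)) (\<lambda>a. 2 ^ length (os a))"
  shows "ptime D \<mu> C (\<lambda>a. tree_of_bool (leaves_no_gain (os a) (ms a) (Z a) (S a)))"
proof -
  let ?D = "{z. fst z \<in> D \<and> snd z \<in> set (subseqs (os (fst z)))}"
  let ?K = "\<lambda>z. Node (C (fst z)) (enc_list enc_wedge (snd z))"
  have W: "ptime ?D (\<lambda>z. \<mu> (fst z)) ?K (\<lambda>z. enc_list enc_wedge (snd z))" by (rule ptime_inner)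
  have out: "ptime ?D (\<lambda>z. \<mu> (fst z)) ?K (\<lambda>z. f (fst z))" if "ptime D \<mu> C f" for f
    by (rule ptime_outer[OF that]) auto
  have "ptime ?D (\<lambda>z. \<mu> (fst z)) ?K
      (\<lambda>z. tree_of_bool (list_all (\<lambda>s. \<not> covered s (map fst (snd z))) (S (fst z))))"
    by (rule ptime_list_all[OF out[OF S]])
      (intro ptime_not ptime_covered ptime_inner ptime_outer[OF ptime_map_fst[OF W]]; auto)
  then show ?thesis
    unfolding leaves_no_gain_def
    by (intro ptime_list_all[OF ptime_subseqs[OF os len]] ptime_imp ptime_conj ptime_is_matching
        ptime_map_fst W ptime_unbeaten out[OF ms] out[OF Z])
qed

lemma poly_bounded_outer:
  assumes "poly_bounded D (\<lambda>a. \<mu> a + tree_size (C a)) g" "\<And>z. z \<in> D' \<Longrightarrow> fst z \<in> D"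
  shows "poly_bounded D' (\<lambda>z. \<mu> (fst z) + tree_size (Node (C (fst z)) (N z))) (\<lambda>z. g (fst z))"
  by (rule poly_bounded_mono_measure[OF poly_bounded_reindex[OF assms]]) auto

lemma length_endpoints: "length (endpoints es) = 2 * length es"
  by (induction es) (auto simp: endpoints_def)

text \<open>
  With \<^term>\<open>k\<close> forbidden and neutral edges there are at most \<^term>\<open>2 * k\<close> endpoints. All lists of
  candidates are then polynomial in \<^term>\<open>2 ^ (k * k)\<close>; the largest is the list of partial covers with at
  most \<^term>\<open>(4 * k + 1) ^ (2 * k)\<close> entries.
\<close>

theorem ptime_solve:
  assumes ls: "ptime D \<mu> C (\<lambda>a. enc_list enc_edge (ls a))"
    and fs: "ptime D \<mu> C (\<lambda>a. enc_list enc_wedge (fs a))"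
    and ms: "ptime D \<mu> C (\<lambda>a. enc_list enc_wedge (ms a))"
    and ns: "ptime D \<mu> C (\<lambda>a. enc_list enc_wedge (ns a))"
    and len: "poly_bounded D (\<lambda>a. \<mu> a + tree_size (C a))
      (\<lambda>a. 2 ^ ((length (fs a) + length (ns a)) * (length (fs a) + length (ns a))))"
  shows "ptime D \<mu> C (\<lambda>a. tree_of_bool (solve (ls a) (fs a) (ms a) (ns a)))"
proof -
  define k where "k = (\<lambda>a. length (fs a) + length (ns a))"
  define T where "T = (\<lambda>a. endpoints (map fst (fs a @ ns a)))"
  have T_eq: "endpoints (map fst (fs a @ ns a)) = T a" for a by (simp add: T_def)
  have lenT: "length (T a) = 2 * k a" for a by (simp add: T_def k_def length_endpoints)
  let ?M = "\<lambda>a. \<mu> a + tree_size (C a)"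
  have len: "poly_bounded D ?M (\<lambda>a. 2 ^ (k a * k a))" using len unfolding k_def .
  then have pk: "poly_bounded D ?M (\<lambda>a. 2 ^ k a)"
    by (rule poly_bounded_mono) (simp add: power_increasing)
  have len_ns: "poly_bounded D ?M (\<lambda>a. 2 ^ length (ns a))"
    by (rule poly_bounded_mono[OF pk]) (simp add: k_def power_increasing)
  have len_os: "poly_bounded D ?M (\<lambda>a. 2 ^ length (fs a @ ns a))"
    using pk by (simp add: k_def)
  have len_T: "poly_bounded D ?M (\<lambda>a. 2 ^ length (T a))"
    by (rule poly_bounded_mono[OF poly_bounded_power[OF pk, of 2]])
      (simp add: lenT power_mult power_mult_distrib mult.commute flip: power_mult)
  \<comment> \<open>Here the exponent 8 comes from 4 k + 1 being at most 2 to the power 4 k, raised to the power 2 k.\<close>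
  have len_S: "poly_bounded D ?M (\<lambda>a. (length (T a @ T a) + 1) ^ length (T a))"
  proof (rule poly_bounded_mono[OF poly_bounded_power[OF len, of 8]])
    fix a
    have "length (T a @ T a) + 1 \<le> 2 ^ (4 * k a)"
      using Suc_leI[OF less_exp[of "4 * k a"]] unfolding length_append lenT by simp
    then have "(length (T a @ T a) + 1) ^ length (T a) \<le> (2 ^ (4 * k a)) ^ (2 * k a)"
      unfolding lenT by (rule power_mono) simp
    also have "\<dots> = (2 ^ (k a * k a)) ^ 8"
      by (simp flip: power_mult)
    finally show "(length (T a @ T a) + 1) ^ length (T a) \<le> (2 ^ (k a * k a)) ^ 8" .
  qed
  have os: "ptime D \<mu> C (\<lambda>a. enc_list enc_wedge (fs a @ ns a))" by (rule ptime_append[OF fs ns])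
  have T: "ptime D \<mu> C (\<lambda>a. enc_list tree_of_nat (T a))"
    unfolding T_def by (rule ptime_endpoints[OF ptime_map_fst[OF os]])
  let ?D = "{z. fst z \<in> D \<and> snd z \<in> set (subseqs (ns (fst z)))}"
  let ?K = "\<lambda>z. Node (C (fst z)) (enc_list enc_wedge (snd z))"
  have Z: "ptime ?D (\<lambda>z. \<mu> (fst z)) ?K (\<lambda>z. enc_list enc_wedge (snd z))" by (rule ptime_inner)
  have out: "ptime ?D (\<lambda>z. \<mu> (fst z)) ?K (\<lambda>z. f (fst z))" if "ptime D \<mu> C f" for f
    by (rule ptime_outer[OF that]) auto
  have Y: "ptime ?D (\<lambda>z. \<mu> (fst z)) ?K (\<lambda>z. enc_list enc_edge (map fst (ms (fst z) @ snd z)))"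
    by (rule ptime_map_fst[OF ptime_append[OF out[OF ms] Z]])
  let ?M1 = "\<lambda>z. \<mu> (fst z) + tree_size (?K z)"
  have pout: "poly_bounded ?D ?M1 (\<lambda>z. g (fst z))" if "poly_bounded D ?M g" for g
    by (rule poly_bounded_outer[OF that]) auto
  let ?D' = "{z. fst z \<in> ?D \<and> snd z \<in> set (subseqs (T (fst (fst z))))}"
  let ?K' = "\<lambda>z. Node (?K (fst z)) (enc_list tree_of_nat (snd z))"
  have S: "ptime ?D' (\<lambda>z. \<mu> (fst (fst z))) ?K' (\<lambda>z. enc_list tree_of_nat (snd z))"
    by (rule ptime_inner)
  have out': "ptime ?D' (\<lambda>z. \<mu> (fst (fst z))) ?K' (\<lambda>z. f (fst z))"
    if "ptime ?D (\<lambda>z. \<mu> (fst z)) ?K f" for f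
    by (rule ptime_outer[OF that]) auto
  have pout': "poly_bounded ?D' (\<lambda>z. \<mu> (fst (fst z)) + tree_size (?K' z)) (\<lambda>z. g (fst (fst z)))"
    if "poly_bounded D ?M g" for g
    by (rule poly_bounded_outer[OF pout[OF that]]) auto
  have len_S': "poly_bounded ?D' (\<lambda>z. \<mu> (fst (fst z)) + tree_size (?K' z))
      (\<lambda>z. (length (T (fst (fst z)) @ T (fst (fst z))) + 1) ^ length (snd z))"
  proof (rule poly_bounded_mono[OF pout'[OF len_S]])
    fix z assume "z \<in> ?D'"
    then have "length (snd z) \<le> length (T (fst (fst z)))"
      by (auto simp: set_subseqs_eq dest: list_emb_length)
    then show "(length (T (fst (fst z)) @ T (fst (fst z))) + 1) ^ length (snd z)
      \<le> (length (T (fst (fst z)) @ T (fst (fst z))) + 1) ^ length (T (fst (fst z)))"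
      by (rule power_increasing) simp
  qed
  have covers: "ptime ?D' (\<lambda>z. \<mu> (fst (fst z))) ?K' (\<lambda>z. tree_of_bool
      (partial_covers (ls (fst (fst z))) (map fst (ms (fst (fst z)) @ snd (fst z)))
         (T (fst (fst z)) @ T (fst (fst z))) (snd z) \<noteq> []))"
    by (rule ptime_nonempty[OF ptime_partial_covers[OF out'[OF out[OF ls]] out'[OF Y]
          ptime_append[OF out'[OF out[OF T]] out'[OF out[OF T]]] S len_S']])
  have gain: "ptime ?D' (\<lambda>z. \<mu> (fst (fst z))) ?K' (\<lambda>z. tree_of_bool
      (leaves_no_gain (fs (fst (fst z)) @ ns (fst (fst z))) (ms (fst (fst z))) (snd (fst z)) (snd z)))"
    by (rule ptime_leaves_no_gain[OF out'[OF out[OF os]] out'[OF out[OF ms]] out'[OF Z] S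
          pout'[OF len_os]])
  have "ptime ?D (\<lambda>z. \<mu> (fst z)) ?K (\<lambda>z. tree_of_bool
     (list_ex (\<lambda>S. partial_covers (ls (fst z)) (map fst (ms (fst z) @ snd z)) (T (fst z) @ T (fst z)) S \<noteq> []
        \<and> leaves_no_gain (fs (fst z) @ ns (fst z)) (ms (fst z)) (snd z) S) (subseqs (T (fst z)))))"
    by (rule ptime_list_ex[OF ptime_subseqs[OF out[OF T] pout[OF len_T]] ptime_conj[OF covers gain]])
  then show ?thesis
    unfolding solve_def T_eq
    by (intro ptime_list_ex[OF ptime_subseqs[OF ns len_ns]] ptime_conj ptime_is_matching Y)
qed

section \<open>Correctness of the search\<close>

lemma incident_iff: "incident e v \<longleftrightarrow> v \<in> edge_of e"
  by (auto simp: incident_def edge_of_def)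

lemma meets_iff: "meets e f \<longleftrightarrow> edge_of e \<inter> edge_of f \<noteq> {}"
  unfolding meets_def incident_iff by (auto simp: edge_of_def)

lemma avoids_iff: "avoids e es \<longleftrightarrow> (\<forall>f\<in>set es. edge_of e \<inter> edge_of f = {})"
  by (auto simp: avoids_def meets_iff list_all_iff)

lemma covered_iff: "covered v es \<longleftrightarrow> v \<in> \<Union> (edge_of ` set es)"
  by (auto simp: covered_def incident_iff list_ex_iff)

lemma edge_of_nonempty: "edge_of e \<noteq> {}"
  by (simp add: edge_of_def)

lemma disjoint_iff: "disjoint A \<longleftrightarrow> (\<forall>a\<in>A. \<forall>b\<in>A. a \<noteq> b \<longrightarrow> a \<inter> b = {})"
  by (auto simp: disjoint_def)

lemma disjoint_insert_iff:
  "disjoint (insert a A) \<longleftrightarrow> (\<forall>f\<in>A. a \<noteq> f \<longrightarrow> a \<inter> f = {}) \<and> disjoint A"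
  unfolding disjoint_iff by (metis Int_commute insert_iff)

lemma disjoint_subset: "disjoint A \<Longrightarrow> B \<subseteq> A \<Longrightarrow> disjoint B"
  unfolding disjoint_iff by blast

text \<open>
  Since an edge is never empty, a list whose members are pairwise disjoint also has no repetition.
\<close>

lemma is_matching_iff: "is_matching es \<longleftrightarrow> distinct (map edge_of es) \<and> disjoint (edge_of ` set es)"
proof (induction es)
  case (Cons e es)
  have avoid: "avoids e es \<longleftrightarrow> edge_of e \<notin> edge_of ` set es \<and>
      (\<forall>f\<in>edge_of ` set es. edge_of e \<noteq> f \<longrightarrow> edge_of e \<inter> f = {})"
    using edge_of_nonempty[of e] by (auto simp: avoids_iff)
  show ?case
    unfolding is_matching.simps Cons.IH avoid list.simps image_insert disjoint_insert_iff distinct.simps set_map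
    by blast
qed (auto simp: disjoint_def)

text \<open>
  The invariant of the search: the chosen edges \<^term>\<open>X\<close> are part of a matching of leader edges that
  avoids \<^term>\<open>ys\<close> and covers \<^term>\<open>R\<close>. Nothing records which vertices were postponed. This is sound
  because the existence of a suitable matching is preserved by postponing.
\<close>

definition extendable :: "edge list \<Rightarrow> edge list \<Rightarrow> edge list \<Rightarrow> nat set \<Rightarrow> bool" where
  "extendable ls ys X R \<longleftrightarrow> (\<exists>M\<subseteq>edge_of ` set ls. disjoint M \<and>
     (\<forall>m\<in>M. \<forall>y\<in>set ys. m \<inter> edge_of y = {}) \<and> edge_of ` set X \<subseteq> M \<and> R \<subseteq> \<Union> M)"

lemma extendableE:
  assumes "extendable ls ys X R"
  obtains M where "M \<subseteq> edge_of ` set ls" "disjoint M" "\<forall>m\<in>M. \<forall>y\<in>set ys. m \<inter> edge_of y = {}"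
    "edge_of ` set X \<subseteq> M" "R \<subseteq> \<Union> M"
  using assms unfolding extendable_def by (elim exE conjE) (rule that)

lemma extendableI:
  assumes "M \<subseteq> edge_of ` set ls" "disjoint M" "\<forall>m\<in>M. \<forall>y\<in>set ys. m \<inter> edge_of y = {}"
    "edge_of ` set X \<subseteq> M" "R \<subseteq> \<Union> M"
  shows "extendable ls ys X R"
  using assms unfolding extendable_def by (intro exI conjI)

lemma extendable_change:
  assumes "extendable ls ys X R"
    and "\<And>M. edge_of ` set X \<subseteq> M \<Longrightarrow> R \<subseteq> \<Union> M \<Longrightarrow> edge_of ` set X' \<subseteq> M \<and> R' \<subseteq> \<Union> M"
  shows "extendable ls ys X' R'"
proof -
  obtain M where M: "M \<subseteq> edge_of ` set ls" "disjoint M" "\<forall>m\<in>M. \<forall>y\<in>set ys. m \<inter> edge_of y = {}"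
    "edge_of ` set X \<subseteq> M" "R \<subseteq> \<Union> M" by (rule extendableE[OF assms(1)])
  show ?thesis using assms(2)[OF M(4,5)] by (intro extendableI[of M] M(1-3)) simp_all
qed

lemma extendable_mono: "extendable ls ys X R \<Longrightarrow> R' \<subseteq> R \<Longrightarrow> extendable ls ys X R'"
  by (erule extendable_change) (meson order_trans)

text \<open>
  Take a matching that covers \<^term>\<open>R\<close> and keep of it only \<^term>\<open>X\<close> and one edge for each vertex of
  \<^term>\<open>R\<close>. The latter edges have at most \<^term>\<open>2 * card R\<close> endpoints. If \<^term>\<open>s\<close> is still
  uncovered, the free edges at \<^term>\<open>s\<close> have pairwise different other ends, so one of these ends is
  not among the endpoints, and its edge can be added.
\<close>

lemma extendable_insert_if_many_free:
  assumes ext: "extendable ls ys X R" and fin: "finite R"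
    and dist: "distinct (map edge_of ls)" and two: "\<forall>e\<in>set ls. card (edge_of e) = 2"
    and many: "length (free_edges ls ys s X) > 2 * card R"
  shows "extendable ls ys X (insert s R)"
proof -
  obtain M where M: "M \<subseteq> edge_of ` set ls" "disjoint M" "\<forall>m\<in>M. \<forall>y\<in>set ys. m \<inter> edge_of y = {}"
    "edge_of ` set X \<subseteq> M" "R \<subseteq> \<Union> M" by (rule extendableE[OF ext])
  have "\<forall>r\<in>R. \<exists>m. m \<in> M \<and> r \<in> m" using M(5) by blast
  then obtain m where m: "\<forall>r\<in>R. m r \<in> M \<and> r \<in> m r" by (rule bchoice[THEN exE])
  let ?N = "m ` R"
  have "card (\<Union> ?N) \<le> (\<Sum>n\<in>?N. card n)" by (rule card_Union_le_sum_card)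
  also have "\<dots> = 2 * card ?N"
  proof -
    have "card n = 2" if "n \<in> ?N" for n using that m M(1) two by fastforce
    then show ?thesis by simp
  qed
  also have "\<dots> \<le> 2 * card R" using card_image_le[OF fin] by simp
  finally have small: "card (\<Union> ?N) \<le> 2 * card R" .
  have finN: "finite (\<Union> ?N)"
  proof -
    have "finite n" if "n \<in> ?N" for n using that m M(1) two by (fastforce intro: card_ge_0_finite)
    then show ?thesis using fin by blast
  qed
  let ?M = "edge_of ` set X \<union> ?N"
  have sub: "?M \<subseteq> M" using M(4) m by blast
  have M_ls: "?M \<subseteq> edge_of ` set ls" by (rule order_trans[OF sub M(1)])
  have M_disj: "disjoint ?M" by (rule disjoint_subset[OF M(2) sub])
  have M_ys: "\<forall>m\<in>?M. \<forall>y\<in>set ys. m \<inter> edge_of y = {}"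
    using M(3) sub by (meson subsetD)
  show ?thesis
  proof (cases "s \<in> \<Union> ?M")
    case True
    have "insert s R \<subseteq> \<Union> ?M" using True m by blast
    then show ?thesis by (rule extendableI[OF M_ls M_disj M_ys Un_upper1])
  next
    case False
    let ?F = "edge_of ` set (free_edges ls ys s X)"
    have "distinct (map edge_of (free_edges ls ys s X))"
      using dist unfolding free_edges_def by (rule distinct_map_filter)
    then have cF: "card ?F = length (free_edges ls ys s X)"
      by (metis distinct_card length_map set_map)
    have "\<exists>f\<in>?F. f \<inter> \<Union> ?N = {}"
    proof (rule ccontr)
      assume no: "\<not> ?thesis"
      have "?F \<subseteq> (\<lambda>t. {s, t}) ` \<Union> ?N"
      proof
        fix f assume f: "f \<in> ?F"
        then obtain e where e: "f = edge_of e" "fst e = s \<or> snd e = s"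
          by (auto simp: free_edges_def incident_def)
        obtain t where t: "t \<in> f" "t \<in> \<Union> ?N" using no f by blast
        have "t \<noteq> s" using t(2) False by auto
        then have "f = {s, t}" using e t(1) by (auto simp: edge_of_def)
        then show "f \<in> (\<lambda>t. {s, t}) ` \<Union> ?N" using t(2) by blast
      qed
      then have "card ?F \<le> card (\<Union> ?N)" using finN by (meson card_image_le card_mono finite_imageI le_trans)
      then show False using small many cF by simp
    qed
    then obtain e where e: "e \<in> set (free_edges ls ys s X)" "edge_of e \<inter> \<Union> ?N = {}" by blast
    have e': "e \<in> set ls" "s \<in> edge_of e" "\<forall>x\<in>set X. edge_of e \<inter> edge_of x = {}"
      "\<forall>y\<in>set ys. edge_of e \<inter> edge_of y = {}"
      using e(1) by (auto simp: free_edges_def incident_iff avoids_iff)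
    let ?M' = "insert (edge_of e) ?M"
    have "?M' \<subseteq> edge_of ` set ls" using M_ls e'(1) by simp
    moreover have "disjoint ?M'"
    proof -
      have "edge_of e \<inter> m = {}" if "m \<in> ?M" for m using that e(2) e'(3) by blast
      then show ?thesis unfolding disjoint_insert_iff using M_disj by blast
    qed
    moreover have "\<forall>m\<in>?M'. \<forall>y\<in>set ys. m \<inter> edge_of y = {}" using M_ys e'(4) by simp
    moreover have "edge_of ` set X \<subseteq> ?M'" by blast
    moreover have "insert s R \<subseteq> \<Union> ?M'" using e'(2) m by blast
    ultimately show ?thesis by (rule extendableI)
  qed
qed

lemma expand_correct:
  assumes "finite R" "distinct (map edge_of ls)" "\<forall>e\<in>set ls. card (edge_of e) = 2"
    and B: "2 * card R \<le> length B"
  shows "(\<exists>X'\<in>set (expand ls ys B s X). extendable ls ys X' R) \<longleftrightarrow> extendable ls ys X (insert s R)"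
proof -
  let ?F = "free_edges ls ys s X"
  consider "covered s X" | "\<not> covered s X" "drop (length B) ?F \<noteq> []"
    | "\<not> covered s X" "drop (length B) ?F = []" by blast
  then show ?thesis
  proof cases
    case 1
    have "extendable ls ys X (insert s R)" if ext: "extendable ls ys X R"
      by (rule extendable_change[OF ext]) (use 1 in \<open>auto simp: covered_iff\<close>)
    then have "extendable ls ys X R \<longleftrightarrow> extendable ls ys X (insert s R)"
      using extendable_mono by blast
    then show ?thesis using 1 by (simp add: expand_def)
  next
    case 2
    then have "length ?F > 2 * card R" using B by simp
    then have "extendable ls ys X R \<longleftrightarrow> extendable ls ys X (insert s R)"
      using extendable_insert_if_many_free[OF _ assms(1-3)] extendable_mono by blast
    then show ?thesis using 2 by (simp add: expand_def)
  next
    case 3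
    have "(\<exists>e\<in>set ?F. extendable ls ys (e # X) R) \<longleftrightarrow> extendable ls ys X (insert s R)"
    proof
      assume "\<exists>e\<in>set ?F. extendable ls ys (e # X) R"
      then obtain e where e: "s \<in> edge_of e" "extendable ls ys (e # X) R"
        by (auto simp: free_edges_def incident_iff)
      show "extendable ls ys X (insert s R)"
        by (rule extendable_change[OF e(2)]) (use e(1) in auto)
    next
      assume ext: "extendable ls ys X (insert s R)"
      obtain M where M: "M \<subseteq> edge_of ` set ls" "disjoint M" "\<forall>m\<in>M. \<forall>y\<in>set ys. m \<inter> edge_of y = {}"
        "edge_of ` set X \<subseteq> M" "insert s R \<subseteq> \<Union> M" by (rule extendableE[OF ext])
      obtain n where "n \<in> M" "s \<in> n" using M(5) by blast
      then obtain e where e: "e \<in> set ls" "edge_of e \<in> M" "s \<in> edge_of e" using M(1) by blast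
      have "edge_of e \<inter> edge_of x = {}" if "x \<in> set X" for x
      proof -
        have "edge_of e \<noteq> edge_of x" using that 3(1) e(3) by (auto simp: covered_iff)
        then show ?thesis using M(2,4) e(2) that unfolding disjoint_iff by blast
      qed
      then have "e \<in> set ?F"
        using e M(3) by (auto simp: free_edges_def incident_iff avoids_iff)
      moreover have "extendable ls ys (e # X) R" using M e(2) by (intro extendableI[of M]) auto
      ultimately show "\<exists>e\<in>set ?F. extendable ls ys (e # X) R" by blast
    qed
    then show ?thesis using 3 by (simp add: expand_def)
  qed
qed

text \<open>
  The set \<^term>\<open>R\<close> stands for the vertices that are processed later; the invariant has to speak of
  them because the bound in the postponement step counts them.
\<close>

lemma partial_covers_correct:
  assumes "distinct (map edge_of ls)" "\<forall>e\<in>set ls. card (edge_of e) = 2"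
    and "finite R" "2 * card (set S \<union> R) \<le> length B"
  shows "(\<exists>X\<in>set (partial_covers ls ys B S). extendable ls ys X R) \<longleftrightarrow> extendable ls ys [] (set S \<union> R)"
  using assms(3,4)
proof (induction S arbitrary: R)
  case (Cons s S)
  have "card R \<le> card (set (s # S) \<union> R)" by (rule card_mono) (use Cons.prems(1) in auto)
  then have "2 * card R \<le> length B" using Cons.prems(2) by linarith
  note step = expand_correct[OF Cons.prems(1) assms(1,2) this]
  have "(\<exists>X\<in>set (partial_covers ls ys B (s # S)). extendable ls ys X R) \<longleftrightarrow>
     (\<exists>X\<in>set (partial_covers ls ys B S). extendable ls ys X (insert s R))"
    by (auto simp flip: step)
  also have "\<dots> \<longleftrightarrow> extendable ls ys [] (set S \<union> insert s R)"
    by (rule Cons.IH) (use Cons.prems in simp_all)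
  finally show ?case by simp
qed simp

lemma partial_covers_valid:
  "X \<in> set (partial_covers ls ys B S) \<Longrightarrow> extendable ls ys X {}"
proof (induction S arbitrary: X)
  case Nil
  then show ?case by (auto simp: extendable_def intro!: exI[of _ "{}"] simp: disjoint_def)
next
  case (Cons s S)
  then obtain Y where Y: "Y \<in> set (partial_covers ls ys B S)" "X \<in> set (expand ls ys B s Y)" by auto
  obtain M where M: "M \<subseteq> edge_of ` set ls" "disjoint M"
    "\<forall>m\<in>M. \<forall>y\<in>set ys. m \<inter> edge_of y = {}" "edge_of ` set Y \<subseteq> M"
    by (rule extendableE[OF Cons.IH[OF Y(1)]])
  show ?case
  proof (cases "X = Y")
    case False
    then obtain e where e: "X = e # Y" "e \<in> set (free_edges ls ys s Y)"
      using Y(2) by (auto simp: expand_def split: if_splits)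
    have "e \<in> set ls" "\<forall>y\<in>set ys. edge_of e \<inter> edge_of y = {}"
      using e(2) by (simp_all add: free_edges_def avoids_iff)
    then have "edge_of ` set X \<subseteq> edge_of ` set ls" "\<forall>m\<in>edge_of ` set X. \<forall>y\<in>set ys. m \<inter> edge_of y = {}"
      unfolding e(1) list.simps image_insert using order_trans[OF M(4,1)] subsetD[OF M(4)] M(3)
      by simp_all
    moreover have "disjoint (edge_of ` set X)"
    proof -
      have "disjoint (edge_of ` set Y)" by (rule disjoint_subset[OF M(2,4)])
      moreover have "\<forall>y\<in>set Y. edge_of e \<inter> edge_of y = {}"
        using e(2) by (auto simp: free_edges_def avoids_iff)
      ultimately show ?thesis unfolding e(1) list.simps image_insert disjoint_insert_iff by blast
    qed
    ultimately show ?thesis by (intro extendableI[of "edge_of ` set X"]) auto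
  qed (use Cons.IH[OF Y(1)] in simp)
qed

theorem partial_covers_nonempty_iff:
  assumes "distinct (map edge_of ls)" "\<forall>e\<in>set ls. card (edge_of e) = 2"
    and "2 * length S \<le> length B"
  shows "partial_covers ls ys B S \<noteq> [] \<longleftrightarrow> extendable ls ys [] (set S)"
proof -
  have "2 * card (set S \<union> {}) \<le> length B" using card_length[of S] assms(3) by simp
  from partial_covers_correct[OF assms(1,2) finite.emptyI this]
  have "(\<exists>X\<in>set (partial_covers ls ys B S). extendable ls ys X {}) \<longleftrightarrow> extendable ls ys [] (set S)" by simp
  moreover have "partial_covers ls ys B S \<noteq> [] \<longleftrightarrow> (\<exists>X. X \<in> set (partial_covers ls ys B S))"
    by (cases "partial_covers ls ys B S") auto
  ultimately show ?thesis using partial_covers_valid by blast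
qed

section \<open>Correctness of the decision procedure\<close>

lemma subseqs_map: "subseqs (map f xs) = map (map f) (subseqs xs)"
  by (induction xs) (auto simp: Let_def)

lemma frac_of_rat_sign: "fst (frac_of_rat r) \<longleftrightarrow> r < 0"
proof -
  obtain p q where pq: "quotient_of r = (p, q)" by fastforce
  then have "q > 0" "r = of_int p / of_int q"
    using quotient_of_denom_pos quotient_of_div by blast+
  then have "r < 0 \<longleftrightarrow> p < 0" by (simp add: divide_less_0_iff)
  then show ?thesis by (simp add: frac_of_rat_def pq)
qed

definition weighted :: "(nat set \<Rightarrow> rat) \<Rightarrow> edge list \<Rightarrow> weighted_edge list" where
  "weighted d ps = map (\<lambda>p. (p, frac_of_rat (d (edge_of p)))) ps"

lemma map_fst_weighted: "map fst (weighted d ps) = ps"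
  by (simp add: weighted_def comp_def)

lemma weighted_append: "weighted d ps @ weighted d qs = weighted d (ps @ qs)"
  by (simp add: weighted_def)

lemma subseqs_weighted: "subseqs (weighted d ps) = map (weighted d) (subseqs ps)"
  unfolding weighted_def by (simp add: subseqs_map weighted_def[abs_def])

definition unbeaten_weight :: "(nat set \<Rightarrow> rat) \<Rightarrow> edge list \<Rightarrow> edge list \<Rightarrow> edge list \<Rightarrow> bool" where
  "unbeaten_weight d ms Z W \<longleftrightarrow>
     sum_list (map (d \<circ> edge_of) (W @ filter (\<lambda>e. 0 \<le> d (edge_of e) \<and> avoids e W) ms)) \<le>
     sum_list (map (d \<circ> edge_of) (ms @ Z))"

lemma unbeaten_weighted:
  "unbeaten (weighted d ms) (weighted d Z) (weighted d W) \<longleftrightarrow> unbeaten_weight d ms Z W"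
proof -
  have val: "frac_val (snd (p, frac_of_rat r)) = r" for p :: edge and r by (simp add: frac_val_of_rat)
  have neg: "sum_list (map (\<lambda>x. - g x) xs) = - sum_list (map g xs)" for g :: "edge \<Rightarrow> rat" and xs
    by (induction xs) auto
  have filt: "filter (\<lambda>e. \<not> fst (snd e) \<and> avoids (fst e) W) (weighted d ms)
     = weighted d (filter (\<lambda>e. 0 \<le> d (edge_of e) \<and> avoids e W) ms)"
    by (simp add: weighted_def filter_map comp_def frac_of_rat_sign not_less)
  show ?thesis
    unfolding unbeaten_def map_fst_weighted filt weighted_append unbeaten_weight_def
    by (subst nonpos_sum)
      (auto simp: weighted_def negate_def frac_of_rat_denom frac_val_negate[unfolded negate_def]
        frac_val_of_rat comp_def neg)
qed

definition decides :: "(nat set \<Rightarrow> rat) \<Rightarrow> edge list \<Rightarrow> edge list \<Rightarrow> edge list \<Rightarrow> edge list \<Rightarrow> bool" where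
  "decides d ls fs ms ns \<longleftrightarrow> (\<exists>Z\<in>set (subseqs ns). is_matching (ms @ Z) \<and>
     (\<exists>S\<in>set (subseqs (endpoints (fs @ ns))). extendable ls (ms @ Z) [] (set S) \<and>
       (\<forall>W\<in>set (subseqs (fs @ ns)). is_matching W \<and> (\<forall>s\<in>set S. \<not> covered s W) \<longrightarrow>
          unbeaten_weight d ms Z W)))"

lemma solve_weighted:
  assumes "distinct (map edge_of ls)" "\<forall>e\<in>set ls. card (edge_of e) = 2"
  shows "solve ls (weighted d fs) (weighted d ms) (weighted d ns) \<longleftrightarrow> decides d ls fs ms ns"
proof -
  have cov: "partial_covers ls ys (T @ T) S \<noteq> [] \<longleftrightarrow> extendable ls ys [] (set S)"
    if "S \<in> set (subseqs T)" for ys T S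
  proof (rule partial_covers_nonempty_iff[OF assms])
    have "length S \<le> length T" using that by (auto simp: set_subseqs_eq dest: list_emb_length)
    then show "2 * length S \<le> length (T @ T)" by simp
  qed
  show ?thesis
    unfolding solve_def decides_def leaves_no_gain_def weighted_append map_fst_weighted
      subseqs_weighted list_ex_iff list_all_iff set_map bex_simps ball_simps unbeaten_weighted
    using cov by (intro bex_cong conj_cong refl) auto
qed

lemma sum_weights:
  assumes "distinct (map edge_of W)"
  shows "sum_list (map (d \<circ> edge_of) W) = (\<Sum>e\<in>edge_of ` set W. (d e :: rat))"
  using sum_list_distinct_conv_sum_set[OF assms, of d] by simp

lemma set_endpoints: "set (endpoints es) = \<Union> (edge_of ` set es)"
  by (auto simp: endpoints_def edge_of_def)

lemma filter_in_subseqs: "filter P xs \<in> set (subseqs xs)"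
  by (simp add: set_subseqs_eq subseq_filter_left)

lemma subseqs_subset: "ys \<in> set (subseqs xs) \<Longrightarrow> set ys \<subseteq> set xs"
  using subseqs_powset[of xs] by blast

lemma subseqs_distinct_map:
  "ys \<in> set (subseqs xs) \<Longrightarrow> distinct (map f xs) \<Longrightarrow> distinct (map f ys)"
  by (rule subseqs_distinctD[of _ "map f xs"]) (simp_all add: subseqs_map)

lemma disjoint_UnI:
  assumes "disjoint A" "disjoint B" "\<And>a b. a \<in> A \<Longrightarrow> b \<in> B \<Longrightarrow> a \<inter> b = {}"
  shows "disjoint (A \<union> B)"
  unfolding disjoint_iff
proof (intro ballI impI)
  fix a b assume "a \<in> A \<union> B" "b \<in> A \<union> B" "a \<noteq> b"
  then show "a \<inter> b = {}"
    using assms(1,2)[unfolded disjoint_iff] assms(3) by (metis Int_commute Un_iff)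
qed

context
  fixes G ls fs ms ns
  assumes G: "G \<in> rp_instances"
    and lists: "lists_edges ls (leader G)" "lists_edges fs (forbidden G)"
      "lists_edges ms (mandatory G)" "lists_edges ns (neutral G)"
begin

lemma list_sets:
  "edge_of ` set ls = leader G" "edge_of ` set fs = forbidden G"
  "edge_of ` set ms = mandatory G" "edge_of ` set ns = neutral G"
  using lists by (simp_all add: lists_edges_def)

lemma follower_eq: "follower G = forbidden G \<union> mandatory G \<union> neutral G"
  and edges_eq: "edges G = leader G \<union> follower G"
  and leader_follower: "leader G \<inter> follower G = {}"
  and parts_disjoint: "forbidden G \<inter> mandatory G = {}" "forbidden G \<inter> neutral G = {}"
    "mandatory G \<inter> neutral G = {}"
  using G by (auto simp: rp_instances_def)

lemma finite_edges: "finite (edges G)"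
proof (rule finite_subset)
  show "edges G \<subseteq> Pow (verts G)" using G unfolding rp_instances_def by blast
  show "finite (Pow (verts G))" using G by (simp add: rp_instances_def)
qed

lemma distinct_lists: "distinct (map edge_of ls)" "distinct (map edge_of (fs @ ns))"
  "distinct (map edge_of ms)" "distinct (map edge_of (ms @ ns))"
  using lists parts_disjoint by (simp_all add: lists_edges_def)

text \<open>
  Sums over lists turn into sums over sets of edges. The parts are pairwise disjoint and listed
  without repetition, so nothing is counted twice.
\<close>

lemma unbeaten_weight_iff:
  assumes "W \<in> set (subseqs (fs @ ns))" "Z \<in> set (subseqs ns)"
  shows "unbeaten_weight (weight G) ms Z W \<longleftrightarrow>
    sum (weight G) (edge_of ` set W \<union> {m \<in> mandatory G. 0 \<le> weight G m \<and> (\<forall>w\<in>edge_of ` set W. m \<inter> w = {})})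
      \<le> sum (weight G) (mandatory G \<union> edge_of ` set Z)"
proof -
  have dW: "distinct (map edge_of W)" and dZ: "distinct (map edge_of Z)"
    using subseqs_distinct_map[OF assms(1)] subseqs_distinct_map[OF assms(2)] distinct_lists(2)
    by auto
  have W: "edge_of ` set W \<subseteq> forbidden G \<union> neutral G"
    using image_mono[OF subseqs_subset[OF assms(1)], of edge_of] list_sets by (simp add: image_Un)
  have Z: "edge_of ` set Z \<subseteq> neutral G"
    using image_mono[OF subseqs_subset[OF assms(2)], of edge_of] list_sets by simp
  let ?m = "filter (\<lambda>e. 0 \<le> weight G (edge_of e) \<and> avoids e W) ms"
  have m: "edge_of ` set ?m = {m \<in> mandatory G. 0 \<le> weight G m \<and> (\<forall>w\<in>edge_of ` set W. m \<inter> w = {})}"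
    unfolding list_sets(3)[symmetric] by (auto simp: avoids_iff)
  have d1: "distinct (map edge_of (W @ ?m))"
    using dW distinct_map_filter[OF distinct_lists(3)] W m parts_disjoint by auto
  have d2: "distinct (map edge_of (ms @ Z))"
    using dZ distinct_lists(3) Z list_sets(3) parts_disjoint by auto
  show ?thesis
    unfolding unbeaten_weight_def sum_weights[OF d1] sum_weights[OF d2] set_append image_Un m
      list_sets(3) ..
qed

text \<open>
  Given a solution, let \<^term>\<open>Z\<close> be the neutral edges in the reaction and \<^term>\<open>S\<close> the endpoints of
  forbidden and neutral edges that the leader covers. A matching \<^term>\<open>W\<close> of forbidden and neutral edges
  that avoids \<^term>\<open>S\<close> avoids all leader edges. Together with the mandatory edges added in the test it is
  a feasible reaction, hence not better than the optimal one.
\<close>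

lemma decides_if_rp_max_matching:
  assumes "rp_max_matching G"
  shows "decides (weight G) ls fs ms ns"
proof -
  obtain X Y where X: "X \<subseteq> leader G" and opt: "optimal_reaction G X Y"
    and Y: "forbidden G \<inter> Y = {}" "mandatory G \<subseteq> Y"
    using assms unfolding rp_max_matching_def by blast
  have Yf: "Y \<subseteq> follower G" and M: "matching G (X \<union> Y)"
    using opt by (auto simp: optimal_reaction_def feasible_reaction_def)
  have dis: "disjoint (X \<union> Y)" using M by (simp add: matching_def)
  have XY: "x \<inter> y = {}" if "x \<in> X" "y \<in> Y" for x y
  proof -
    have "x \<noteq> y" using that X Yf leader_follower by blast
    then show ?thesis using dis that unfolding disjoint_iff by blast
  qed
  define Z where "Z = filter (\<lambda>e. edge_of e \<in> Y) ns"
  have Z: "Z \<in> set (subseqs ns)" unfolding Z_def by (rule filter_in_subseqs)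
  have EZ: "edge_of ` set Z = Y \<inter> neutral G"
    unfolding list_sets(4)[symmetric] Z_def by auto
  have Yeq: "edge_of ` set (ms @ Z) = Y"
    unfolding set_append image_Un EZ list_sets(3) using Y Yf follower_eq by blast
  \<comment> \<open>Only the covered vertices at which a competing reaction could have edges matter.\<close>
  define S where "S = filter (\<lambda>v. v \<in> \<Union> X) (endpoints (fs @ ns))"
  have S: "S \<in> set (subseqs (endpoints (fs @ ns)))" unfolding S_def by (rule filter_in_subseqs)
  have "is_matching (ms @ Z)"
    unfolding is_matching_iff Yeq
  proof
    show "distinct (map edge_of (ms @ Z))"
      using distinct_lists(4) distinct_map_filter[of edge_of ns] EZ list_sets(3) parts_disjoint
      by (auto simp: Z_def)
    show "disjoint Y" using dis by (rule disjoint_subset) simp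
  qed
  moreover have "extendable ls (ms @ Z) [] (set S)"
  proof (rule extendableI[of X])
    show "X \<subseteq> edge_of ` set ls" using X list_sets(1) by simp
    show "disjoint X" using dis by (rule disjoint_subset) simp
    show "\<forall>m\<in>X. \<forall>y\<in>set (ms @ Z). m \<inter> edge_of y = {}" using XY Yeq by blast
  qed (auto simp: S_def)
  moreover have "unbeaten_weight (weight G) ms Z W"
    if W: "W \<in> set (subseqs (fs @ ns))" "is_matching W" "\<forall>s\<in>set S. \<not> covered s W" for W
  proof -
    let ?W = "edge_of ` set W"
    let ?m = "{m \<in> mandatory G. 0 \<le> weight G m \<and> (\<forall>w\<in>?W. m \<inter> w = {})}"
    have Wsub: "?W \<subseteq> forbidden G \<union> neutral G"
      using image_mono[OF subseqs_subset[OF W(1)], of edge_of] list_sets by (simp add: image_Un)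
    have XW: "x \<inter> w = {}" if "x \<in> X" "w \<in> ?W" for x w
    proof -
      have "w \<subseteq> set (endpoints (fs @ ns))"
        using that(2) subseqs_subset[OF W(1)] unfolding set_endpoints by blast
      moreover have "\<forall>s\<in>set S. s \<notin> w" using W(3) that(2) by (auto simp: covered_iff)
      ultimately show ?thesis using that(1) by (auto simp: S_def)
    qed
    have "feasible_reaction G X (?W \<union> ?m)"
      unfolding feasible_reaction_def matching_def
    proof (intro conjI)
      show "?W \<union> ?m \<subseteq> follower G" using Wsub follower_eq by blast
      then show "X \<union> (?W \<union> ?m) \<subseteq> edges G" using X edges_eq by blast
      have "disjoint (X \<union> ?m)" by (rule disjoint_subset[OF dis]) (use Y(2) in blast)
      moreover have "disjoint ?W" using W(2) by (simp add: is_matching_iff)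
      moreover have "a \<inter> w = {}" if "a \<in> X \<union> ?m" "w \<in> ?W" for a w
        using that XW by blast
      ultimately have "disjoint ((X \<union> ?m) \<union> ?W)" by (rule disjoint_UnI)
      then show "disjoint (X \<union> (?W \<union> ?m))" by (simp only: Un_ac)
    qed
    then have "sum (weight G) (?W \<union> ?m) \<le> sum (weight G) Y"
      using opt unfolding optimal_reaction_def by blast
    also have "Y = mandatory G \<union> edge_of ` set Z" using Yeq list_sets(3) by auto
    finally show ?thesis unfolding unbeaten_weight_iff[OF W(1) Z] .
  qed
  ultimately show ?thesis unfolding decides_def using Z S by blast
qed

text \<open>
  The leader may cover more vertices than those in \<^term>\<open>S\<close>, but this only takes reactions away from
  the follower, and never the intended one, since the leader edges avoid it. Any other reaction
  splits into a part \<^term>\<open>W\<close> outside the mandatory edges and a mandatory part, and the latter weighs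
  at most as much as the nonnegative mandatory edges that avoid \<^term>\<open>W\<close>.
\<close>

lemma rp_max_matching_if_decides:
  assumes "decides (weight G) ls fs ms ns"
  shows "rp_max_matching G"
proof -
  obtain Z S where Z: "Z \<in> set (subseqs ns)" "is_matching (ms @ Z)"
    and S: "S \<in> set (subseqs (endpoints (fs @ ns)))" "extendable ls (ms @ Z) [] (set S)"
    and unb: "\<And>W. W \<in> set (subseqs (fs @ ns)) \<Longrightarrow> is_matching W \<Longrightarrow> \<forall>s\<in>set S. \<not> covered s W \<Longrightarrow>
          unbeaten_weight (weight G) ms Z W"
    using assms unfolding decides_def by blast
  obtain X where X: "X \<subseteq> edge_of ` set ls" "disjoint X"
    "\<forall>m\<in>X. \<forall>y\<in>set (ms @ Z). m \<inter> edge_of y = {}" "edge_of ` set [] \<subseteq> X" "set S \<subseteq> \<Union> X"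
    by (rule extendableE[OF S(2)])
  let ?Y = "mandatory G \<union> edge_of ` set Z"
  have Yeq: "edge_of ` set (ms @ Z) = ?Y" using list_sets(3) by auto
  have EZ: "edge_of ` set Z \<subseteq> neutral G" using image_mono[OF subseqs_subset[OF Z(1)], of edge_of] list_sets by simp
  have XY: "x \<inter> y = {}" if "x \<in> X" "y \<in> ?Y" for x y
    using that X(3) unfolding Yeq[symmetric] by blast
  have feas: "feasible_reaction G X ?Y"
    unfolding feasible_reaction_def matching_def
  proof (intro conjI)
    show "?Y \<subseteq> follower G" using EZ follower_eq by blast
    then show "X \<union> ?Y \<subseteq> edges G" using X(1) list_sets(1) edges_eq by blast
    have "disjoint ?Y" using Z(2) unfolding is_matching_iff Yeq by simp
    from X(2) this XY show "disjoint (X \<union> ?Y)" by (rule disjoint_UnI)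
  qed
  have "sum (weight G) Y' \<le> sum (weight G) ?Y" if feas': "feasible_reaction G X Y'" for Y'
  proof -
    have Y': "Y' \<subseteq> follower G" "disjoint (X \<union> Y')"
      using feas' by (auto simp: feasible_reaction_def matching_def)
    define W where "W = filter (\<lambda>e. edge_of e \<in> Y') (fs @ ns)"
    have W: "W \<in> set (subseqs (fs @ ns))" unfolding W_def by (rule filter_in_subseqs)
    have EW: "edge_of ` set W = Y' \<inter> (forbidden G \<union> neutral G)"
      unfolding list_sets(2,4)[symmetric] W_def by auto
    let ?W = "edge_of ` set W"
    let ?m = "{m \<in> mandatory G. 0 \<le> weight G m \<and> (\<forall>w\<in>?W. m \<inter> w = {})}"
    have "is_matching W"
      unfolding is_matching_iff
    proof
      show "distinct (map edge_of W)" using subseqs_distinct_map[OF W distinct_lists(2)] .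
      show "disjoint ?W" by (rule disjoint_subset[OF Y'(2)]) (use EW in blast)
    qed
    moreover have "\<forall>s\<in>set S. \<not> covered s W"
    proof
      fix s assume "s \<in> set S"
      then obtain x where x: "x \<in> X" "s \<in> x" using X(5) by blast
      show "\<not> covered s W"
      proof
        assume "covered s W"
        then obtain w where w: "w \<in> ?W" "s \<in> w" by (auto simp: covered_iff)
        have "w \<in> Y'" using w(1) unfolding EW by blast
        moreover have "x \<in> leader G" using x(1) X(1) unfolding list_sets(1) by blast
        ultimately have "x \<noteq> w" using Y'(1) leader_follower by blast
        then have "x \<inter> w = {}" using Y'(2) x(1) \<open>w \<in> Y'\<close> unfolding disjoint_iff by simp
        then show False using x(2) w(2) by blast
      qed
    qed
    ultimately have "sum (weight G) (?W \<union> ?m) \<le> sum (weight G) ?Y"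
      using unb[OF W] unbeaten_weight_iff[OF W Z(1)] by blast
    moreover have "sum (weight G) Y' \<le> sum (weight G) (?W \<union> ?m)"
    proof -
      have fin: "finite (mandatory G)" "finite ?W" "finite Y'"
        using finite_edges edges_eq follower_eq Y'(1) by (auto intro: finite_subset)
      have avoid: "m \<inter> w = {}" if "m \<in> Y' \<inter> mandatory G" "w \<in> ?W" for m w
      proof -
        have "m \<noteq> w" using that EW parts_disjoint by blast
        moreover have "m \<in> X \<union> Y'" "w \<in> X \<union> Y'" using that unfolding EW by blast+
        ultimately show ?thesis using Y'(2) unfolding disjoint_iff by simp
      qed
      have "Y' = ?W \<union> (Y' \<inter> mandatory G)"
        unfolding EW using Y'(1)[unfolded follower_eq] by blast
      then have "sum (weight G) Y' = sum (weight G) (?W \<union> (Y' \<inter> mandatory G))" by simp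
      also have "\<dots> = sum (weight G) ?W + sum (weight G) (Y' \<inter> mandatory G)"
      proof (rule sum.union_disjoint)
        show "?W \<inter> (Y' \<inter> mandatory G) = {}" using EW parts_disjoint by blast
      qed (use fin in simp_all)
      also have "sum (weight G) (Y' \<inter> mandatory G) \<le> sum (weight G) ?m"
      proof -
        have "sum (weight G) (Y' \<inter> mandatory G) \<le> sum (weight G) {m \<in> Y' \<inter> mandatory G. 0 \<le> weight G m}"
        proof -
          have "sum (weight G) (Y' \<inter> mandatory G) \<le> (\<Sum>m\<in>Y' \<inter> mandatory G. if 0 \<le> weight G m then weight G m else 0)"
            by (rule sum_mono) auto
          also have "\<dots> = sum (weight G) {m \<in> Y' \<inter> mandatory G. 0 \<le> weight G m}"
            by (rule sum.inter_filter[symmetric]) (use fin in simp)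
          finally show ?thesis .
        qed
        also have "\<dots> \<le> sum (weight G) ?m"
          by (rule sum_mono2) (use fin(1) avoid in auto)
        finally show ?thesis .
      qed
      also have "sum (weight G) ?W + sum (weight G) ?m = sum (weight G) (?W \<union> ?m)"
      proof (rule sum.union_disjoint[symmetric])
        show "?W \<inter> ?m = {}" using EW parts_disjoint by blast
      qed (use fin in simp_all)
      finally show ?thesis by simp
    qed
    ultimately show ?thesis by simp
  qed
  then have "optimal_reaction G X ?Y" using feas unfolding optimal_reaction_def by blast
  moreover have "forbidden G \<inter> ?Y = {}" using EZ parts_disjoint by blast
  moreover have "X \<subseteq> leader G" using X(1) list_sets(1) by simp
  ultimately show ?thesis unfolding rp_max_matching_def by blast
qed

theorem solve_correct:
  "solve ls (weighted (weight G) fs) (weighted (weight G) ms) (weighted (weight G) ns)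
    \<longleftrightarrow> rp_max_matching G"
proof -
  have "\<forall>e\<in>set ls. card (edge_of e) = 2"
    using G edges_eq list_sets(1) by (auto simp: rp_instances_def)
  then show ?thesis
    using solve_weighted[OF distinct_lists(1)] decides_if_rp_max_matching rp_max_matching_if_decides
    by blast
qed

end

section \<open>A computable bound in the parameter\<close>

text \<open>
  A number in unary notation is a list over the one-element type, so the list rules apply to it.
\<close>

lemma unary_list: "unary n = enc_list (\<lambda>_::unit. Leaf) (replicate n ())"
  by (simp add: unary_def enc_list_def)

lemma tree_size_unary: "tree_size (unary n) = 2 * n + 1"
  by (induction n) (simp_all add: unary_def)

lemma ptime_unary_Suc:
  assumes "ptime D \<mu> C (\<lambda>a. unary (n a))"
  shows "ptime D \<mu> C (\<lambda>a. unary (Suc (n a)))"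
  using ptime_Node[OF ptime_Leaf assms] by (simp add: unary_def)

lemma ptime_unary_add:
  assumes "ptime D \<mu> C (\<lambda>a. unary (m a))" "ptime D \<mu> C (\<lambda>a. unary (n a))"
  shows "ptime D \<mu> C (\<lambda>a. unary (m a + n a))"
  using ptime_append[OF assms[unfolded unary_list]] unfolding unary_list replicate_add .

lemma ptime_unary_mult:
  assumes m: "ptime D \<mu> C (\<lambda>a. unary (m a))" and n: "ptime D \<mu> C (\<lambda>a. unary (n a))"
  shows "ptime D \<mu> C (\<lambda>a. unary (m a * n a))"
proof -
  have "ptime D \<mu> C (\<lambda>a. unary ((\<lambda>a xs. length xs * n a) a (replicate (m a) ())))"
  proof (rule ptime_structural_recursion[where F = "\<lambda>a xs. length xs * n a" and ec = unary,
        OF m[unfolded unary_list], where bd = "\<lambda>a. tree_size (unary (m a)) * tree_size (unary (n a)) + 1"])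
    show "poly_bounded D (\<lambda>a. \<mu> a + tree_size (C a)) (\<lambda>a. tree_size (unary (m a)) * tree_size (unary (n a)) + 1)"
      by (intro poly_bounded_add poly_bounded_mult poly_bounded_const ptime_size m n)
    fix a and xs :: "unit list" assume "suffix xs (replicate (m a) ())"
    from suffix_length_le[OF this] have "length xs * n a \<le> m a * n a" by simp
    moreover have "2 * (m a * n a) \<le> (2 * m a + 1) * (2 * n a + 1)" by simp
    ultimately show "tree_size (unary (length xs * n a)) \<le> tree_size (unary (m a)) * tree_size (unary (n a)) + 1"
      unfolding tree_size_unary by linarith
  next
    show "ptime D \<mu> C (\<lambda>a. unary (length ([] :: unit list) * n a))"
      by (simp add: unary_def ptime_Leaf)
    let ?E = "{(a, x, xs). a \<in> D \<and> suffix (x # xs) (replicate (m a) ())}"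
    let ?K = "\<lambda>z. Node (C (fst z)) (Node Leaf (Node (enc_list (\<lambda>_. Leaf) (snd (snd z)))
       (unary (length (snd (snd z)) * n (fst z)))))"
    have nz: "ptime ?E (\<lambda>z. \<mu> (fst z)) ?K (\<lambda>z. unary (n (fst z)))"
      by (rule ptime_outer[OF n]) auto
    show "ptime ?E (\<lambda>z. \<mu> (fst z)) ?K (\<lambda>z. unary (length (fst (snd z) # snd (snd z)) * n (fst z)))"
      unfolding list.size mult_Suc add_Suc_right add_0_right
      by (rule ptime_unary_add[OF nz]) (rule ptime_proj)
  qed
  then show ?thesis by simp
qed

lemma ptime_unary_power2:
  assumes n: "ptime D \<mu> C (\<lambda>a. unary (n a))"
    and bd: "poly_bounded D (\<lambda>a. \<mu> a + tree_size (C a)) (\<lambda>a. 2 ^ n a)"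
  shows "ptime D \<mu> C (\<lambda>a. unary (2 ^ n a))"
proof -
  have "ptime D \<mu> C (\<lambda>a. unary ((\<lambda>a xs. 2 ^ length xs) a (replicate (n a) ())))"
  proof (rule ptime_structural_recursion[where F = "\<lambda>a xs. 2 ^ length xs" and ec = unary,
        OF n[unfolded unary_list], where bd = "\<lambda>a. 2 * 2 ^ n a + 1"])
    show "poly_bounded D (\<lambda>a. \<mu> a + tree_size (C a)) (\<lambda>a. 2 * 2 ^ n a + 1)"
      by (intro poly_bounded_add poly_bounded_mult poly_bounded_const bd)
    fix a and xs :: "unit list" assume "suffix xs (replicate (n a) ())"
    from suffix_length_le[OF this] have "(2::nat) ^ length xs \<le> 2 ^ n a"
      by (intro power_increasing) simp_all
    then show "tree_size (unary (2 ^ length xs)) \<le> 2 * 2 ^ n a + 1"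
      unfolding tree_size_unary by simp
  next
    show "ptime D \<mu> C (\<lambda>a. unary (2 ^ length ([] :: unit list)))"
      by (simp add: unary_def ptime_Leaf ptime_Node)
    let ?E = "{(a, x, xs). a \<in> D \<and> suffix (x # xs) (replicate (n a) ())}"
    have "2 ^ length (x # xs) = 2 ^ length xs + (2::nat) ^ length xs" for x :: unit and xs by simp
    then show "ptime ?E (\<lambda>z. \<mu> (fst z)) (\<lambda>z. Node (C (fst z)) (Node Leaf
       (Node (enc_list (\<lambda>_. Leaf) (snd (snd z))) (unary (2 ^ length (snd (snd z)))))))
       (\<lambda>z. unary (2 ^ length (fst (snd z) # snd (snd z))))"
      by (simp only:) (intro ptime_unary_add; rule ptime_proj)
  qed
  then show ?thesis by simp
qed

lemma ptime_unary_power: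
  assumes "ptime D \<mu> C (\<lambda>a. unary (n a))"
  shows "ptime D \<mu> C (\<lambda>a. unary (n a ^ c))"
proof (induction c)
  case 0
  show ?case by (simp add: unary_def ptime_Leaf ptime_Node)
next
  case (Suc c)
  then show ?case unfolding power_Suc by (rule ptime_unary_mult[OF assms])
qed

lemma computable_if_ptime:
  assumes "ptime UNIV \<mu> unary (\<lambda>n. unary (f n))"
  shows "computable f"
  using assms unfolding ptime_def computable_def by blast

text \<open>
  Computability asks for no time bound, so the value itself can be taken as the budget.
\<close>

lemma computable_power2_square: "computable (\<lambda>k. (2 ^ Suc (k * k)) ^ c)"
proof (rule computable_if_ptime)
  let ?\<mu> = "\<lambda>k. 2 ^ Suc (k * k)"
  have "poly_bounded UNIV (\<lambda>k. ?\<mu> k + tree_size (unary k)) (\<lambda>k. 2 ^ Suc (k * k))"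
    by (rule poly_bounded_mono[OF poly_bounded_self]) simp
  then show "ptime UNIV ?\<mu> unary (\<lambda>k. unary ((2 ^ Suc (k * k)) ^ c))"
    by (intro ptime_unary_power ptime_unary_power2 ptime_unary_Suc ptime_unary_mult ptime_id)
qed

section \<open>Fixed-parameter tractability\<close>

definition enc_input ::
  "nat list \<times> edge list \<times> weighted_edge list \<times> weighted_edge list \<times> weighted_edge list \<Rightarrow> tree" where
  "enc_input a = tree_of_list [enc_list tree_of_nat (fst a), enc_list enc_edge (fst (snd a)),
     enc_list enc_wedge (fst (snd (snd a))), enc_list enc_wedge (fst (snd (snd (snd a)))),
     enc_list enc_wedge (snd (snd (snd (snd a))))]"

lemma ptime_solve_input:
  fixes k
  defines "k \<equiv> \<lambda>a. length (fst (snd (snd a))) + length (snd (snd (snd (snd a))))"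
  shows "ptime UNIV (\<lambda>a. 2 ^ (k a * k a)) enc_input
    (\<lambda>a. tree_of_bool (solve (fst (snd a)) (fst (snd (snd a))) (fst (snd (snd (snd a)))) (snd (snd (snd (snd a))))))"
proof -
  let ?p = "ptime UNIV (\<lambda>a. 2 ^ (k a * k a)) enc_input"
  have 1: "?p (\<lambda>a. enc_list enc_edge (fst (snd a)))"
    unfolding enc_input_def tree_of_list.simps by (rule ptime_proj)
  have 2: "?p (\<lambda>a. enc_list enc_wedge (fst (snd (snd a))))"
    unfolding enc_input_def tree_of_list.simps by (rule ptime_proj)
  have 3: "?p (\<lambda>a. enc_list enc_wedge (fst (snd (snd (snd a)))))"
    unfolding enc_input_def tree_of_list.simps by (rule ptime_proj)
  have 4: "?p (\<lambda>a. enc_list enc_wedge (snd (snd (snd (snd a)))))"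
    unfolding enc_input_def tree_of_list.simps
    by (rule ptime_Node_right[OF ptime_Node_right[OF ptime_Node_right[OF ptime_Node_right[OF
          ptime_Node_left[OF ptime_id]]]]])
  show ?thesis
    by (rule ptime_solve[OF 1 2 3 4])
      (unfold k_def, rule poly_bounded_mono[OF poly_bounded_self], simp)
qed

lemma tree_of_weighted_edges_eq: "tree_of_weighted_edges d ps = enc_list enc_wedge (weighted d ps)"
  by (simp add: tree_of_weighted_edges_def enc_list_def weighted_def comp_def enc_pair_def
      tree_of_edge_def tree_of_rat_frac)

lemma tree_of_edges_eq: "tree_of_edges ps = enc_list enc_edge ps"
  by (simp add: tree_of_edges_def enc_list_def enc_pair_def[abs_def] tree_of_edge_def[abs_def])

lemma card_lists_edges: "lists_edges ps F \<Longrightarrow> card F = length ps"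
  unfolding lists_edges_def by (metis distinct_card length_map)

theorem corollary3p8:
  shows "fixed_parameter_tractable rp_instances rp_encodings rp_max_matching
           (\<lambda>G. card (forbidden G) + card (neutral G))"
proof -
  obtain P c where P: "\<And>a. \<exists>t\<le>(2 ^ ((length (fst (snd (snd a))) + length (snd (snd (snd (snd a))))) *
        (length (fst (snd (snd a))) + length (snd (snd (snd (snd a)))))) + tree_size (enc_input a) + 2) ^ c.
      runs P (enc_input a)
        (tree_of_bool (solve (fst (snd a)) (fst (snd (snd a))) (fst (snd (snd (snd a)))) (snd (snd (snd (snd a)))))) t"
    using ptime_time[OF ptime_solve_input] by (meson UNIV_I)
  show ?thesis
    unfolding fixed_parameter_tractable_def
  proof (intro exI[of _ P] exI[of _ "\<lambda>k. (2 ^ Suc (k * k)) ^ c"] exI[of _ c] conjI ballI)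
    show "computable (\<lambda>k. (2 ^ Suc (k * k)) ^ c)" by (rule computable_power2_square)
    fix G x assume G: "G \<in> rp_instances" and "x \<in> rp_encodings G"
    then obtain vs ls fs ms ns where x: "x = tree_of_list [tree_of_list (map tree_of_nat vs),
        tree_of_edges ls, tree_of_weighted_edges (weight G) fs,
        tree_of_weighted_edges (weight G) ms, tree_of_weighted_edges (weight G) ns]"
      and lists: "lists_edges ls (leader G)" "lists_edges fs (forbidden G)"
        "lists_edges ms (mandatory G)" "lists_edges ns (neutral G)"
      unfolding rp_encodings_def by blast
    let ?w = "weighted (weight G)"
    let ?k = "card (forbidden G) + card (neutral G)"
    define a where "a = (vs, ls, ?w fs, ?w ms, ?w ns)"
    have xa: "x = enc_input a"
      unfolding x a_def enc_input_def tree_of_edges_eq tree_of_weighted_edges_eq by (simp add: enc_list_def)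
    have k: "length (fst (snd (snd a))) + length (snd (snd (snd (snd a)))) = ?k"
      using card_lists_edges[OF lists(2)] card_lists_edges[OF lists(4)]
      by (simp add: a_def weighted_def)
    have yes: "solve (fst (snd a)) (fst (snd (snd a))) (fst (snd (snd (snd a)))) (snd (snd (snd (snd a))))
        \<longleftrightarrow> rp_max_matching G"
      using solve_correct[OF G lists] by (simp add: a_def)
    obtain t where t: "t \<le> (2 ^ (?k * ?k) + tree_size x + 2) ^ c"
      "runs P x (tree_of_bool (rp_max_matching G)) t"
      using P[of a] unfolding k yes xa[symmetric] by blast
    \<comment> \<open>This separates a factor that depends only on the parameter from the size of the input.\<close>
    have "2 ^ (?k * ?k) + tree_size x + 2 \<le> 2 ^ Suc (?k * ?k) * tree_size x"
    proof -
      define g s where "g = (2::nat) ^ (?k * ?k)" and "s = tree_size x"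
      have "1 \<le> g" unfolding g_def by simp
      moreover have "3 \<le> s" unfolding s_def x by simp
      ultimately obtain g' s' where "g = g' + 1" "s = s' + 3" by (metis le_add_diff_inverse2)
      then have "g + s + 2 \<le> 2 * g * s" by (simp add: algebra_simps)
      then show ?thesis unfolding g_def s_def by (simp add: mult.assoc)
    qed
    then have "(2 ^ (?k * ?k) + tree_size x + 2) ^ c \<le> (2 ^ Suc (?k * ?k) * tree_size x) ^ c"
      by (rule power_mono) simp
    with t(1) have "t \<le> (2 ^ Suc (?k * ?k)) ^ c * tree_size x ^ c"
      unfolding power_mult_distrib[symmetric] by (rule order_trans)
    moreover have "tree_of_bool (rp_max_matching G) \<noteq> Leaf \<longleftrightarrow> rp_max_matching G"
      by (cases "rp_max_matching G") simp_all
    ultimately show "\<exists>v t. runs P x v t \<and> (v \<noteq> Leaf \<longleftrightarrow> rp_max_matching G) \<and>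
        t \<le> (2 ^ Suc (?k * ?k)) ^ c * tree_size x ^ c"
      using t(2) by blast
  qed
qed

end
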